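(* Let $\mathcal{F}$ be a family of pairs $(f,g)$ of non-negative measurable functions on $\mathbb{R}^n$. Given $1<q_-<q_+<\infty$, suppose there exists $p_0$, $q_-<p_0<q_+$, such that for every $w_0\in A_{p_0/q_-}\cap RH_{(q_+/p_0)'}$, $$\int_{\mathbb{R}^n}f(x)^{p_0}w_0(x)\,dx\le C\int_{\mathbb{R}^n}g(x)^{p_0}w_0(x)\,dx,\qquad(f,g)\in\mathcal{F}.$$ Then for every $p(\cdot)\in LH$ with $q_-<p_-\le p_+<q_+$, $$\|f\|_{p(\cdot)}\le C\|g\|_{p(\cdot)},\qquad(f,g)\in\mathcal{F}.$$ More generally, for every such $p(\cdot)$ there exists $p_*$, $q_-<p_*<q_+$, such that if $\sigma=\frac{p_*q_-}{p_*-q_-}$, then there exists a constant $c=c(p_-,p_+,q_-,q_+,p_* )\in(0,1)$ so that for every weight $w$ with $w^\sigma\in A_{p(\cdot)/(c\sigma)}$, $$\|fw\|_{p(\cdot)}\le C\|gw\|_{p(\cdot)},\qquad(f,g)\in\mathcal{F}.$$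
   Context: $\mathcal{P}$ is the set of measurable $p(\cdot):\mathbb{R}^n\to[1,\infty]$; $p_-=\operatorname{ess\,inf}p$, $p_+=\operatorname{ess\,sup}p$. The conjugate exponent is defined pointwise by $1/p(x)+1/p'(x)=1$, $1/\infty=0$ (same notation for constants). With $\mathbb{R}^n_\infty=\{x:p(x)=\infty\}$, $$\|f\|_{p(\cdot)}=\inf\Big\{\lambda>0:\int_{\mathbb{R}^n\setminus\mathbb{R}^n_\infty}\Big(\frac{|f(x)|}{\lambda}\Big)^{p(x)}dx+\lambda^{-1}\|f\|_{L^\infty(\mathbb{R}^n_\infty)}\le1\Big\}.$$ $p(\cdot)\in LH$ means $p(\cdot)\in\mathcal{P}$ and there are constants $C_0$, $C_\infty>0$ and $p_\infty$ with $|p(x)-p(y)|\le\frac{C_0}{-\log|x-y|}$ for all $|x-y|<1/2$, and $|p(x)-p_\infty|\le\frac{C_\infty}{\log(e+|x|)}$ for all $x$. A weight is a non-negative measurable function. For $r(\cdot)\in\mathcal{P}$, $w\in A_{r(\cdot)}$ iff $0<w<\infty$ a.e. and $\sup_B|B|^{-1}\|w\chi_B\|_{r(\cdot)}\|w^{-1}\chi_B\|_{r'(\cdot)}<\infty$. The class $A_{p_0/q_-}$ in the hypothesis is the classical one: for a constant $1<p<\infty$, $w_0\in A_p$ iff $\sup_B\big(\frac1{|B|}\int_Bw_0\big)\big(\frac1{|B|}\int_Bw_0^{1-p'}\big)^{p-1}<\infty$. For $s>1$, $w_0\in RH_s$ iff $\sup_B\frac{(|B|^{-1}\int_Bw_0^s)^{1/s}}{|B|^{-1}\int_Bw_0}<\infty$.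 Suprema are over balls $B\subset\mathbb{R}^n$. Convention: an inequality over $(f,g)\in\mathcal{F}$ (norm or weighted integral) means that it holds, with constant independent of the pair, for every pair $(f,g)\in\mathcal{F}$ for which the left-hand side is finite. *)

theory Defs
  imports "HOL-Analysis.Analysis" "HOL-Probability.Essential_Supremum"
begin

text \<open>
  Non-negative functions are \<^typ>\<open>ennreal\<close>-valued, exponents \<^typ>\<open>ereal\<close>-valued, and
  ``measurable'' means Lebesgue measurable.  Hence \<open>|f| = f\<close>, and the convention
  \<open>0 * \<infinity> = 0\<close> of \<^typ>\<open>ennreal\<close> applies to all products.
\<close>

section \<open>Real powers and conjugate exponents\<close>

definition epowr :: "ennreal \<Rightarrow> real \<Rightarrow> ennreal" where
  "epowr x a =
     (if a = 0 then 1
      else if x = 0 then (if 0 < a then 0 else \<infinity>)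
      else if x = \<infinity> then (if 0 < a then \<infinity> else 0)
      else ennreal (enn2real x powr a))"

lemma epowr_ennreal: "0 < x \<Longrightarrow> epowr (ennreal x) a = ennreal (x powr a)"
  by (simp add: epowr_def)

text \<open>The solution \<open>p'\<close> of \<open>1/p + 1/p' = 1\<close>, used both for real constants \<open>p > 1\<close> and for
  extended exponents \<open>p \<in> [1,\<infinity>]\<close>; in \<^typ>\<open>ereal\<close> one has \<open>inverse \<infinity> = 0\<close> and
  \<open>inverse 0 = \<infinity>\<close>.\<close>

definition conj_exp :: "'a::{inverse,minus,one} \<Rightarrow> 'a" where
  "conj_exp p = inverse (1 - inverse p)"

lemma conj_exp_real: "1 < p \<Longrightarrow> 1 / p + 1 / conj_exp p = (1::real)"
  by (simp add: conj_exp_def field_simps)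

lemma conj_exp_ereal:
  fixes p :: ereal
  assumes "1 \<le> p"
  shows "1 \<le> conj_exp p" and "1 / p + 1 / conj_exp p = 1"
proof -
  have "1 \<le> conj_exp p \<and> 1 / p + 1 / conj_exp p = 1"
  proof (cases p)
    case (real r)
    then have r: "1 \<le> r" using assms by simp
    show ?thesis
    proof (cases "r = 1")
      case True
      then show ?thesis
        using real by (simp add: conj_exp_def one_ereal_def zero_ereal_def[symmetric])
    next
      case False
      then have "1 < r" using r by simp
      then show ?thesis
        using real by (simp add: conj_exp_def one_ereal_def divide_ereal_def field_simps)
    qed
  next
    case PInf
    then show ?thesis by (simp add: conj_exp_def)
  next
    case MInf
    then show ?thesis using assms by simp
  qed
  then show "1 \<le> conj_exp p" and "1 / p + 1 / conj_exp p = 1" by auto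
qed

section \<open>Variable exponents\<close>

definition exponents :: "(real ^ 'n \<Rightarrow> ereal) set" where
  "exponents = {p. p \<in> borel_measurable lebesgue \<and> (\<forall>x. 1 \<le> p x)}"

definition p_minus :: "(real ^ 'n \<Rightarrow> ereal) \<Rightarrow> ereal" where
  "p_minus p = Sup {z. AE x in lebesgue. z \<le> p x}"

definition p_plus :: "(real ^ 'n \<Rightarrow> ereal) \<Rightarrow> ereal" where
  "p_plus p = esssup lebesgue p"

text \<open>Membership forces \<open>p\<close> to be finite everywhere, since \<open>\<bar>\<infinity> - y\<bar> = \<infinity>\<close> in
  \<^typ>\<open>ereal\<close>, for \<open>y = \<infinity>\<close> as well.  For \<open>x = y\<close> the first bound reads \<open>0 \<le> 0\<close>, as
  \<open>ln 0 = 0\<close> and \<open>C0 / 0 = 0\<close>.\<close>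

definition LH :: "(real ^ 'n \<Rightarrow> ereal) set" where
  "LH = {p \<in> exponents.
     (\<exists>C0>0. \<forall>x y. dist x y < 1 / 2 \<longrightarrow> \<bar>p x - p y\<bar> \<le> ereal (C0 / (- ln (dist x y)))) \<and>
     (\<exists>Cinf>0. \<exists>pinf::real. \<forall>x. \<bar>p x - ereal pinf\<bar> \<le> ereal (Cinf / ln (exp 1 + norm x)))}"

definition var_modular :: "(real ^ 'n \<Rightarrow> ereal) \<Rightarrow> (real ^ 'n \<Rightarrow> ennreal) \<Rightarrow> real \<Rightarrow> ennreal" where
  "var_modular p f l =
     (\<integral>\<^sup>+ x\<in>{x. p x \<noteq> \<infinity>}. epowr (f x / ennreal l) (real_of_ereal (p x)) \<partial>lebesgue) +
     esssup (restrict_space lebesgue {x. p x = \<infinity>}) f / ennreal l"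

definition var_norm :: "(real ^ 'n \<Rightarrow> ereal) \<Rightarrow> (real ^ 'n \<Rightarrow> ennreal) \<Rightarrow> ennreal" where
  "var_norm p f = Inf {ennreal l |l. 0 < l \<and> var_modular p f l \<le> 1}"

section \<open>Weights\<close>

definition weight :: "(real ^ 'n \<Rightarrow> ennreal) \<Rightarrow> bool" where
  "weight w \<longleftrightarrow> w \<in> borel_measurable lebesgue"

definition A_var :: "(real ^ 'n \<Rightarrow> ereal) \<Rightarrow> (real ^ 'n \<Rightarrow> ennreal) set" where
  "A_var r = {w. weight w \<and> (AE x in lebesgue. 0 < w x \<and> w x < \<infinity>) \<and>
     (SUP (a, \<rho>) \<in> UNIV \<times> {0<..}.
        inverse (emeasure lebesgue (ball a \<rho>))
        * var_norm r (\<lambda>x. w x * indicator (ball a \<rho>) x)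
        * var_norm (\<lambda>x. conj_exp (r x)) (\<lambda>x. inverse (w x) * indicator (ball a \<rho>) x)) < \<infinity>}"

definition ball_avg :: "real ^ 'n \<Rightarrow> real \<Rightarrow> (real ^ 'n \<Rightarrow> ennreal) \<Rightarrow> ennreal" where
  "ball_avg a \<rho> h = (\<integral>\<^sup>+ x\<in>ball a \<rho>. h x \<partial>lebesgue) / emeasure lebesgue (ball a \<rho>)"

text \<open>The classical classes, for constants \<open>p, s > 1\<close>.  Because \<open>0 * \<infinity> = 0\<close>, the weights
  that are a.e. \<open>0\<close> or a.e. \<open>\<infinity>\<close> belong to both; a weighted estimate
  \<open>\<integral> f\<^sup>p w \<le> C \<integral> g\<^sup>p w\<close>, required only when the left-hand side is finite, holds trivially
  for them if \<open>w = 0\<close>, and for \<open>w = \<infinity>\<close> because then \<open>f = 0\<close> a.e.\<close>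

definition A_const :: "real \<Rightarrow> (real ^ 'n \<Rightarrow> ennreal) set" where
  "A_const p = {w. weight w \<and>
     (SUP (a, \<rho>) \<in> UNIV \<times> {0<..}.
        ball_avg a \<rho> w * epowr (ball_avg a \<rho> (\<lambda>x. epowr (w x) (1 - conj_exp p))) (p - 1)) < \<infinity>}"

definition RH :: "real \<Rightarrow> (real ^ 'n \<Rightarrow> ennreal) set" where
  "RH s = {w. weight w \<and>
     (SUP (a, \<rho>) \<in> UNIV \<times> {0<..}.
        epowr (ball_avg a \<rho> (\<lambda>x. epowr (w x) s)) (1 / s) / ball_avg a \<rho> w) < \<infinity>}"

section \<open>Inequalities over a family of pairs\<close>

definition family_ineq ::
  "((real ^ 'n \<Rightarrow> ennreal) \<times> (real ^ 'n \<Rightarrow> ennreal)) set \<Rightarrow> ((real ^ 'n \<Rightarrow> ennreal) \<Rightarrow> ennreal) \<Rightarrow> bool"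
where
  "family_ineq F N \<longleftrightarrow> (\<exists>C>0. \<forall>(f, g)\<in>F. N f < \<infinity> \<longrightarrow> N f \<le> ennreal C * N g)"

end

theory Submission
  imports Defs "HOL-Probability.Probability"
begin

text \<open>
  The hypothesis is an inequality with one fixed exponent \<open>p0\<close> and many weights; the conclusion
  concerns the norm with exponent \<open>p(\<cdot>)\<close>.  By duality the norm of \<open>f w\<close> is, up to a constant, the
  integral of \<open>(f w)\<^sup>p\<^sup>s h\<close> for a suitable \<open>h\<close> in the unit ball of the space with the exponent
  conjugate to \<open>p(\<cdot>) / ps\<close>; here \<open>h\<close> can be written down explicitly, as a power of \<open>f w\<close>.  If
  \<open>h w\<^sup>p\<^sup>s\<close> is below a weight \<open>v\<close> for which the inequality with exponent \<open>ps\<close> is known, and if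
  \<open>v w\<^sup>-\<^sup>p\<^sup>s\<close> still lies in the dual space, then \<open>f\<close> may be replaced by \<open>g\<close> and Young's inequality ends
  the proof.  Three points need an argument.

  \<^bold>\<open>The weights.\<close>  Only weights made from \<open>A\<^sub>1\<close> weights are used.  If \<open>u\<^sub>1\<close> and \<open>u\<^sub>2\<close> are \<open>A\<^sub>1\<close>, then
  \<open>u\<^sub>1\<^sup>1\<^sup>-\<^sup>P u\<^sub>2\<^sup>1\<^sup>/\<^sup>s\<close> is in \<open>A\<^sub>P\<close> and in \<open>RH\<^sub>s\<close> (\<open>A1_weight_product\<close>).  An \<open>A\<^sub>1\<close> majorant of a
  function is obtained, following Coifman and Rochberg, as the power
  \<open>(max \<psi> (M \<psi>))\<^sup>\<delta>\<close> with \<open>\<delta> < 1\<close> (\<open>A1_weight_majorant\<close>).  One application of the maximal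
  operator therefore replaces the usual iteration, and what has to be known about \<open>M\<close> is only that
  \<open>M \<psi>\<close> lies in the right space when \<open>\<psi>\<close> does.  The price, a factor \<open>1/\<delta>\<close> in the exponents, is
  paid from the strict inequalities \<open>qm < ps\<close> and \<open>p\<^sub>+ < qp\<close>.

  \<^bold>\<open>The exponent.\<close>  The exponent \<open>ps\<close> is chosen below \<open>p0\<close> and below the harmonic mean of \<open>qm\<close> and
  \<open>p\<^sub>-\<close>.  For \<open>u \<in> A\<^sub>1\<close> and \<open>v = u\<^sup>1\<^sup>-\<^sup>p\<^sup>s\<^sup>/\<^sup>q\<^sup>p\<close> the inequality with exponent \<open>ps\<close> follows from the
  one with \<open>p0\<close> by a classical argument in the space \<open>L\<^sup>r(u)\<close>, on which \<open>M\<close> is bounded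
  (\<open>limited_range_A1_weight\<close>).

  \<^bold>\<open>The maximal operator.\<close>  For a small constant \<open>k\<close> the condition \<open>w\<^sup>\<sigma> \<in> A\<^sub>p\<^sub>/\<^sub>(\<^sub>k\<^sub>\<sigma>\<^sub>)\<close> implies, by the
  log-Hoelder conditions, that \<open>w\<close> has comparable power means with the constant exponents \<open>-\<sigma>\<close>
  and \<open>p\<^sub>-/k\<close> (\<open>A_var_imp_power_means\<close>).  These exponents lie strictly beyond those needed for the
  dual space.  That room makes a direct proof possible that \<open>M\<close> maps the weighted variable space into
  itself (\<open>variable_maximal_finite\<close>): Hoelder's inequality moves the weight out of the averages, the
  variable exponent is then replaced by constants, and for constant exponents the estimate is the
  boundedness of the maximal operator of a doubling measure (\<open>weighted_maximal_majorant\<close>).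

  The constants in the hypothesis may depend on the weight in an arbitrary way.  If the
  conclusion failed, it would fail along a sequence of pairs with constants growing as fast as one
  likes; a single weight built from the whole sequence then gives a contradiction
  (\<open>family_ineqI\<close>).
\<close>

section \<open>Real powers of extended non-negative numbers\<close>

lemma ennreal_zero_top_pos_cases:
  fixes x :: ennreal
  obtains (zero) "x = 0" | (top) "x = \<infinity>" | (pos) r where "0 < r" "x = ennreal r"
  by (cases x) (auto simp: order_le_less)

lemma epowr_zero_right [simp]: "epowr x 0 = 1"
  by (simp add: epowr_def)

lemma epowr_zero_left [simp]: "0 < a \<Longrightarrow> epowr 0 a = 0"
  by (simp add: epowr_def)

lemma epowr_zero_left_neg [simp]: "a < 0 \<Longrightarrow> epowr 0 a = \<infinity>"
  by (simp add: epowr_def)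

lemma epowr_top [simp]: "0 < a \<Longrightarrow> epowr \<infinity> a = \<infinity>" "0 < a \<Longrightarrow> epowr top a = \<infinity>"
  by (simp_all add: epowr_def)

lemma epowr_top_neg [simp]: "a < 0 \<Longrightarrow> epowr \<infinity> a = 0" "a < 0 \<Longrightarrow> epowr top a = 0"
  by (simp_all add: epowr_def)

lemma epowr_one_right [simp]: "epowr x 1 = x"
  by (cases x rule: ennreal_zero_top_pos_cases) (auto simp: epowr_ennreal)

lemma epowr_one_left [simp]: "epowr 1 a = 1"
  using epowr_ennreal[of 1 a] by simp

lemma borel_measurable_epowr [measurable]:
  assumes [measurable]: "f \<in> borel_measurable M" "a \<in> borel_measurable M"
  shows "(\<lambda>x. epowr (f x) (a x)) \<in> borel_measurable M"
  unfolding epowr_def by measurable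

lemma epowr_mono:
  assumes "x \<le> y" "0 \<le> a"
  shows "epowr x a \<le> epowr y a"
proof (cases "a = 0")
  case False
  with assms show ?thesis
    by (cases x rule: ennreal_zero_top_pos_cases; cases y rule: ennreal_zero_top_pos_cases)
      (auto simp: epowr_ennreal powr_mono2 intro!: ennreal_leI simp: top_unique)
qed simp

lemma epowr_antimono:
  assumes "x \<le> y" "a \<le> 0"
  shows "epowr y a \<le> epowr x a"
proof (cases "a = 0")
  case False
  with assms show ?thesis
    by (cases x rule: ennreal_zero_top_pos_cases; cases y rule: ennreal_zero_top_pos_cases)
      (auto simp: epowr_ennreal powr_mono2' intro!: ennreal_leI simp: top_unique)
qed simp

lemma epowr_epowr: "epowr (epowr x a) b = epowr x (a * b)"
proof (cases "a = 0 \<or> b = 0")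
  case False
  then show ?thesis
    by (cases x rule: ennreal_zero_top_pos_cases)
      (auto simp: epowr_ennreal powr_powr epowr_def zero_less_mult_iff enn2real_eq_0_iff)
qed auto

lemma epowr_mult:
  assumes "0 \<le> a"
  shows "epowr (x * y) a = epowr x a * epowr y a"
proof (cases "a = 0")
  case False
  with assms show ?thesis
    by (cases x rule: ennreal_zero_top_pos_cases; cases y rule: ennreal_zero_top_pos_cases)
      (auto simp: epowr_ennreal powr_mult ennreal_mult'[symmetric] ennreal_mult_top ennreal_top_mult
         ennreal_mult_eq_top_iff)
qed simp

lemma epowr_mult_pos:
  assumes "0 < x" "x < \<infinity>" "0 < y" "y < \<infinity>"
  shows "epowr (x * y) a = epowr x a * epowr y a"
  using assms
  by (cases x rule: ennreal_zero_top_pos_cases; cases y rule: ennreal_zero_top_pos_cases)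
    (auto simp: epowr_ennreal powr_mult ennreal_mult'[symmetric])

lemma epowr_add:
  assumes "0 < x" "x < \<infinity>"
  shows "epowr x (a + b) = epowr x a * epowr x b"
  using assms by (cases x rule: ennreal_zero_top_pos_cases)
    (auto simp: epowr_ennreal powr_add ennreal_mult'[symmetric])

lemma epowr_add_nonneg:
  assumes "0 \<le> a" "0 \<le> b"
  shows "epowr x (a + b) = epowr x a * epowr x b"
proof (cases "a = 0 \<or> b = 0")
  case False
  with assms have "0 < a" "0 < b" by auto
  then show ?thesis
    by (cases x rule: ennreal_zero_top_pos_cases)
      (auto simp: epowr_ennreal powr_add ennreal_mult'[symmetric] ennreal_mult_top)
qed auto

lemma epowr_pos: "0 < x \<Longrightarrow> x < \<infinity> \<Longrightarrow> 0 < epowr x a"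
  by (cases x rule: ennreal_zero_top_pos_cases) (auto simp: epowr_ennreal)

lemma epowr_pos_nonneg: "0 < x \<Longrightarrow> 0 \<le> a \<Longrightarrow> 0 < epowr x a"
  by (cases x rule: ennreal_zero_top_pos_cases; cases "a = 0") (auto simp: epowr_ennreal)

lemma epowr_finite: "0 < x \<Longrightarrow> x < \<infinity> \<Longrightarrow> epowr x a < \<infinity>" "0 < x \<Longrightarrow> x < \<infinity> \<Longrightarrow> epowr x a < top"
  by (cases x rule: ennreal_zero_top_pos_cases, auto simp: epowr_ennreal)+

lemma epowr_finite_nonneg: "x < \<infinity> \<Longrightarrow> 0 \<le> a \<Longrightarrow> epowr x a < \<infinity>" "x < \<infinity> \<Longrightarrow> 0 \<le> a \<Longrightarrow> epowr x a < top"
  by (cases x rule: ennreal_zero_top_pos_cases; cases "a = 0"; auto simp: epowr_ennreal)+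

lemma epowr_eq_0_iff: "0 < a \<Longrightarrow> epowr x a = 0 \<longleftrightarrow> x = 0"
  by (cases x rule: ennreal_zero_top_pos_cases) (auto simp: epowr_ennreal)

lemma epowr_eq_top_iff: "0 < a \<Longrightarrow> epowr x a = \<infinity> \<longleftrightarrow> x = \<infinity>"
  by (cases x rule: ennreal_zero_top_pos_cases) (auto simp: epowr_ennreal)

lemma epowr_inverse: "epowr (inverse x) a = epowr x (- a)"
  by (cases x rule: ennreal_zero_top_pos_cases; cases "a = 0"; cases "0 < a")
     (auto simp: epowr_ennreal inverse_ennreal powr_minus inverse_powr powr_minus_divide)

lemma le_epowr_inverse:
  assumes "epowr x a \<le> y" "0 < a"
  shows "x \<le> epowr y (1 / a)"
  using epowr_mono[OF assms(1), of "1 / a"] assms(2) by (simp add: epowr_epowr)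

lemma epowr_inverse_le:
  assumes "x \<le> epowr y (1 / a)" "0 < a"
  shows "epowr x a \<le> y"
  using epowr_mono[OF assms(1), of a] assms(2) by (simp add: epowr_epowr)

text \<open>This removes a variable exponent, at the price of the sum of its two extreme values.\<close>

lemma epowr_le_endpoints:
  assumes "0 < b" "b \<le> a" "a \<le> c"
  shows "epowr x a \<le> epowr x b + epowr x c"
proof (cases x rule: ennreal_zero_top_pos_cases)
  case (pos r)
  show ?thesis
  proof (cases "1 \<le> r")
    case True
    then have "epowr x a \<le> epowr x c" using pos assms
      by (auto simp: epowr_ennreal intro!: ennreal_leI powr_mono)
    then show ?thesis by (rule order_trans) simp
  next
    case False
    then have "epowr x a \<le> epowr x b" using pos assms
      by (auto simp: epowr_ennreal intro!: ennreal_leI powr_mono')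
    then show ?thesis by (rule order_trans) simp
  qed
qed (use assms in auto)

lemma epowr_exponent_mono:
  assumes "1 \<le> x" "a \<le> b" "0 < a"
  shows "epowr x a \<le> epowr x b"
  using assms by (cases x rule: ennreal_zero_top_pos_cases)
    (auto simp: epowr_ennreal intro!: ennreal_leI powr_mono)

lemma epowr_exponent_antimono:
  assumes "x \<le> 1" "a \<le> b" "0 < a"
  shows "epowr x b \<le> epowr x a"
  using assms by (cases x rule: ennreal_zero_top_pos_cases)
    (auto simp: epowr_ennreal top_unique intro!: ennreal_leI powr_mono')

lemma epowr_sum_le:
  assumes "0 \<le> a"
  shows "epowr (x + y) a \<le> ennreal (2 powr a) * (epowr x a + epowr y a)"
proof -
  have "epowr (x + y) a \<le> epowr (2 * max x y) a"
    using assms by (intro epowr_mono) (auto simp: mult_2 intro!: add_mono)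
  also have "\<dots> = epowr 2 a * epowr (max x y) a"
    using assms by (rule epowr_mult)
  also have "epowr 2 a = ennreal (2 powr a)"
    using epowr_ennreal[of 2 a] by simp
  also have "epowr (max x y) a \<le> epowr x a + epowr y a"
    by (auto simp: max_def)
  finally show ?thesis by (simp add: mult_left_mono)
qed

lemma epowr_young:
  assumes "0 < \<theta>" "\<theta> < 1"
  shows "epowr x \<theta> * epowr y (1 - \<theta>) \<le> ennreal \<theta> * x + ennreal (1 - \<theta>) * y"
proof (cases x rule: ennreal_zero_top_pos_cases)
  case zero with assms show ?thesis by simp
next
  case top with assms show ?thesis by (simp add: ennreal_mult_top)
next
  case x: (pos r)
  show ?thesis
  proof (cases y rule: ennreal_zero_top_pos_cases)
    case zero with assms show ?thesis by simp
  next
    case top with assms show ?thesis by (simp add: ennreal_mult_top)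
  next
    case y: (pos s)
    have "r powr \<theta> * s powr (1 - \<theta>) \<le> \<theta> * r + (1 - \<theta>) * s"
      using Youngs_inequality_0[of \<theta> "1 - \<theta>" r s] assms x y by simp
    then show ?thesis using assms x y
      by (simp add: epowr_ennreal ennreal_mult[symmetric] ennreal_plus[symmetric] del: ennreal_plus)
  qed
qed

section \<open>Integral inequalities\<close>

text \<open>Hoelder's inequality in the form without exponents outside \<open>(0, 1)\<close>; Jensen's inequality and the
  comparison of power means are the cases in which one of the two functions is constant or a power of
  the other.\<close>

lemma nn_integral_Holder:
  assumes [measurable]: "f \<in> borel_measurable M" "g \<in> borel_measurable M"
    and \<theta>: "0 < \<theta>" "\<theta> < 1"
  shows "(\<integral>\<^sup>+x. epowr (f x) \<theta> * epowr (g x) (1 - \<theta>) \<partial>M)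
           \<le> epowr (\<integral>\<^sup>+x. f x \<partial>M) \<theta> * epowr (\<integral>\<^sup>+x. g x \<partial>M) (1 - \<theta>)"
proof -
  let ?I = "\<integral>\<^sup>+x. f x \<partial>M" and ?J = "\<integral>\<^sup>+x. g x \<partial>M"
  consider "?I = 0 \<or> ?J = 0" | "?I \<noteq> 0" "?J \<noteq> 0" "?I = \<infinity> \<or> ?J = \<infinity>"
    | i j where "0 < i" "?I = ennreal i" "0 < j" "?J = ennreal j"
    by (cases ?I rule: ennreal_zero_top_pos_cases; cases ?J rule: ennreal_zero_top_pos_cases) auto
  then show ?thesis
  proof cases
    case 1
    then have "AE x in M. epowr (f x) \<theta> * epowr (g x) (1 - \<theta>) = 0"
      using \<theta> by (auto simp: nn_integral_0_iff_AE elim: eventually_mono)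
    then have "(\<integral>\<^sup>+x. epowr (f x) \<theta> * epowr (g x) (1 - \<theta>) \<partial>M) = 0"
      by (subst nn_integral_0_iff_AE) auto
    then show ?thesis by simp
  next
    case 2
    then have "epowr ?I \<theta> * epowr ?J (1 - \<theta>) = \<infinity>"
      using \<theta> by (auto simp: ennreal_mult_eq_top_iff epowr_eq_0_iff epowr_eq_top_iff)
    then show ?thesis by simp
  next
    case 3
    have pt: "epowr (f x) \<theta> * epowr (g x) (1 - \<theta>) \<le>
       ennreal (i powr \<theta> * j powr (1 - \<theta>)) * (ennreal (\<theta> / i) * f x + ennreal ((1 - \<theta>) / j) * g x)" for x
    proof -
      have cancel: "y = ennreal c * (y * ennreal (1 / c))" if "0 < c" for y c
      proof -
        have "ennreal c * (y * ennreal (1 / c)) = y * (ennreal c * ennreal (1 / c))"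
          by (rule mult.left_commute)
        also have "ennreal c * ennreal (1 / c) = 1"
          using that by (simp add: ennreal_mult[symmetric])
        finally show ?thesis by simp
      qed
      have move: "ennreal t * (y * ennreal (1 / c)) = ennreal (t / c) * y" if "0 < c" "0 < t" for y c t
        using that by (simp add: divide_inverse ennreal_mult ac_simps)
      have "epowr (f x) \<theta> * epowr (g x) (1 - \<theta>)
        = ennreal (i powr \<theta> * j powr (1 - \<theta>)) * (epowr (f x * ennreal (1 / i)) \<theta> * epowr (g x * ennreal (1 / j)) (1 - \<theta>))"
        using \<theta> 3 by (subst cancel[of i "f x"], simp, subst cancel[of j "g x"], simp)
          (simp add: epowr_mult[of \<theta> "ennreal i"] epowr_mult[of "1 - \<theta>" "ennreal j"] epowr_ennreal
            ennreal_mult ac_simps)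
      also have "\<dots> \<le> ennreal (i powr \<theta> * j powr (1 - \<theta>)) *
          (ennreal \<theta> * (f x * ennreal (1 / i)) + ennreal (1 - \<theta>) * (g x * ennreal (1 / j)))"
        by (intro mult_left_mono epowr_young \<theta>) simp
      also have "ennreal \<theta> * (f x * ennreal (1 / i)) = ennreal (\<theta> / i) * f x"
        using 3 \<theta> by (simp add: move)
      also have "ennreal (1 - \<theta>) * (g x * ennreal (1 / j)) = ennreal ((1 - \<theta>) / j) * g x"
        using 3 \<theta> by (simp add: move)
      finally show ?thesis .
    qed
    have "(\<integral>\<^sup>+x. epowr (f x) \<theta> * epowr (g x) (1 - \<theta>) \<partial>M) \<le>
      (\<integral>\<^sup>+x. ennreal (i powr \<theta> * j powr (1 - \<theta>)) * (ennreal (\<theta> / i) * f x + ennreal ((1 - \<theta>) / j) * g x) \<partial>M)"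
      by (intro nn_integral_mono pt)
    also have "\<dots> = ennreal (i powr \<theta> * j powr (1 - \<theta>)) * (ennreal (\<theta> / i) * ?I + ennreal ((1 - \<theta>) / j) * ?J)"
      by (simp add: nn_integral_cmult nn_integral_add)
    also have "\<dots> = ennreal (i powr \<theta> * j powr (1 - \<theta>))"
      using 3 \<theta> by (simp add: ennreal_mult[symmetric] ennreal_plus[symmetric] del: ennreal_plus)
    also have "\<dots> = epowr ?I \<theta> * epowr ?J (1 - \<theta>)"
      using 3 by (simp add: epowr_ennreal ennreal_mult)
    finally show ?thesis .
  qed
qed

lemma (in prob_space) nn_integral_epowr_le:
  assumes [measurable]: "f \<in> borel_measurable M" and "0 < a" "a \<le> 1"
  shows "(\<integral>\<^sup>+x. epowr (f x) a \<partial>M) \<le> epowr (\<integral>\<^sup>+x. f x \<partial>M) a"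
proof (cases "a = 1")
  case False
  then show ?thesis
    using nn_integral_Holder[of f M "\<lambda>_. 1" a] assms by (simp add: emeasure_space_1)
qed simp

text \<open>Hoelder's inequality applied to \<open>1 = (f\<^sup>a)\<^sup>\<theta> (f\<^sup>-\<^sup>b)\<^sup>1\<^sup>-\<^sup>\<theta>\<close> with \<open>a \<theta> = b (1 - \<theta>)\<close>.\<close>

lemma (in prob_space) nn_integral_epowr_neg_ge:
  assumes [measurable]: "f \<in> borel_measurable M" and f: "AE x in M. 0 < f x \<and> f x < \<infinity>"
    and b: "0 < a" "0 < b"
  shows "1 \<le> epowr (\<integral>\<^sup>+x. epowr (f x) a \<partial>M) (1 / a) * epowr (\<integral>\<^sup>+x. epowr (f x) (- b) \<partial>M) (1 / b)"
proof -
  define \<theta> where "\<theta> = b / (a + b)"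
  have \<theta>: "0 < \<theta>" "\<theta> < 1" using b by (auto simp: \<theta>_def)
  have eq: "a * \<theta> + (- b) * (1 - \<theta>) = 0" using b by (simp add: \<theta>_def field_simps)
  have "1 = (\<integral>\<^sup>+x. 1 \<partial>M)" by (simp add: emeasure_space_1)
  also have "\<dots> = (\<integral>\<^sup>+x. epowr (epowr (f x) a) \<theta> * epowr (epowr (f x) (- b)) (1 - \<theta>) \<partial>M)"
  proof (rule nn_integral_cong_AE, use f in eventually_elim)
    case (elim x)
    then show ?case
      using epowr_add[of "f x" "a * \<theta>" "(- b) * (1 - \<theta>)"] by (simp only: eq epowr_epowr) simp
  qed
  also have "\<dots> \<le> epowr (\<integral>\<^sup>+x. epowr (f x) a \<partial>M) \<theta> * epowr (\<integral>\<^sup>+x. epowr (f x) (- b) \<partial>M) (1 - \<theta>)"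
    using \<theta> by (intro nn_integral_Holder) auto
  finally have "1 \<le> epowr (epowr (\<integral>\<^sup>+x. epowr (f x) a \<partial>M) \<theta> * epowr (\<integral>\<^sup>+x. epowr (f x) (- b) \<partial>M) (1 - \<theta>)) ((a + b) / (a * b))"
    using epowr_mono[of 1 _ "(a + b) / (a * b)"] b by simp
  moreover have "\<theta> * ((a + b) / (a * b)) = 1 / a" "(1 - \<theta>) * ((a + b) / (a * b)) = 1 / b"
    using b by (auto simp: \<theta>_def divide_simps)
  ultimately show ?thesis using b by (simp add: epowr_mult epowr_epowr)
qed

lemma nn_integral_exp_Ici:
  assumes "0 < a"
  shows "(\<integral>\<^sup>+s. ennreal (a * exp (- (a * s))) * indicator {c ..} s \<partial>lborel) = ennreal (exp (- (a * c)))"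
proof -
  have "(\<integral>\<^sup>+s. ennreal (a * exp (- (a * s))) * indicator {c ..} s \<partial>lborel) = ennreal (0 - (- exp (- (a * c))))"
  proof (rule nn_integral_FTC_atLeast)
    have "((\<lambda>s. exp (- (a * s))) \<longlongrightarrow> 0) at_top"
      using assms by real_asymp
    then show "((\<lambda>s. - exp (- (a * s))) \<longlongrightarrow> 0) at_top"
      using tendsto_minus by fastforce
  qed (use assms in \<open>auto intro!: derivative_eq_intros\<close>)
  then show ?thesis by simp
qed

lemma nn_integral_exp_Iic:
  assumes "0 < a"
  shows "(\<integral>\<^sup>+s. ennreal (a * exp (a * s)) * indicator {..c} s \<partial>lborel) = ennreal (exp (a * c))"
proof -
  have "(\<integral>\<^sup>+s. ennreal (a * exp (a * s)) * indicator {..c} s \<partial>lborel)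
      = (\<integral>\<^sup>+s. ennreal (a * exp (- (a * s))) * indicator {-c..} s \<partial>lborel)"
    using nn_integral_real_affine[of "\<lambda>s. ennreal (a * exp (a * s)) * indicator {..c} s" "-1" 0]
    by (auto simp: indicator_def minus_le_iff intro!: nn_integral_cong)
  then show ?thesis using nn_integral_exp_Ici[OF assms, of "-c"] by simp
qed

text \<open>The layer-cake formula for a number, with the height written as \<open>e\<^sup>-\<^sup>s\<close>: in this variable the
  integrand is smooth for every \<open>a > 0\<close>, and powers of the height are exponentials.\<close>

lemma epowr_eq_nn_integral_exp:
  assumes a: "0 < a"
  shows "epowr y a = (\<integral>\<^sup>+s. ennreal (a * exp (- (a * s))) * indicator {s. ennreal (exp (- s)) < y} s \<partial>lborel)"
proof (cases y rule: ennreal_zero_top_pos_cases)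
  case zero then show ?thesis using a by simp
next
  case top
  have "of_nat m \<le> (\<integral>\<^sup>+s. ennreal (a * exp (- (a * s))) \<partial>lborel)" for m :: nat
  proof -
    define c where "c = - ln (real m + 1) / a"
    have "of_nat m \<le> ennreal (exp (- (a * c)))"
      using a by (simp add: c_def ennreal_of_nat_eq_real_of_nat)
    also have "\<dots> = (\<integral>\<^sup>+s. ennreal (a * exp (- (a * s))) * indicator {c ..} s \<partial>lborel)"
      by (rule nn_integral_exp_Ici[OF a, symmetric])
    also have "\<dots> \<le> (\<integral>\<^sup>+s. ennreal (a * exp (- (a * s))) \<partial>lborel)"
      by (intro nn_integral_mono) (auto simp: indicator_def)
    finally show ?thesis .
  qed
  then have "(SUP m. of_nat m) \<le> (\<integral>\<^sup>+s. ennreal (a * exp (- (a * s))) \<partial>lborel)"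
    by (intro SUP_least)
  then have "(\<integral>\<^sup>+s. ennreal (a * exp (- (a * s))) \<partial>lborel) = \<infinity>"
    by (simp add: ennreal_SUP_of_nat_eq_top top_unique)
  then show ?thesis using top a by simp
next
  case (pos r)
  have "(\<integral>\<^sup>+s. ennreal (a * exp (- (a * s))) * indicator {s. ennreal (exp (- s)) < y} s \<partial>lborel)
     = (\<integral>\<^sup>+s. ennreal (a * exp (- (a * s))) * indicator {- ln r ..} s \<partial>lborel)"
  proof (rule nn_integral_cong_AE)
    have "AE s in lborel. s \<noteq> - ln r" by (rule AE_lborel_singleton)
    then show "AE s in lborel. ennreal (a * exp (- (a * s))) * indicator {s. ennreal (exp (- s)) < y} s
       = ennreal (a * exp (- (a * s))) * indicator {- ln r ..} s"
    proof eventually_elim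
      case (elim s)
      have "ennreal (exp (- s)) < y \<longleftrightarrow> - ln r \<le> s"
        using elim pos by (simp add: ennreal_less_iff) (metis exp_less_cancel_iff exp_ln minus_less_iff order_less_le)
      then show ?case by (simp add: indicator_def)
    qed
  qed
  also have "\<dots> = ennreal (exp (- (a * - ln r)))" by (rule nn_integral_exp_Ici[OF a])
  also have "\<dots> = epowr y a" using pos by (simp add: epowr_ennreal powr_def)
  finally show ?thesis by simp
qed

lemma (in sigma_finite_measure) nn_integral_epowr_layer_cake:
  assumes [measurable]: "f \<in> borel_measurable M" "g \<in> borel_measurable M" and a: "0 < a"
  shows "(\<integral>\<^sup>+x. g x * epowr (f x) a \<partial>M) =
    (\<integral>\<^sup>+s. ennreal (a * exp (- (a * s))) *
       (\<integral>\<^sup>+x. g x * indicator {x. ennreal (exp (- s)) < f x} x \<partial>M) \<partial>lborel)"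
proof -
  interpret pair_sigma_finite M "lborel :: real measure" ..
  have "(\<integral>\<^sup>+x. g x * epowr (f x) a \<partial>M) =
    (\<integral>\<^sup>+x. (\<integral>\<^sup>+s. g x * (ennreal (a * exp (- (a * s))) * indicator {x. ennreal (exp (- s)) < f x} x) \<partial>lborel) \<partial>M)"
    by (subst epowr_eq_nn_integral_exp[OF a], intro nn_integral_cong, subst nn_integral_cmult)
       (auto simp: indicator_def cong: if_cong)
  also have "\<dots> = (\<integral>\<^sup>+s. (\<integral>\<^sup>+x. g x * (ennreal (a * exp (- (a * s))) * indicator {x. ennreal (exp (- s)) < f x} x) \<partial>M) \<partial>lborel)"
    by (rule Fubini'[symmetric]) (simp add: indicator_def, measurable)
  also have "\<dots> = (\<integral>\<^sup>+s. (\<integral>\<^sup>+x. ennreal (a * exp (- (a * s))) * (g x * indicator {x. ennreal (exp (- s)) < f x} x) \<partial>M) \<partial>lborel)"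
    by (simp only: ac_simps)
  also have "\<dots> = (\<integral>\<^sup>+s. ennreal (a * exp (- (a * s))) *
       (\<integral>\<^sup>+x. g x * indicator {x. ennreal (exp (- s)) < f x} x \<partial>M) \<partial>lborel)"
    by (intro nn_integral_cong nn_integral_cmult) (simp add: indicator_def, measurable)
  finally show ?thesis .
qed

section \<open>The uncentred maximal function of a doubling measure\<close>

definition maximal_fun :: "(real ^ 'n) measure \<Rightarrow> (real ^ 'n \<Rightarrow> ennreal) \<Rightarrow> real ^ 'n \<Rightarrow> ennreal" where
  "maximal_fun \<nu> f x = (SUP (a, \<rho>) \<in> {(a, \<rho>). 0 < \<rho> \<and> x \<in> ball a \<rho>}.
     (\<integral>\<^sup>+y\<in>ball a \<rho>. f y \<partial>\<nu>) / emeasure \<nu> (ball a \<rho>))"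

lemma maximal_fun_upper:
  "0 < \<rho> \<Longrightarrow> x \<in> ball a \<rho> \<Longrightarrow>
     (\<integral>\<^sup>+y\<in>ball a \<rho>. f y \<partial>\<nu>) / emeasure \<nu> (ball a \<rho>) \<le> maximal_fun \<nu> f x"
  unfolding maximal_fun_def by (rule SUP_upper2[of "(a, \<rho>)"]) auto

lemma maximal_fun_least:
  "(\<And>a \<rho>. 0 < \<rho> \<Longrightarrow> x \<in> ball a \<rho> \<Longrightarrow>
     (\<integral>\<^sup>+y\<in>ball a \<rho>. f y \<partial>\<nu>) / emeasure \<nu> (ball a \<rho>) \<le> K) \<Longrightarrow> maximal_fun \<nu> f x \<le> K"
  unfolding maximal_fun_def by (rule SUP_least) auto

lemma less_maximal_fun_iff:
  "l < maximal_fun \<nu> f x \<longleftrightarrow> (\<exists>a \<rho>. 0 < \<rho> \<and> x \<in> ball a \<rho> \<and>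
     l < (\<integral>\<^sup>+y\<in>ball a \<rho>. f y \<partial>\<nu>) / emeasure \<nu> (ball a \<rho>))"
  unfolding maximal_fun_def by (auto simp: less_SUP_iff)

lemma open_less_maximal_fun: "open {x. l < maximal_fun \<nu> f x}"
proof -
  have "{x. l < maximal_fun \<nu> f x} = (\<Union>(a, \<rho>) \<in> {(a, \<rho>). 0 < \<rho> \<and>
     l < (\<integral>\<^sup>+y\<in>ball a \<rho>. f y \<partial>\<nu>) / emeasure \<nu> (ball a \<rho>)}. ball a \<rho>)"
    unfolding less_maximal_fun_iff by blast
  then show ?thesis by (auto intro!: open_UN)
qed

lemma borel_measurable_maximal_fun [measurable]: "maximal_fun \<nu> f \<in> borel_measurable borel"
  by (rule borel_measurableI_greater) (simp add: open_less_maximal_fun)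

lemma lebesgue_measurable_maximal_fun [measurable]: "maximal_fun \<nu> f \<in> borel_measurable lebesgue"
  by (rule measurable_completion) simp

lemma ball_sets_lebesgue [measurable, simp]: "ball a \<rho> \<in> sets lebesgue"
  by simp

text \<open>The factor \<open>5\<close> is the one of the Vitali covering lemma.\<close>

locale doubling_measure =
  fixes \<nu> :: "(real ^ 'n) measure" and D :: real
  assumes sets_eq [measurable_cong]: "sets \<nu> = sets lebesgue"
    and ball_pos: "0 < \<rho> \<Longrightarrow> 0 < emeasure \<nu> (ball a \<rho>)"
    and ball_finite: "emeasure \<nu> (ball a \<rho>) < \<infinity>"
    and doubling: "0 < \<rho> \<Longrightarrow> emeasure \<nu> (ball a (5 * \<rho>)) \<le> ennreal D * emeasure \<nu> (ball a \<rho>)"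
begin

lemma space_eq [simp]: "space \<nu> = UNIV"
  using sets_eq_imp_space_eq[OF sets_eq] by simp

sublocale sigma_finite_measure \<nu>
proof
  show "\<exists>A. countable A \<and> A \<subseteq> sets \<nu> \<and> \<Union>A = space \<nu> \<and> (\<forall>a\<in>A. emeasure \<nu> a \<noteq> \<infinity>)"
  proof (intro exI[of _ "range (\<lambda>n::nat. ball 0 (real n))"] conjI)
    show "\<Union>(range (\<lambda>n::nat. ball 0 (real n))) = space \<nu>"
      using reals_Archimedean2 by (auto simp: set_eq_iff)
    show "\<forall>a\<in>range (\<lambda>n::nat. ball 0 (real n)). emeasure \<nu> a \<noteq> \<infinity>"
      using ball_finite by (auto simp: less_top)
  qed (auto simp: sets_eq)
qed

text \<open>Vitali's lemma selects disjoint balls whose fivefold enlargements cover the level set; on each of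
  them the integral of \<open>f\<close> exceeds \<open>l\<close> times the measure.\<close>

lemma maximal_weak_type:
  assumes f [measurable]: "f \<in> borel_measurable lebesgue" and l: "0 < l"
  shows "ennreal l * emeasure \<nu> {x. ennreal l < maximal_fun \<nu> f x} \<le> ennreal D * (\<integral>\<^sup>+x. f x \<partial>\<nu>)"
proof -
  define P where "P a \<rho> \<longleftrightarrow> 0 < \<rho> \<and> ennreal l < (\<integral>\<^sup>+y\<in>ball a \<rho>. f y \<partial>\<nu>) / emeasure \<nu> (ball a \<rho>)" for a \<rho>
  \<comment> \<open>The covering lemma needs bounded radii, so the level set is exhausted by the sets \<open>U k\<close>.\<close>
  define U where "U k = (\<Union>(a, \<rho>) \<in> {(a, \<rho>). P a \<rho> \<and> \<rho> \<le> real k}. ball a \<rho>)" for k :: nat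
  have U_meas [measurable]: "U k \<in> sets \<nu>" for k
  proof -
    have "open (U k)" by (auto simp: U_def)
    then show ?thesis by (simp add: sets_eq lborelD)
  qed
  have U_le: "ennreal l * emeasure \<nu> (U k) \<le> ennreal D * (\<integral>\<^sup>+x. f x \<partial>\<nu>)" for k
  proof -
    have bd: "0 < snd i \<and> snd i \<le> real k" if "i \<in> {(a, \<rho>). P a \<rho> \<and> \<rho> \<le> real k}" for i
      using that by (auto simp: P_def)
    have cov: "U k \<subseteq> (\<Union>i\<in>{(a, \<rho>). P a \<rho> \<and> \<rho> \<le> real k}. ball (fst i) (snd i))"
      by (auto simp: U_def)
    obtain C where C: "countable C" "C \<subseteq> {(a, \<rho>). P a \<rho> \<and> \<rho> \<le> real k}"
      "pairwise (\<lambda>i j. disjnt (ball (fst i) (snd i)) (ball (fst j) (snd j))) C"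
      "U k \<subseteq> (\<Union>i\<in>C. ball (fst i) (5 * snd i))"
      using Vitali_covering_lemma_balls[OF cov bd] by blast
    have one: "ennreal l * emeasure \<nu> (ball (fst i) (5 * snd i))
        \<le> ennreal D * emeasure (density \<nu> f) (ball (fst i) (snd i))" if "i \<in> C" for i
    proof -
      have i: "P (fst i) (snd i)" using C(2) that by auto
      have "ennreal l * emeasure \<nu> (ball (fst i) (snd i)) \<le> (\<integral>\<^sup>+y\<in>ball (fst i) (snd i). f y \<partial>\<nu>)"
      proof -
        let ?m = "emeasure \<nu> (ball (fst i) (snd i))"
        have m: "0 < ?m" "?m < \<infinity>" using ball_pos[of "snd i"] ball_finite i by (auto simp: P_def)
        have "ennreal l * ?m \<le> (\<integral>\<^sup>+y\<in>ball (fst i) (snd i). f y \<partial>\<nu>) / ?m * ?m"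
          using i by (intro mult_right_mono) (auto simp: P_def)
        also have "\<dots> = (\<integral>\<^sup>+y\<in>ball (fst i) (snd i). f y \<partial>\<nu>)"
          using m by (simp add: ennreal_divide_times mult_divide_eq_ennreal)
        finally show ?thesis .
      qed
      moreover have "(\<integral>\<^sup>+y\<in>ball (fst i) (snd i). f y \<partial>\<nu>) = emeasure (density \<nu> f) (ball (fst i) (snd i))"
        by (subst emeasure_density) (auto simp: sets_eq)
      moreover have "ennreal l * emeasure \<nu> (ball (fst i) (5 * snd i))
          \<le> ennreal l * (ennreal D * emeasure \<nu> (ball (fst i) (snd i)))"
        using doubling[of "snd i" "fst i"] i by (intro mult_left_mono) (auto simp: P_def)
      ultimately show ?thesis
        using mult_left_mono[of "ennreal l * emeasure \<nu> (ball (fst i) (snd i))" _ "ennreal D"]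
        by (simp add: mult.left_commute[of "ennreal l"] order_trans)
    qed
    have "ennreal l * emeasure \<nu> (U k) \<le> ennreal l * emeasure \<nu> (\<Union>i\<in>C. ball (fst i) (5 * snd i))"
      using C(1,4) by (intro mult_left_mono emeasure_mono) (auto simp: sets_eq)
    also have "emeasure \<nu> (\<Union>i\<in>C. ball (fst i) (5 * snd i)) \<le>
        (\<integral>\<^sup>+x. (\<integral>\<^sup>+i. indicator (ball (fst i) (5 * snd i)) x \<partial>count_space C) \<partial>\<nu>)"
    proof -
      have "emeasure \<nu> (\<Union>i\<in>C. ball (fst i) (5 * snd i)) = (\<integral>\<^sup>+x. indicator (\<Union>i\<in>C. ball (fst i) (5 * snd i)) x \<partial>\<nu>)"
        using C(1) by (subst nn_integral_indicator) (auto simp: sets_eq)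
      also have "\<dots> \<le> (\<integral>\<^sup>+x. (\<integral>\<^sup>+i. indicator (ball (fst i) (5 * snd i)) x \<partial>count_space C) \<partial>\<nu>)"
      proof (rule nn_integral_mono)
        fix x
        show "indicator (\<Union>i\<in>C. ball (fst i) (5 * snd i)) x \<le>
          (\<integral>\<^sup>+i. indicator (ball (fst i) (5 * snd i)) x \<partial>count_space C :: ennreal)"
        proof (cases "x \<in> (\<Union>i\<in>C. ball (fst i) (5 * snd i))")
          case True
          then obtain i where i: "i \<in> C" "x \<in> ball (fst i) (5 * snd i)" by auto
          then show ?thesis
            using nn_integral_ge_point[OF i(1), of "\<lambda>i. indicator (ball (fst i) (5 * snd i)) x"] True
            by simp
        qed simp
      qed
      finally show ?thesis .
    qed
    also have "\<dots> = (\<integral>\<^sup>+i. emeasure \<nu> (ball (fst i) (5 * snd i)) \<partial>count_space C)"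
      using C(1) by (subst nn_integral_count_space_nn_integral) (auto simp: sets_eq intro!: nn_integral_cong)
    also have "ennreal l * \<dots> = (\<integral>\<^sup>+i. ennreal l * emeasure \<nu> (ball (fst i) (5 * snd i)) \<partial>count_space C)"
      by (simp add: nn_integral_cmult)
    also have "\<dots> \<le> (\<integral>\<^sup>+i. ennreal D * emeasure (density \<nu> f) (ball (fst i) (snd i)) \<partial>count_space C)"
      by (intro nn_integral_mono one) simp
    also have "\<dots> = ennreal D * (\<integral>\<^sup>+i. emeasure (density \<nu> f) (ball (fst i) (snd i)) \<partial>count_space C)"
      by (simp add: nn_integral_cmult)
    also have "(\<integral>\<^sup>+i. emeasure (density \<nu> f) (ball (fst i) (snd i)) \<partial>count_space C) =
        emeasure (density \<nu> f) (\<Union>i\<in>C. ball (fst i) (snd i))"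
      using C(1,3) by (subst emeasure_UN_countable)
        (auto simp: sets_eq disjoint_family_on_def pairwise_def disjnt_def)
    also have "\<dots> \<le> emeasure (density \<nu> f) (space (density \<nu> f))"
      by (rule emeasure_space)
    also have "\<dots> = (\<integral>\<^sup>+x. f x \<partial>\<nu>)"
      by (subst emeasure_density) (auto simp: sets.top[of \<nu>, simplified])
    finally show ?thesis by (simp add: mult_left_mono)
  qed
  have eq: "{x. ennreal l < maximal_fun \<nu> f x} = (\<Union>k. U k)"
  proof -
    have "\<exists>k::nat. \<rho> \<le> real k" for \<rho> by (rule real_arch_simple)
    then show ?thesis
      unfolding less_maximal_fun_iff U_def P_def by blast
  qed
  have inc: "incseq U" 
  proof (rule incseq_SucI)
    fix k show "U k \<subseteq> U (Suc k)" unfolding U_def by (rule UN_mono) auto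
  qed
  have "ennreal l * emeasure \<nu> (\<Union>k. U k) = ennreal l * (SUP k. emeasure \<nu> (U k))"
    using inc by (subst SUP_emeasure_incseq[symmetric]) auto
  also have "\<dots> = (SUP k. ennreal l * emeasure \<nu> (U k))"
    by (simp add: SUP_mult_left_ennreal)
  also have "\<dots> \<le> ennreal D * (\<integral>\<^sup>+x. f x \<partial>\<nu>)"
    by (rule SUP_least) (rule U_le)
  finally show ?thesis by (simp add: eq)
qed

text \<open>Values of \<open>f\<close> below \<open>l/2\<close> contribute at most \<open>l/2\<close> to an average, hence only the larger ones
  matter for averages above \<open>l\<close>.\<close>

lemma maximal_weak_type_truncated:
  assumes f [measurable]: "f \<in> borel_measurable lebesgue" and l: "0 < l"
  shows "emeasure \<nu> {x. ennreal l < maximal_fun \<nu> f x}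
     \<le> ennreal (2 * D / l) * (\<integral>\<^sup>+x. f x * indicator {x. ennreal l < 2 * f x} x \<partial>\<nu>)"
proof -
  define g where "g x = f x * indicator {x. ennreal l < 2 * f x} x" for x
  have [measurable]: "g \<in> borel_measurable lebesgue" unfolding g_def by measurable
  have le: "f x \<le> g x + ennreal (l / 2)" for x
  proof (cases "ennreal l < 2 * f x")
    case False
    then have "2 * f x \<le> 2 * ennreal (l / 2)"
      using l by (simp add: ennreal_mult[symmetric] flip: ennreal_numeral)
    then have "f x \<le> ennreal (l / 2)"
      by (subst (asm) ennreal_mult_le_mult_iff) auto
    then show ?thesis by (simp add: add_increasing)
  qed (simp add: g_def)
  have sub: "{x. ennreal l < maximal_fun \<nu> f x} \<subseteq> {x. ennreal (l / 2) < maximal_fun \<nu> g x}"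
  proof safe
    fix x assume "ennreal l < maximal_fun \<nu> f x"
    then obtain a \<rho> where a: "0 < \<rho>" "x \<in> ball a \<rho>"
      "ennreal l < (\<integral>\<^sup>+y\<in>ball a \<rho>. f y \<partial>\<nu>) / emeasure \<nu> (ball a \<rho>)"
      by (auto simp: less_maximal_fun_iff)
    let ?m = "emeasure \<nu> (ball a \<rho>)"
    have m: "?m \<noteq> 0" "?m \<noteq> \<infinity>" using ball_pos[OF a(1), of a] ball_finite[of a \<rho>] by auto
    have "(\<integral>\<^sup>+y\<in>ball a \<rho>. f y \<partial>\<nu>) \<le> (\<integral>\<^sup>+y. g y * indicator (ball a \<rho>) y + ennreal (l / 2) * indicator (ball a \<rho>) y \<partial>\<nu>)"
      using le by (intro nn_integral_mono) (auto simp: indicator_def)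
    also have "\<dots> = (\<integral>\<^sup>+y\<in>ball a \<rho>. g y \<partial>\<nu>) + ennreal (l / 2) * ?m"
      by (subst nn_integral_add) (auto simp: nn_integral_cmult_indicator sets_eq)
    finally have "(\<integral>\<^sup>+y\<in>ball a \<rho>. f y \<partial>\<nu>) / ?m \<le> ((\<integral>\<^sup>+y\<in>ball a \<rho>. g y \<partial>\<nu>) + ennreal (l / 2) * ?m) / ?m"
      by (rule divide_right_mono_ennreal)
    also have "\<dots> = (\<integral>\<^sup>+y\<in>ball a \<rho>. g y \<partial>\<nu>) / ?m + ennreal (l / 2)"
      using m by (simp add: add_divide_distrib_ennreal mult_divide_eq_ennreal)
    finally have "ennreal (l / 2) + ennreal (l / 2) < (\<integral>\<^sup>+y\<in>ball a \<rho>. g y \<partial>\<nu>) / ?m + ennreal (l / 2)"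
      using a(3) l by (simp add: ennreal_plus[symmetric] del: ennreal_plus)
    then have "ennreal (l / 2) < (\<integral>\<^sup>+y\<in>ball a \<rho>. g y \<partial>\<nu>) / ?m"
      by (meson add_right_mono leD not_le_imp_less)
    also have "\<dots> \<le> maximal_fun \<nu> g x"
      using a by (intro maximal_fun_upper) auto
    finally show "ennreal (l / 2) < maximal_fun \<nu> g x" .
  qed
  have [measurable]: "{x. ennreal (l / 2) < maximal_fun \<nu> g x} \<in> sets \<nu>"
    using open_less_maximal_fun[of "ennreal (l / 2)" \<nu> g] by (simp add: sets_eq lborelD)
  have "emeasure \<nu> {x. ennreal l < maximal_fun \<nu> f x} \<le> emeasure \<nu> {x. ennreal (l / 2) < maximal_fun \<nu> g x}"
    using sub by (rule emeasure_mono) simp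
  also have "\<dots> = ennreal (2 / l) * (ennreal (l / 2) * emeasure \<nu> {x. ennreal (l / 2) < maximal_fun \<nu> g x})"
    using l by (simp add: ennreal_mult[symmetric] mult.assoc[symmetric])
  also have "\<dots> \<le> ennreal (2 / l) * (ennreal D * (\<integral>\<^sup>+x. g x \<partial>\<nu>))"
    using l by (intro mult_left_mono maximal_weak_type) auto
  also have "\<dots> = ennreal (2 * D / l) * (\<integral>\<^sup>+x. g x \<partial>\<nu>)"
    using l by (simp add: mult.assoc[symmetric] ennreal_mult'[symmetric])
  finally show ?thesis unfolding g_def .
qed

text \<open>Marcinkiewicz interpolation: the truncated weak-type bound is integrated over all heights and the
  order of integration is exchanged by two applications of the layer-cake formula.\<close>

theorem maximal_strong_type:
  assumes r: "1 < r"
  shows "\<exists>C>0. \<forall>f\<in>borel_measurable lebesgue.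
    (\<integral>\<^sup>+x. epowr (maximal_fun \<nu> f x) r \<partial>\<nu>) \<le> ennreal C * (\<integral>\<^sup>+x. epowr (f x) r \<partial>\<nu>)"
proof -
  define K where "K = 2 * max D 0 * r / (r - 1) * 2 powr (r - 1)"
  have "(\<integral>\<^sup>+x. epowr (maximal_fun \<nu> f x) r \<partial>\<nu>) \<le> ennreal K * (\<integral>\<^sup>+x. epowr (f x) r \<partial>\<nu>)"
    if f [measurable]: "f \<in> borel_measurable lebesgue" for f
  proof -
    have "(\<integral>\<^sup>+x. epowr (maximal_fun \<nu> f x) r \<partial>\<nu>) =
      (\<integral>\<^sup>+s. ennreal (r * exp (- (r * s))) * emeasure \<nu> {x. ennreal (exp (- s)) < maximal_fun \<nu> f x} \<partial>lborel)"
    proof -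
      have "{x. ennreal (exp (- s)) < maximal_fun \<nu> f x} \<in> sets \<nu>" for s
        using open_less_maximal_fun[of "ennreal (exp (- s))" \<nu> f] by (simp add: sets_eq lborelD)
      then show ?thesis
        using nn_integral_epowr_layer_cake[of "maximal_fun \<nu> f" "\<lambda>_. 1" r] r by simp
    qed
    also have "\<dots> \<le> (\<integral>\<^sup>+s. ennreal (2 * max D 0 * r / (r - 1)) * (ennreal ((r - 1) * exp (- ((r - 1) * s))) *
         (\<integral>\<^sup>+x. f x * indicator {x. ennreal (exp (- s)) < 2 * f x} x \<partial>\<nu>)) \<partial>lborel)"
    proof (rule nn_integral_mono)
      fix s :: real
      let ?J = "\<integral>\<^sup>+x. f x * indicator {x. ennreal (exp (- s)) < 2 * f x} x \<partial>\<nu>"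
      have "ennreal (r * exp (- (r * s))) * emeasure \<nu> {x. ennreal (exp (- s)) < maximal_fun \<nu> f x}
        \<le> ennreal (r * exp (- (r * s))) * (ennreal (2 * max D 0 / exp (- s)) * ?J)"
        by (intro mult_left_mono order_trans[OF maximal_weak_type_truncated] mult_right_mono ennreal_leI divide_right_mono) auto
      also have "\<dots> = ennreal (r * exp (- (r * s)) * (2 * max D 0 / exp (- s))) * ?J"
        using r by (subst ennreal_mult) (auto simp: mult.assoc)
      also have "r * exp (- (r * s)) * (2 * max D 0 / exp (- s)) =
          (2 * max D 0 * r / (r - 1)) * ((r - 1) * exp (- ((r - 1) * s)))"
        using r by (simp add: exp_minus exp_diff left_diff_distrib field_simps)
      also have "ennreal ((2 * max D 0 * r / (r - 1)) * ((r - 1) * exp (- ((r - 1) * s)))) * ?J =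
          ennreal (2 * max D 0 * r / (r - 1)) * (ennreal ((r - 1) * exp (- ((r - 1) * s))) * ?J)"
        using r by (subst ennreal_mult) (auto simp: mult.assoc)
      finally show "ennreal (r * exp (- (r * s))) * emeasure \<nu> {x. ennreal (exp (- s)) < maximal_fun \<nu> f x}
        \<le> ennreal (2 * max D 0 * r / (r - 1)) * (ennreal ((r - 1) * exp (- ((r - 1) * s))) * ?J)" .
    qed
    also have "\<dots> = ennreal (2 * max D 0 * r / (r - 1)) * (\<integral>\<^sup>+s. (ennreal ((r - 1) * exp (- ((r - 1) * s))) *
         (\<integral>\<^sup>+x. f x * indicator {x. ennreal (exp (- s)) < 2 * f x} x \<partial>\<nu>)) \<partial>lborel)"
      by (rule nn_integral_cmult) measurable
    also have "(\<integral>\<^sup>+s. (ennreal ((r - 1) * exp (- ((r - 1) * s))) *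
         (\<integral>\<^sup>+x. f x * indicator {x. ennreal (exp (- s)) < 2 * f x} x \<partial>\<nu>)) \<partial>lborel)
       = (\<integral>\<^sup>+x. f x * epowr (2 * f x) (r - 1) \<partial>\<nu>)"
      using r by (subst nn_integral_epowr_layer_cake) auto
    also have "\<dots> = (\<integral>\<^sup>+x. ennreal (2 powr (r - 1)) * epowr (f x) r \<partial>\<nu>)"
    proof (rule nn_integral_cong)
      fix x
      have "epowr 2 (r - 1) = ennreal (2 powr (r - 1))"
        using epowr_ennreal[of 2 "r - 1"] by simp
      moreover have "f x * epowr (f x) (r - 1) = epowr (f x) r"
        using epowr_add_nonneg[of 1 "r - 1" "f x"] r by simp
      ultimately show "f x * epowr (2 * f x) (r - 1) = ennreal (2 powr (r - 1)) * epowr (f x) r"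
        using r mult.left_commute[of "f x" "ennreal (2 powr (r - 1))" "epowr (f x) (r - 1)"]
        by (simp add: epowr_mult)
    qed
    also have "\<dots> = ennreal (2 powr (r - 1)) * (\<integral>\<^sup>+x. epowr (f x) r \<partial>\<nu>)"
      by (rule nn_integral_cmult) measurable
    also have "ennreal (2 * max D 0 * r / (r - 1)) * \<dots> = ennreal K * (\<integral>\<^sup>+x. epowr (f x) r \<partial>\<nu>)"
      unfolding K_def using r by (subst ennreal_mult) (auto simp: mult.assoc)
    finally show ?thesis .
  qed
  moreover have K: "ennreal K \<le> ennreal (max K 1)" by (rule ennreal_leI) simp
  ultimately show ?thesis
    by (intro exI[of _ "max K 1"] conjI ballI order_trans[OF _ mult_right_mono[OF K]]) auto
qed

end

section \<open>Averages over balls\<close>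

text \<open>The volume of a ball should stay an opaque constant in simplification.\<close>

declare emeasure_completion [simp del]

lemma ennreal_le_divideI:
  assumes "ennreal q * x \<le> y" "0 < q"
  shows "x \<le> y / ennreal q"
proof -
  have "x = x * ennreal q / ennreal q" using assms(2) by (simp add: mult_divide_eq_ennreal)
  also have "\<dots> \<le> y / ennreal q"
    using assms(1) by (intro divide_right_mono_ennreal) (simp add: mult.commute)
  finally show ?thesis .
qed

lemma emeasure_lebesgue_ball:
  fixes a :: "real ^ 'n"
  assumes "0 \<le> \<rho>"
  shows "emeasure lebesgue (ball a \<rho>) = ennreal (unit_ball_vol (real CARD('n)) * \<rho> ^ CARD('n))"
  using emeasure_ball[OF assms, of a] by (simp add: emeasure_completion)

lemma emeasure_lebesgue_ball_pos:
  assumes "0 < \<rho>" shows "0 < emeasure lebesgue (ball (a :: real ^ 'n) \<rho>)"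
  using assms by (subst emeasure_lebesgue_ball) auto

lemma emeasure_lebesgue_ball_finite: "emeasure lebesgue (ball (a :: real ^ 'n) \<rho>) < \<infinity>"
proof (cases "0 \<le> \<rho>")
  case True
  then show ?thesis by (subst emeasure_lebesgue_ball) auto
next
  case False
  then have "ball a \<rho> = {}" by (intro ball_empty) simp
  then show ?thesis by (simp only: emeasure_empty) simp
qed

lemma emeasure_lebesgue_ball_scale:
  fixes a b :: "real ^ 'n"
  assumes "0 \<le> k" "0 \<le> \<rho>"
  shows "emeasure lebesgue (ball a (k * \<rho>)) = ennreal (k ^ CARD('n)) * emeasure lebesgue (ball b \<rho>)"
proof -
  have "k ^ CARD('n) * (unit_ball_vol (real CARD('n)) * \<rho> ^ CARD('n)) =
      unit_ball_vol (real CARD('n)) * (k * \<rho>) ^ CARD('n)"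
    by (simp add: power_mult_distrib)
  then show ?thesis
    using assms by (subst (1 2) emeasure_lebesgue_ball) (auto simp: ennreal_mult'[symmetric])
qed

interpretation lebesgue_doubling: doubling_measure "lebesgue :: (real ^ 'n) measure" "5 ^ CARD('n)"
proof
  fix \<rho> :: real and a :: "real ^ 'n"
  show "emeasure lebesgue (ball a (5 * \<rho>)) \<le> ennreal (5 ^ CARD('n)) * emeasure lebesgue (ball a \<rho>)"
    if "0 < \<rho>"
    using emeasure_lebesgue_ball_scale[of 5 \<rho> a a] that by simp
qed (rule refl emeasure_lebesgue_ball_pos emeasure_lebesgue_ball_finite | assumption)+

abbreviation max_fun :: "(real ^ 'n \<Rightarrow> ennreal) \<Rightarrow> real ^ 'n \<Rightarrow> ennreal" where
  "max_fun \<equiv> maximal_fun lebesgue"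

lemma ball_avg_le_max_fun: "0 < \<rho> \<Longrightarrow> x \<in> ball a \<rho> \<Longrightarrow> ball_avg a \<rho> f \<le> max_fun f x"
  unfolding ball_avg_def by (rule maximal_fun_upper)

lemma max_fun_least:
  "(\<And>a \<rho>. 0 < \<rho> \<Longrightarrow> x \<in> ball a \<rho> \<Longrightarrow> ball_avg a \<rho> f \<le> K) \<Longrightarrow> max_fun f x \<le> K"
  unfolding ball_avg_def by (rule maximal_fun_least)

text \<open>An average is an integral over a probability space, which makes the inequalities above available.\<close>

lemma ball_avg_eq_uniform:
  "h \<in> borel_measurable lebesgue \<Longrightarrow>
     ball_avg a \<rho> h = (\<integral>\<^sup>+x. h x \<partial>uniform_measure lebesgue (ball a \<rho>))"
  by (simp add: ball_avg_def nn_integral_uniform_measure)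

lemma prob_space_ball: "0 < \<rho> \<Longrightarrow> prob_space (uniform_measure lebesgue (ball (a :: real ^ 'n) \<rho>))"
  using emeasure_lebesgue_ball_pos[of \<rho> a] emeasure_lebesgue_ball_finite[of a \<rho>]
  by (intro prob_space_uniform_measure) auto

lemma AE_ball: "AE x in lebesgue. P x \<Longrightarrow> AE x in uniform_measure lebesgue (ball (a :: real ^ 'n) \<rho>). P x"
  by (rule AE_uniform_measureI) auto

lemma ball_avg_mono_AE:
  "AE x in lebesgue. x \<in> ball a \<rho> \<longrightarrow> f x \<le> g x \<Longrightarrow> ball_avg a \<rho> f \<le> ball_avg a \<rho> g"
  unfolding ball_avg_def
  by (intro divide_right_mono_ennreal nn_integral_mono_AE) (auto elim!: eventually_mono simp: indicator_def)

lemma ball_avg_cong_AE: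
  "AE x in lebesgue. x \<in> ball a \<rho> \<longrightarrow> f x = g x \<Longrightarrow> ball_avg a \<rho> f = ball_avg a \<rho> g"
  by (intro antisym ball_avg_mono_AE) (auto elim!: eventually_mono)

lemma ball_avg_cmult:
  assumes [measurable]: "f \<in> borel_measurable lebesgue"
  shows "ball_avg a \<rho> (\<lambda>x. c * f x) = c * ball_avg a \<rho> f"
  by (simp add: ball_avg_eq_uniform nn_integral_cmult)

lemma ball_avg_add:
  assumes [measurable]: "f \<in> borel_measurable lebesgue" "g \<in> borel_measurable lebesgue"
  shows "ball_avg a \<rho> (\<lambda>x. f x + g x) = ball_avg a \<rho> f + ball_avg a \<rho> g"
  by (simp add: ball_avg_eq_uniform nn_integral_add)

lemma ball_avg_const:
  assumes "0 < \<rho>" shows "ball_avg (a :: real ^ 'n) \<rho> (\<lambda>_. c) = c"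
proof -
  interpret prob_space "uniform_measure lebesgue (ball a \<rho>)" by (rule prob_space_ball[OF assms])
  show ?thesis using emeasure_space_1 by (simp add: ball_avg_eq_uniform del: emeasure_uniform_measure)
qed

lemma ball_avg_Holder:
  assumes [measurable]: "f \<in> borel_measurable lebesgue" "g \<in> borel_measurable lebesgue" and "0 < \<theta>" "\<theta> < 1"
  shows "ball_avg a \<rho> (\<lambda>x. epowr (f x) \<theta> * epowr (g x) (1 - \<theta>))
           \<le> epowr (ball_avg a \<rho> f) \<theta> * epowr (ball_avg a \<rho> g) (1 - \<theta>)"
  using assms by (simp add: ball_avg_eq_uniform nn_integral_Holder)

lemma ball_avg_epowr_le:
  assumes [measurable]: "f \<in> borel_measurable lebesgue" and "0 < a" "a \<le> 1" "0 < \<rho>"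
  shows "ball_avg c \<rho> (\<lambda>x. epowr (f x) a) \<le> epowr (ball_avg (c :: real ^ 'n) \<rho> f) a"
proof -
  interpret prob_space "uniform_measure lebesgue (ball c \<rho>)" by (rule prob_space_ball) fact
  show ?thesis using assms by (simp add: ball_avg_eq_uniform nn_integral_epowr_le)
qed

lemma ball_avg_power_mean:
  assumes [measurable]: "f \<in> borel_measurable lebesgue" and "0 < a" "a \<le> b" "0 < \<rho>"
  shows "epowr (ball_avg c \<rho> (\<lambda>x. epowr (f x) a)) (1 / a)
    \<le> epowr (ball_avg (c :: real ^ 'n) \<rho> (\<lambda>x. epowr (f x) b)) (1 / b)"
proof -
  have "ball_avg c \<rho> (\<lambda>x. epowr (epowr (f x) b) (a / b)) \<le> epowr (ball_avg c \<rho> (\<lambda>x. epowr (f x) b)) (a / b)"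
    using assms by (intro ball_avg_epowr_le) auto
  then have "ball_avg c \<rho> (\<lambda>x. epowr (f x) a) \<le> epowr (ball_avg c \<rho> (\<lambda>x. epowr (f x) b)) (a / b)"
    using assms by (simp add: epowr_epowr)
  from epowr_mono[OF this, of "1 / a"] show ?thesis
    using assms by (simp add: epowr_epowr)
qed

lemma ball_avg_power_mean_neg:
  assumes [measurable]: "f \<in> borel_measurable lebesgue" and "AE x in lebesgue. 0 < f x \<and> f x < \<infinity>"
    and "0 < a" "0 < b" "0 < \<rho>"
  shows "1 \<le> epowr (ball_avg (c :: real ^ 'n) \<rho> (\<lambda>x. epowr (f x) a)) (1 / a)
    * epowr (ball_avg c \<rho> (\<lambda>x. epowr (f x) (- b))) (1 / b)"
proof -
  interpret prob_space "uniform_measure lebesgue (ball c \<rho>)" by (rule prob_space_ball) fact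
  show ?thesis using assms by (simp add: ball_avg_eq_uniform nn_integral_epowr_neg_ge AE_ball)
qed

lemma ball_avg_pos:
  assumes [measurable]: "f \<in> borel_measurable lebesgue" and f: "AE x in lebesgue. 0 < f x" and "0 < \<rho>"
  shows "0 < ball_avg (c :: real ^ 'n) \<rho> f"
proof (rule ccontr)
  interpret prob_space "uniform_measure lebesgue (ball c \<rho>)" by (rule prob_space_ball) fact
  assume "\<not> 0 < ball_avg c \<rho> f"
  then have "AE x in uniform_measure lebesgue (ball c \<rho>). f x = 0"
    by (simp add: ball_avg_eq_uniform nn_integral_0_iff_AE)
  with AE_ball[OF f] have "AE x in uniform_measure lebesgue (ball c \<rho>). False"
    by eventually_elim auto
  then show False by simp
qed

lemma ball_avg_mult_volume:
  assumes "0 < \<rho>"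
  shows "ball_avg (c :: real ^ 'n) \<rho> f * emeasure lebesgue (ball c \<rho>) = (\<integral>\<^sup>+x\<in>ball c \<rho>. f x \<partial>lebesgue)"
  unfolding ball_avg_def
  using emeasure_lebesgue_ball_pos[OF assms, of c] emeasure_lebesgue_ball_finite[of c \<rho>]
  by (simp add: ennreal_divide_times mult_divide_eq_ennreal)

lemma ball_avg_le_larger:
  fixes a b :: "real ^ 'n"
  assumes "0 < \<rho>" "0 < k" "ball a \<rho> \<subseteq> ball b (k * \<rho>)"
  shows "ball_avg a \<rho> f \<le> ennreal (k ^ CARD('n)) * ball_avg b (k * \<rho>) f"
proof -
  let ?v = "emeasure lebesgue (ball a \<rho>)"
  have v: "0 < ?v" "?v < \<infinity>" using emeasure_lebesgue_ball_pos[OF assms(1), of a] emeasure_lebesgue_ball_finite by auto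
  have "(\<integral>\<^sup>+x\<in>ball a \<rho>. f x \<partial>lebesgue) \<le> (\<integral>\<^sup>+x\<in>ball b (k * \<rho>). f x \<partial>lebesgue)"
    using assms(3) by (intro nn_integral_mono) (auto simp: indicator_def)
  also have "\<dots> = ball_avg b (k * \<rho>) f * emeasure lebesgue (ball b (k * \<rho>))"
    using assms by (subst ball_avg_mult_volume) auto
  also have "emeasure lebesgue (ball b (k * \<rho>)) = ennreal (k ^ CARD('n)) * ?v"
    using assms by (intro emeasure_lebesgue_ball_scale) auto
  finally have "(\<integral>\<^sup>+x\<in>ball a \<rho>. f x \<partial>lebesgue) \<le> ?v * (ennreal (k ^ CARD('n)) * ball_avg b (k * \<rho>) f)"
    by (simp add: ac_simps)
  then show ?thesis unfolding ball_avg_def[of a] using v by (intro divide_le_posI_ennreal) auto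
qed

section \<open>Weights with the \<open>A\<^sub>1\<close> property\<close>

text \<open>The bound is required at every point of the ball instead of almost everywhere.  The weights
  constructed below have this property, and no exceptional sets depending on the ball arise.\<close>

definition A1_weight :: "(real ^ 'n \<Rightarrow> ennreal) \<Rightarrow> bool" where
  "A1_weight u \<longleftrightarrow> u \<in> borel_measurable lebesgue \<and> (AE x in lebesgue. 0 < u x \<and> u x < \<infinity>) \<and>
     (\<exists>C>0. \<forall>a \<rho> x. 0 < \<rho> \<longrightarrow> x \<in> ball a \<rho> \<longrightarrow> ball_avg a \<rho> u \<le> ennreal C * u x)"

lemma A1_weightE:
  assumes "A1_weight u"
  obtains C where "0 < C" "\<And>a \<rho> x. 0 < \<rho> \<Longrightarrow> x \<in> ball a \<rho> \<Longrightarrow> ball_avg a \<rho> u \<le> ennreal C * u x"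
  using assms unfolding A1_weight_def by blast

lemma A1_weight_measurable: "A1_weight u \<Longrightarrow> u \<in> borel_measurable lebesgue"
  and A1_weight_AE: "A1_weight u \<Longrightarrow> AE x in lebesgue. 0 < u x \<and> u x < \<infinity>"
  by (auto simp: A1_weight_def)

lemma ball_ex_AE:
  assumes "AE x in lebesgue. P x" "0 < \<rho>"
  obtains x where "x \<in> ball (a :: real ^ 'n) \<rho>" "P x"
proof -
  have "\<exists>x\<in>ball a \<rho>. P x"
  proof (rule ccontr)
    assume "\<not> (\<exists>x\<in>ball a \<rho>. P x)"
    then have "AE x in lebesgue. x \<notin> ball a \<rho>" using assms(1) by (auto elim!: eventually_mono)
    then have "emeasure lebesgue (ball a \<rho>) = 0" by (subst (asm) AE_iff_measurable[where N = "ball a \<rho>"]) auto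
    then show False using emeasure_lebesgue_ball_pos[OF assms(2), of a] by simp
  qed
  then show thesis using that by blast
qed

lemma A1_weight_avg_real:
  assumes u: "A1_weight u" and "0 < \<rho>"
  obtains r where "0 < r" "ball_avg (a :: real ^ 'n) \<rho> u = ennreal r"
proof -
  obtain C where C: "0 < C" "\<And>a \<rho> x. 0 < \<rho> \<Longrightarrow> x \<in> ball a \<rho> \<Longrightarrow> ball_avg a \<rho> u \<le> ennreal C * u x"
    using A1_weightE[OF u] by blast
  obtain x where x: "x \<in> ball a \<rho>" "0 < u x \<and> u x < \<infinity>"
    using ball_ex_AE[OF A1_weight_AE[OF u] assms(2)] by blast
  have "ball_avg a \<rho> u < \<infinity>"
    using C(2)[OF assms(2) x(1)] x(2) by (auto simp: ennreal_mult_less_top le_less_trans)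
  moreover have "0 < ball_avg a \<rho> u"
    using A1_weight_AE[OF u] assms(2) by (intro ball_avg_pos A1_weight_measurable[OF u]) (auto elim!: eventually_mono)
  ultimately show thesis using that by (cases "ball_avg a \<rho> u" rule: ennreal_zero_top_pos_cases) auto
qed

text \<open>The average over the large ball is at most a multiple of \<open>u\<close> at each point of the small ball, hence
  of the average over the small ball.\<close>

lemma A1_weight_doubling:
  fixes u :: "real ^ 'n \<Rightarrow> ennreal"
  assumes u: "A1_weight u"
  shows "\<exists>D. doubling_measure (density lebesgue u) D"
proof -
  note [measurable] = A1_weight_measurable[OF u]
  obtain C where C: "0 < C" "\<And>a \<rho> x. 0 < \<rho> \<Longrightarrow> x \<in> ball a \<rho> \<Longrightarrow> ball_avg a \<rho> u \<le> ennreal C * u x"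
    using A1_weightE[OF u] by blast
  have dens: "emeasure (density lebesgue u) (ball a \<rho>) = ball_avg a \<rho> u * emeasure lebesgue (ball a \<rho>)" if "0 < \<rho>" for a \<rho>
    using that by (simp add: emeasure_density ball_avg_mult_volume)
  show ?thesis
  proof (intro exI[of _ "C * 5 ^ CARD('n)"], standard)
    fix \<rho> :: real and a :: "real ^ 'n"
    show "sets (density lebesgue u) = sets lebesgue" by simp
    { assume \<rho>: "0 < \<rho>"
      obtain r where r: "0 < r" "ball_avg a \<rho> u = ennreal r"
        using A1_weight_avg_real[OF u \<rho>] by blast
      show "0 < emeasure (density lebesgue u) (ball a \<rho>)"
        using dens[OF \<rho>, of a] emeasure_lebesgue_ball_pos[OF \<rho>, of a] r by (simp add: ennreal_zero_less_mult_iff)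
      have "ball_avg a (5 * \<rho>) u = ball_avg a \<rho> (\<lambda>_. ball_avg a (5 * \<rho>) u)"
        using \<rho> by (simp add: ball_avg_const)
      also have "\<dots> \<le> ball_avg a \<rho> (\<lambda>x. ennreal C * u x)"
        using \<rho> C(2)[of "5 * \<rho>" _ a] by (intro ball_avg_mono_AE AE_I2) auto
      also have "\<dots> = ennreal C * ball_avg a \<rho> u" by (rule ball_avg_cmult) simp
      finally have "ball_avg a (5 * \<rho>) u * emeasure lebesgue (ball a (5 * \<rho>)) \<le>
         ennreal C * ball_avg a \<rho> u * (ennreal (5 ^ CARD('n)) * emeasure lebesgue (ball a \<rho>))"
        using \<rho> by (subst emeasure_lebesgue_ball_scale[of 5 \<rho> a a]) (auto intro: mult_mono)
      then show "emeasure (density lebesgue u) (ball a (5 * \<rho>)) \<le>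
        ennreal (C * 5 ^ CARD('n)) * emeasure (density lebesgue u) (ball a \<rho>)"
        using \<rho> C(1) by (simp add: dens ennreal_mult ac_simps) }
    show "emeasure (density lebesgue u) (ball a \<rho>) < \<infinity>"
    proof (cases "0 < \<rho>")
      case True
      obtain r where r: "0 < r" "ball_avg a \<rho> u = ennreal r"
        using A1_weight_avg_real[OF u True] by blast
      then show ?thesis using dens[OF True, of a] emeasure_lebesgue_ball_finite[of a \<rho>]
        by (simp add: ennreal_mult_less_top)
    next
      case False
      then have "ball a \<rho> = {}" by (intro ball_empty) simp
      then show ?thesis by (simp only: emeasure_empty) simp
    qed
  qed
qed

text \<open>With respect to an \<open>A\<^sub>1\<close> weight \<open>u\<close> the Lebesgue average is controlled by the average for the
  measure \<open>u dx\<close>, because \<open>u\<close> is bounded below by a multiple of its own average.\<close>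

lemma A1_weight_maximal_bound:
  fixes u :: "real ^ 'n \<Rightarrow> ennreal"
  assumes u: "A1_weight u" and r: "1 < r"
  shows "\<exists>C>0. \<forall>\<psi>\<in>borel_measurable lebesgue.
    (\<integral>\<^sup>+x. epowr (max_fun \<psi> x) r * u x \<partial>lebesgue) \<le> ennreal C * (\<integral>\<^sup>+x. epowr (\<psi> x) r * u x \<partial>lebesgue)"
proof -
  note [measurable] = A1_weight_measurable[OF u]
  obtain D where "doubling_measure (density lebesgue u) D" using A1_weight_doubling[OF u] by blast
  then interpret \<nu>: doubling_measure "density lebesgue u" D .
  obtain C where C: "0 < C" "\<And>a \<rho> x. 0 < \<rho> \<Longrightarrow> x \<in> ball a \<rho> \<Longrightarrow> ball_avg a \<rho> u \<le> ennreal C * u x"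
    using A1_weightE[OF u] by blast
  obtain K where K: "0 < K" "\<And>f. f \<in> borel_measurable lebesgue \<Longrightarrow>
    (\<integral>\<^sup>+x. epowr (maximal_fun (density lebesgue u) f x) r \<partial>density lebesgue u) \<le>
     ennreal K * (\<integral>\<^sup>+x. epowr (f x) r \<partial>density lebesgue u)"
    using \<nu>.maximal_strong_type[OF r] by blast
  have pt: "max_fun \<psi> x \<le> ennreal C * maximal_fun (density lebesgue u) \<psi> x"
    if [measurable]: "\<psi> \<in> borel_measurable lebesgue" for \<psi> :: "real ^ 'n \<Rightarrow> ennreal" and x
  proof (rule max_fun_least)
    fix a :: "real ^ 'n" and \<rho> :: real assume \<rho>: "0 < \<rho>" and x: "x \<in> ball a \<rho>"
    obtain q where q: "0 < q" "ball_avg a \<rho> u = ennreal q" using A1_weight_avg_real[OF u \<rho>] by blast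
    let ?v = "emeasure lebesgue (ball a \<rho>)"
    have v: "0 < ?v" "?v < \<infinity>" using emeasure_lebesgue_ball_pos[OF \<rho>, of a] emeasure_lebesgue_ball_finite by auto
    have "ennreal q * ball_avg a \<rho> \<psi> = ball_avg a \<rho> (\<lambda>y. ennreal q * \<psi> y)"
      by (rule ball_avg_cmult[symmetric]) simp
    also have "\<dots> \<le> ball_avg a \<rho> (\<lambda>y. ennreal C * (\<psi> y * u y))"
      using C(2)[OF \<rho>, of _ a] q(2)
      by (intro ball_avg_mono_AE AE_I2) (auto simp: mult.left_commute[of "ennreal C"] mult.commute[of "ennreal q"] intro: mult_left_mono)
    also have "\<dots> = ennreal C * ball_avg a \<rho> (\<lambda>y. \<psi> y * u y)" by (rule ball_avg_cmult) simp
    also have "ball_avg a \<rho> (\<lambda>y. \<psi> y * u y) = (\<integral>\<^sup>+y\<in>ball a \<rho>. \<psi> y \<partial>density lebesgue u) / ?v"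
      by (simp add: ball_avg_def nn_integral_density ac_simps)
    finally have *: "ball_avg a \<rho> \<psi> \<le> ennreal C * ((\<integral>\<^sup>+y\<in>ball a \<rho>. \<psi> y \<partial>density lebesgue u) / ?v) / ennreal q"
      using q(1) by (intro ennreal_le_divideI)
    have "emeasure (density lebesgue u) (ball a \<rho>) = ennreal q * ?v"
      using \<rho> q by (simp add: emeasure_density ball_avg_mult_volume[symmetric])
    then have "ennreal C * ((\<integral>\<^sup>+y\<in>ball a \<rho>. \<psi> y \<partial>density lebesgue u) / ?v) / ennreal q
      = ennreal C * ((\<integral>\<^sup>+y\<in>ball a \<rho>. \<psi> y \<partial>density lebesgue u) / emeasure (density lebesgue u) (ball a \<rho>))"
      using q v by (simp add: divide_ennreal_def ennreal_inverse_mult ac_simps)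
    also have "\<dots> \<le> ennreal C * maximal_fun (density lebesgue u) \<psi> x"
      using \<rho> x by (intro mult_left_mono maximal_fun_upper) auto
    finally show "ball_avg a \<rho> \<psi> \<le> ennreal C * maximal_fun (density lebesgue u) \<psi> x"
      using * by simp
  qed
  have "(\<integral>\<^sup>+x. epowr (max_fun \<psi> x) r * u x \<partial>lebesgue) \<le> ennreal (C powr r * K) * (\<integral>\<^sup>+x. epowr (\<psi> x) r * u x \<partial>lebesgue)"
    if [measurable]: "\<psi> \<in> borel_measurable lebesgue" for \<psi> :: "real ^ 'n \<Rightarrow> ennreal"
  proof -
    have "(\<integral>\<^sup>+x. epowr (max_fun \<psi> x) r * u x \<partial>lebesgue) = (\<integral>\<^sup>+x. epowr (max_fun \<psi> x) r \<partial>density lebesgue u)"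
      by (simp add: nn_integral_density mult.commute)
    also have "\<dots> \<le> (\<integral>\<^sup>+x. ennreal (C powr r) * epowr (maximal_fun (density lebesgue u) \<psi> x) r \<partial>density lebesgue u)"
    proof (rule nn_integral_mono)
      fix x
      have "epowr (max_fun \<psi> x) r \<le> epowr (ennreal C * maximal_fun (density lebesgue u) \<psi> x) r"
        using r by (intro epowr_mono pt) auto
      then show "epowr (max_fun \<psi> x) r \<le> ennreal (C powr r) * epowr (maximal_fun (density lebesgue u) \<psi> x) r"
        using r C(1) by (simp add: epowr_mult epowr_ennreal)
    qed
    also have "\<dots> = ennreal (C powr r) * (\<integral>\<^sup>+x. epowr (maximal_fun (density lebesgue u) \<psi> x) r \<partial>density lebesgue u)"
      by (rule nn_integral_cmult) simp
    also have "\<dots> \<le> ennreal (C powr r) * (ennreal K * (\<integral>\<^sup>+x. epowr (\<psi> x) r \<partial>density lebesgue u))"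
      by (intro mult_left_mono K) auto
    also have "(\<integral>\<^sup>+x. epowr (\<psi> x) r \<partial>density lebesgue u) = (\<integral>\<^sup>+x. epowr (\<psi> x) r * u x \<partial>lebesgue)"
      by (simp add: nn_integral_density mult.commute)
    finally show ?thesis using K(1) by (simp add: ennreal_mult mult.assoc)
  qed
  then show ?thesis using C(1) K(1) by (intro exI[of _ "C powr r * K"]) auto
qed

section \<open>The construction of Coifman and Rochberg\<close>

text \<open>For \<open>\<delta> < 1\<close> a function of weak type \<open>L\<^sup>1\<close> has locally integrable \<open>\<delta>\<close>-th power: in the layer-cake
  formula the part of \<open>B\<close> above height \<open>e\<^sup>-\<^sup>s\<close> has measure at most \<open>b\<close> and at most \<open>e\<^sup>s k\<close>, and the two
  bounds agree at \<open>s = ln (b / k)\<close>, where the integral is split.\<close>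

lemma (in sigma_finite_measure) Kolmogorov_inequality:
  assumes h [measurable]: "h \<in> borel_measurable M" and B [measurable]: "B \<in> sets M"
    and b: "emeasure M B = ennreal b" "0 < b" and k: "0 < k" and \<delta>: "0 < \<delta>" "\<delta> < 1"
    and weak: "\<And>l. 0 < l \<Longrightarrow> ennreal l * emeasure M {x \<in> space M. ennreal l < h x} \<le> ennreal k"
  shows "(\<integral>\<^sup>+x\<in>B. epowr (h x) \<delta> \<partial>M) \<le> ennreal (b * (k / b) powr \<delta> / (1 - \<delta>))"
proof -
  define c where "c = ln (b / k)"
  have ec: "exp c = b / k" using b k by (simp add: c_def)
  have dist: "(\<integral>\<^sup>+x. indicator B x * indicator {x. ennreal (exp (- s)) < h x} x \<partial>M)
      \<le> ennreal b * indicator {c..} s + ennreal (exp s * k) * indicator {..c} s" for s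
  proof -
    have "(\<integral>\<^sup>+x. indicator B x * indicator {x. ennreal (exp (- s)) < h x} x \<partial>M) \<le> (\<integral>\<^sup>+x. indicator B x \<partial>M)"
      by (intro nn_integral_mono) (auto simp: indicator_def)
    then have 1: "(\<integral>\<^sup>+x. indicator B x * indicator {x. ennreal (exp (- s)) < h x} x \<partial>M) \<le> ennreal b"
      using b by simp
    have "(\<integral>\<^sup>+x. indicator B x * indicator {x. ennreal (exp (- s)) < h x} x \<partial>M)
        \<le> (\<integral>\<^sup>+x. indicator {x \<in> space M. ennreal (exp (- s)) < h x} x \<partial>M)"
      by (intro nn_integral_mono) (auto simp: indicator_def)
    also have "\<dots> = emeasure M {x \<in> space M. ennreal (exp (- s)) < h x}" by simp
    also have "\<dots> = ennreal (exp s) * (ennreal (exp (- s)) * emeasure M {x \<in> space M. ennreal (exp (- s)) < h x})"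
      by (simp add: mult.assoc[symmetric] ennreal_mult[symmetric] exp_minus)
    also have "\<dots> \<le> ennreal (exp s) * ennreal k"
      by (intro mult_left_mono weak) auto
    finally have 2: "(\<integral>\<^sup>+x. indicator B x * indicator {x. ennreal (exp (- s)) < h x} x \<partial>M) \<le> ennreal (exp s * k)"
      using k by (simp add: ennreal_mult)
    show ?thesis
    proof (cases "c \<le> s")
      case True
      with 1 show ?thesis by (auto simp: indicator_def add_increasing2)
    next
      case False
      with 2 show ?thesis by (auto simp: indicator_def)
    qed
  qed
  have "(\<integral>\<^sup>+x\<in>B. epowr (h x) \<delta> \<partial>M) = (\<integral>\<^sup>+x. indicator B x * epowr (h x) \<delta> \<partial>M)"
    by (simp add: mult.commute)
  also have "\<dots> = (\<integral>\<^sup>+s. ennreal (\<delta> * exp (- (\<delta> * s))) *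
       (\<integral>\<^sup>+x. indicator B x * indicator {x. ennreal (exp (- s)) < h x} x \<partial>M) \<partial>lborel)"
    using \<delta> by (intro nn_integral_epowr_layer_cake) auto
  also have "\<dots> \<le> (\<integral>\<^sup>+s. ennreal b * (ennreal (\<delta> * exp (- (\<delta> * s))) * indicator {c..} s)
      + ennreal (k * \<delta> / (1 - \<delta>)) * (ennreal ((1 - \<delta>) * exp ((1 - \<delta>) * s)) * indicator {..c} s) \<partial>lborel)"
  proof (rule nn_integral_mono)
    fix s :: real
    have "ennreal (\<delta> * exp (- (\<delta> * s))) * ennreal (exp s * k) = ennreal (\<delta> * exp (- (\<delta> * s)) * (exp s * k))"
      using \<delta> k by (simp add: ennreal_mult)
    also have "\<delta> * exp (- (\<delta> * s)) * (exp s * k) = k * \<delta> / (1 - \<delta>) * ((1 - \<delta>) * exp ((1 - \<delta>) * s))"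
      using \<delta> by (simp add: left_diff_distrib exp_diff exp_minus field_simps)
    also have "ennreal \<dots> = ennreal (k * \<delta> / (1 - \<delta>)) * ennreal ((1 - \<delta>) * exp ((1 - \<delta>) * s))"
      using \<delta> k by (intro ennreal_mult) auto
    finally have eq: "ennreal (\<delta> * exp (- (\<delta> * s))) * ennreal (exp s * k) =
       ennreal (k * \<delta> / (1 - \<delta>)) * ennreal ((1 - \<delta>) * exp ((1 - \<delta>) * s))" .
    have "ennreal (\<delta> * exp (- (\<delta> * s))) * (\<integral>\<^sup>+x. indicator B x * indicator {x. ennreal (exp (- s)) < h x} x \<partial>M)
      \<le> ennreal (\<delta> * exp (- (\<delta> * s))) * (ennreal b * indicator {c..} s + ennreal (exp s * k) * indicator {..c} s)"
      by (intro mult_left_mono dist) simp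
    also have "\<dots> = ennreal b * (ennreal (\<delta> * exp (- (\<delta> * s))) * indicator {c..} s)
      + ennreal (\<delta> * exp (- (\<delta> * s))) * ennreal (exp s * k) * indicator {..c} s"
      by (simp only: distrib_left ac_simps)
    also note eq
    finally show "ennreal (\<delta> * exp (- (\<delta> * s))) * (\<integral>\<^sup>+x. indicator B x * indicator {x. ennreal (exp (- s)) < h x} x \<partial>M)
      \<le> ennreal b * (ennreal (\<delta> * exp (- (\<delta> * s))) * indicator {c..} s)
      + ennreal (k * \<delta> / (1 - \<delta>)) * (ennreal ((1 - \<delta>) * exp ((1 - \<delta>) * s)) * indicator {..c} s)"
      by (simp only: mult.assoc)
  qed
  also have "\<dots> = ennreal b * ennreal (exp (- (\<delta> * c))) + ennreal (k * \<delta> / (1 - \<delta>)) * ennreal (exp ((1 - \<delta>) * c))"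
    using \<delta> by (subst nn_integral_add) (simp_all add: nn_integral_cmult nn_integral_exp_Ici nn_integral_exp_Iic)
  also have "\<dots> = ennreal (b * exp (- (\<delta> * c)) + k * \<delta> / (1 - \<delta>) * exp ((1 - \<delta>) * c))"
    using \<delta> b k by (subst ennreal_plus) (auto simp: ennreal_mult[symmetric])
  also have "exp (- (\<delta> * c)) = (k / b) powr \<delta>"
    using b k by (simp add: powr_def c_def ln_div algebra_simps)
  also have "exp ((1 - \<delta>) * c) = (b / k) * (k / b) powr \<delta>"
    using b k by (simp add: powr_def c_def ln_div left_diff_distrib exp_diff exp_add algebra_simps)
  also have "b * (k / b) powr \<delta> + k * \<delta> / (1 - \<delta>) * (b / k * (k / b) powr \<delta>) = b * (k / b) powr \<delta> / (1 - \<delta>)"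
    using b k \<delta> by (simp add: field_simps)
  finally show ?thesis .
qed

lemma max_fun_zero:
  fixes \<psi> :: "real ^ 'n \<Rightarrow> ennreal"
  assumes [measurable]: "\<psi> \<in> borel_measurable lebesgue" and "max_fun \<psi> x = 0"
  shows "AE y in lebesgue. \<psi> y = 0"
proof -
  have "AE y in lebesgue. y \<in> ball x (real (Suc k)) \<longrightarrow> \<psi> y = 0" for k
  proof -
    have "ball_avg x (real (Suc k)) \<psi> = 0"
      using ball_avg_le_max_fun[of "real (Suc k)" x x \<psi>] assms(2) by simp
    then have "(\<integral>\<^sup>+y\<in>ball x (real (Suc k)). \<psi> y \<partial>lebesgue) = 0"
      using ball_avg_mult_volume[of "real (Suc k)" x \<psi>] by simp
    then show ?thesis
      by (simp add: nn_integral_0_iff_AE) (auto elim!: eventually_mono simp: indicator_def split: if_splits)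
  qed
  then have "AE y in lebesgue. \<forall>k. y \<in> ball x (real (Suc k)) \<longrightarrow> \<psi> y = 0" by (subst AE_all_countable) blast
  then show ?thesis
  proof eventually_elim
    case (elim y)
    obtain k where "dist x y < real k" using reals_Archimedean2 by blast
    then have "y \<in> ball x (real (Suc k))" by simp
    then show ?case using elim by blast
  qed
qed

text \<open>The theorem of Coifman and Rochberg.  Inside a ball \<open>B\<close> the part of \<open>\<psi>\<close> living on the triple of
  \<open>B\<close> is handled by Kolmogorov's inequality, and the maximal function of the rest is essentially
  constant on \<open>B\<close>.\<close>

lemma Coifman_Rochberg:
  assumes \<delta>: "0 < \<delta>" "\<delta> < 1"
  shows "\<exists>C>0. \<forall>\<psi>\<in>borel_measurable lebesgue. \<forall>a \<rho>. \<forall>x\<in>ball (a :: real ^ 'n) \<rho>.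
    ball_avg a \<rho> (\<lambda>y. epowr (max_fun \<psi> y) \<delta>) \<le> ennreal C * epowr (max_fun \<psi> x) \<delta>"
proof -
  let ?n = "CARD('n)"
  define C where "C = 2 powr \<delta> * ((5 ^ ?n * 3 ^ ?n) powr \<delta> / (1 - \<delta>) + (3 ^ ?n) powr \<delta>)"
  have C: "0 < C" using \<delta> by (auto simp: C_def intro!: mult_pos_pos add_pos_pos)
  have "ball_avg a \<rho> (\<lambda>y. epowr (max_fun \<psi> y) \<delta>) \<le> ennreal C * epowr (max_fun \<psi> x) \<delta>"
    if [measurable]: "\<psi> \<in> borel_measurable lebesgue" and x: "x \<in> ball a \<rho>" for \<psi> and a x :: "real ^ 'n" and \<rho>
  proof -
    have \<rho>: "0 < \<rho>" using x dist_not_less_zero[of a x] by (metis le_less_trans mem_ball zero_le_dist)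
    have sets: "ball a \<rho> \<in> sets lebesgue" for \<rho> by simp
    define v where "v = unit_ball_vol (real ?n) * \<rho> ^ ?n"
    have v: "emeasure lebesgue (ball a \<rho>) = ennreal v" "0 < v"
      using \<rho> emeasure_lebesgue_ball[of \<rho> a] by (auto simp: v_def)
    show ?thesis
    proof (cases "max_fun \<psi> x" rule: ennreal_zero_top_pos_cases)
      case zero
      then have \<psi>0: "AE y in lebesgue. \<psi> y = 0" by (intro max_fun_zero) auto
      have "max_fun \<psi> y = 0" for y
      proof -
        have "ball_avg b r \<psi> = 0" for b r
        proof -
          have "ball_avg b r \<psi> = ball_avg b r (\<lambda>_. 0)"
            using \<psi>0 by (intro ball_avg_cong_AE) (auto elim!: eventually_mono)
          then show ?thesis by (simp add: ball_avg_def)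
        qed
        then show ?thesis using max_fun_least[of y \<psi> 0] by simp
      qed
      then show ?thesis using \<delta> by (simp add: ball_avg_def)
    next
      case top
      then show ?thesis using C \<delta> by (simp add: ennreal_mult_top)
    next
      case m: (pos m)
      define \<psi>1 where "\<psi>1 y = \<psi> y * indicator (ball a (3 * \<rho>)) y" for y
      define \<psi>2 where "\<psi>2 y = \<psi> y * indicator (- ball a (3 * \<rho>)) y" for y
      have [measurable]: "\<psi>1 \<in> borel_measurable lebesgue" "\<psi>2 \<in> borel_measurable lebesgue"
        unfolding \<psi>1_def \<psi>2_def by measurable
      have split: "max_fun \<psi> y \<le> max_fun \<psi>1 y + max_fun \<psi>2 y" for y
      proof (rule max_fun_least)
        fix b :: "real ^ 'n" and r :: real assume r: "0 < r" "y \<in> ball b r"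
        have "ball_avg b r \<psi> = ball_avg b r (\<lambda>y. \<psi>1 y + \<psi>2 y)"
          by (intro ball_avg_cong_AE) (auto simp: \<psi>1_def \<psi>2_def indicator_def)
        also have "\<dots> = ball_avg b r \<psi>1 + ball_avg b r \<psi>2" by (rule ball_avg_add) auto
        also have "\<dots> \<le> max_fun \<psi>1 y + max_fun \<psi>2 y"
          using r by (intro add_mono ball_avg_le_max_fun)
        finally show "ball_avg b r \<psi> \<le> max_fun \<psi>1 y + max_fun \<psi>2 y" .
      qed
      have far: "max_fun \<psi>2 y \<le> ennreal (3 ^ ?n * m)" if y: "y \<in> ball a \<rho>" for y
      proof (rule max_fun_least)
        fix b :: "real ^ 'n" and r :: real assume r: "0 < r" "y \<in> ball b r"
        show "ball_avg b r \<psi>2 \<le> ennreal (3 ^ ?n * m)"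
        proof (cases "r < \<rho>")
          case True
          have "ball b r \<subseteq> ball a (3 * \<rho>)"
          proof
            fix z assume "z \<in> ball b r"
            moreover have "dist a z \<le> dist a y + dist b y + dist b z"
              using dist_triangle[of a z y] dist_triangle[of y z b] by (simp add: dist_commute)
            ultimately show "z \<in> ball a (3 * \<rho>)" using True y r by simp
          qed
          then have "ball_avg b r \<psi>2 = ball_avg b r (\<lambda>_. 0)"
            by (intro ball_avg_cong_AE AE_I2) (auto simp: \<psi>2_def indicator_def)
          then show ?thesis using r by (simp add: ball_avg_const)
        next
          case False
          have sub: "ball b r \<subseteq> ball b (3 * r)" using r by auto
          have "dist b x \<le> dist b y + dist a y + dist a x"
            using dist_triangle[of b x y] dist_triangle[of y x a] by (simp add: dist_commute)
          then have xb: "x \<in> ball b (3 * r)" using False x y r by simp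
          have "ball_avg b r \<psi>2 \<le> ball_avg b r \<psi>"
            by (intro ball_avg_mono_AE AE_I2) (auto simp: \<psi>2_def indicator_def)
          also have "\<dots> \<le> ennreal (3 ^ ?n) * ball_avg b (3 * r) \<psi>"
            using r sub by (intro ball_avg_le_larger) auto
          also have "\<dots> \<le> ennreal (3 ^ ?n) * max_fun \<psi> x"
            using r xb by (intro mult_left_mono ball_avg_le_max_fun) auto
          also have "\<dots> = ennreal (3 ^ ?n * m)" using m by (simp add: ennreal_mult)
          finally show ?thesis .
        qed
      qed
      have int1: "(\<integral>\<^sup>+y. \<psi>1 y \<partial>lebesgue) \<le> ennreal (3 ^ ?n * v * m)"
      proof -
        have "(\<integral>\<^sup>+y. \<psi>1 y \<partial>lebesgue) = ball_avg a (3 * \<rho>) \<psi> * emeasure lebesgue (ball a (3 * \<rho>))"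
          using \<rho> by (simp add: \<psi>1_def ball_avg_mult_volume)
        also have "emeasure lebesgue (ball a (3 * \<rho>)) = ennreal (3 ^ ?n * v)"
          using \<rho> v by (subst emeasure_lebesgue_ball_scale[where b = a]) (auto simp: ennreal_mult)
        also have "ball_avg a (3 * \<rho>) \<psi> \<le> max_fun \<psi> x"
          using x \<rho> by (intro ball_avg_le_max_fun) auto
        also have "max_fun \<psi> x * ennreal (3 ^ ?n * v) = ennreal (3 ^ ?n * v * m)"
          using m v by (simp add: ennreal_mult[symmetric] ac_simps)
        finally show ?thesis by (simp add: mult_right_mono)
      qed
      have near: "(\<integral>\<^sup>+y\<in>ball a \<rho>. epowr (max_fun \<psi>1 y) \<delta> \<partial>lebesgue)
          \<le> ennreal (v * (5 ^ ?n * (3 ^ ?n * v * m) / v) powr \<delta> / (1 - \<delta>))"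
      proof (rule lebesgue_doubling.Kolmogorov_inequality)
        fix l :: real assume l: "0 < l"
        have "ennreal l * emeasure lebesgue {x. ennreal l < max_fun \<psi>1 x} \<le> ennreal (5 ^ ?n) * (\<integral>\<^sup>+y. \<psi>1 y \<partial>lebesgue)"
          by (rule lebesgue_doubling.maximal_weak_type[OF _ l]) simp
        also have "\<dots> \<le> ennreal (5 ^ ?n) * ennreal (3 ^ ?n * v * m)"
          by (intro mult_left_mono int1) simp
        also have "\<dots> = ennreal (5 ^ ?n * (3 ^ ?n * v * m))"
          using v m by (intro ennreal_mult[symmetric]) auto
        finally show "ennreal l * emeasure lebesgue {x \<in> space lebesgue. ennreal l < max_fun \<psi>1 x} \<le> ennreal (5 ^ ?n * (3 ^ ?n * v * m))"
          by simp
      qed (use v m \<delta> in auto)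
      have near': "ball_avg a \<rho> (\<lambda>y. epowr (max_fun \<psi>1 y) \<delta>) \<le> ennreal ((5 ^ ?n * 3 ^ ?n) powr \<delta> / (1 - \<delta>) * m powr \<delta>)"
      proof -
        have "ball_avg a \<rho> (\<lambda>y. epowr (max_fun \<psi>1 y) \<delta>) \<le> ennreal (v * (5 ^ ?n * (3 ^ ?n * v * m) / v) powr \<delta> / (1 - \<delta>)) / ennreal v"
          unfolding ball_avg_def v(1) by (intro divide_right_mono_ennreal near)
        also have "\<dots> = ennreal (v * (5 ^ ?n * (3 ^ ?n * v * m) / v) powr \<delta> / (1 - \<delta>) / v)"
          using v \<delta> m by (intro divide_ennreal) auto
        also have "v * (5 ^ ?n * (3 ^ ?n * v * m) / v) powr \<delta> / (1 - \<delta>) / v = (5 ^ ?n * (3 ^ ?n * v * m) / v) powr \<delta> / (1 - \<delta>)"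
          using v by simp
        also have "5 ^ ?n * (3 ^ ?n * v * m) / v = (5 ^ ?n * 3 ^ ?n) * m"
          using v by simp
        also have "((5 ^ ?n * 3 ^ ?n) * m) powr \<delta> / (1 - \<delta>) = (5 ^ ?n * 3 ^ ?n) powr \<delta> / (1 - \<delta>) * m powr \<delta>"
          using m by (subst powr_mult) auto
        finally show ?thesis .
      qed
      have "ball_avg a \<rho> (\<lambda>y. epowr (max_fun \<psi> y) \<delta>) \<le>
        ball_avg a \<rho> (\<lambda>y. ennreal (2 powr \<delta>) * (epowr (max_fun \<psi>1 y) \<delta> + ennreal ((3 ^ ?n * m) powr \<delta>)))"
      proof (intro ball_avg_mono_AE AE_I2 impI)
        fix y assume y: "y \<in> ball a \<rho>"
        have "epowr (max_fun \<psi> y) \<delta> \<le> epowr (max_fun \<psi>1 y + ennreal (3 ^ ?n * m)) \<delta>"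
          using \<delta> split[of y] far[OF y] by (intro epowr_mono) (auto intro: order_trans add_left_mono)
        also have "\<dots> \<le> ennreal (2 powr \<delta>) * (epowr (max_fun \<psi>1 y) \<delta> + epowr (ennreal (3 ^ ?n * m)) \<delta>)"
          using \<delta> by (intro epowr_sum_le) auto
        finally show "epowr (max_fun \<psi> y) \<delta> \<le> ennreal (2 powr \<delta>) * (epowr (max_fun \<psi>1 y) \<delta> + ennreal ((3 ^ ?n * m) powr \<delta>))"
          using m by (simp add: epowr_ennreal)
      qed
      also have "\<dots> = ennreal (2 powr \<delta>) * (ball_avg a \<rho> (\<lambda>y. epowr (max_fun \<psi>1 y) \<delta>) + ennreal ((3 ^ ?n * m) powr \<delta>))"
        using \<rho> by (simp add: ball_avg_cmult ball_avg_add ball_avg_const)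
      also have "\<dots> \<le> ennreal (2 powr \<delta>) * (ennreal ((5 ^ ?n * 3 ^ ?n) powr \<delta> / (1 - \<delta>) * m powr \<delta>) + ennreal ((3 ^ ?n * m) powr \<delta>))"
        by (intro mult_left_mono add_right_mono near') simp
      also have "\<dots> = ennreal (2 powr \<delta> * ((5 ^ ?n * 3 ^ ?n) powr \<delta> / (1 - \<delta>) * m powr \<delta> + (3 ^ ?n * m) powr \<delta>))"
        using \<delta> by (subst ennreal_mult) (auto simp: ennreal_plus)
      also have "(3 ^ ?n * m) powr \<delta> = (3 ^ ?n) powr \<delta> * m powr \<delta>"
        by (rule powr_mult)
      also have "2 powr \<delta> * ((5 ^ ?n * 3 ^ ?n) powr \<delta> / (1 - \<delta>) * m powr \<delta> + (3 ^ ?n) powr \<delta> * m powr \<delta>) = C * m powr \<delta>"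
        by (simp add: C_def algebra_simps)
      also have "ennreal (C * m powr \<delta>) = ennreal C * epowr (max_fun \<psi> x) \<delta>"
        using m C by (simp add: epowr_ennreal ennreal_mult)
      finally show ?thesis .
    qed
  qed
  then show ?thesis using C by blast
qed

text \<open>Taking the maximum with \<open>\<psi>\<close> makes the majorant property trivial; the \<open>A\<^sub>1\<close> bound survives
  because \<open>\<delta> < 1\<close> and Jensen's inequality bound the average of \<open>\<psi>\<^sup>\<delta>\<close> by \<open>(M\<psi>)\<^sup>\<delta>\<close>.\<close>

lemma A1_weight_majorant:
  fixes \<psi> :: "real ^ 'n \<Rightarrow> ennreal"
  assumes [measurable]: "\<psi> \<in> borel_measurable lebesgue" and \<delta>: "0 < \<delta>" "\<delta> < 1"
    and nz: "\<not> (AE x in lebesgue. \<psi> x = 0)"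
    and fin: "AE x in lebesgue. max (\<psi> x) (max_fun \<psi> x) < \<infinity>"
  shows "A1_weight (\<lambda>x. epowr (max (\<psi> x) (max_fun \<psi> x)) \<delta>)"
proof -
  obtain C where C: "0 < C" "\<And>a \<rho> x. x \<in> ball a \<rho> \<Longrightarrow>
      ball_avg a \<rho> (\<lambda>y. epowr (max_fun \<psi> y) \<delta>) \<le> ennreal C * epowr (max_fun \<psi> x) \<delta>"
    using Coifman_Rochberg[OF \<delta>, where 'n = 'n] assms(1) by blast
  have "AE x in lebesgue. 0 < epowr (max (\<psi> x) (max_fun \<psi> x)) \<delta> \<and> epowr (max (\<psi> x) (max_fun \<psi> x)) \<delta> < \<infinity>"
    using fin
  proof eventually_elim
    case (elim x)
    have "max_fun \<psi> x \<noteq> 0" using nz max_fun_zero[of \<psi> x] by auto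
    then show ?case using elim \<delta>
      by (intro conjI epowr_pos_nonneg epowr_finite_nonneg) (auto simp: max_def zero_less_iff_neq_zero)
  qed
  moreover have "ball_avg a \<rho> (\<lambda>x. epowr (max (\<psi> x) (max_fun \<psi> x)) \<delta>) \<le> ennreal (1 + C) * epowr (max (\<psi> x) (max_fun \<psi> x)) \<delta>"
    if \<rho>: "0 < \<rho>" and x: "x \<in> ball a \<rho>" for a \<rho> x
  proof -
    have "ball_avg a \<rho> (\<lambda>x. epowr (max (\<psi> x) (max_fun \<psi> x)) \<delta>) \<le> ball_avg a \<rho> (\<lambda>x. epowr (\<psi> x) \<delta> + epowr (max_fun \<psi> x) \<delta>)"
      by (intro ball_avg_mono_AE AE_I2) (auto simp: max_def)
    also have "\<dots> = ball_avg a \<rho> (\<lambda>x. epowr (\<psi> x) \<delta>) + ball_avg a \<rho> (\<lambda>x. epowr (max_fun \<psi> x) \<delta>)"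
      by (rule ball_avg_add) auto
    also have "\<dots> \<le> epowr (max_fun \<psi> x) \<delta> + ennreal C * epowr (max_fun \<psi> x) \<delta>"
    proof (rule add_mono)
      have "ball_avg a \<rho> (\<lambda>x. epowr (\<psi> x) \<delta>) \<le> epowr (ball_avg a \<rho> \<psi>) \<delta>"
        using \<delta> \<rho> by (intro ball_avg_epowr_le) auto
      also have "\<dots> \<le> epowr (max_fun \<psi> x) \<delta>"
        using \<delta> \<rho> x by (intro epowr_mono ball_avg_le_max_fun) auto
      finally show "ball_avg a \<rho> (\<lambda>x. epowr (\<psi> x) \<delta>) \<le> epowr (max_fun \<psi> x) \<delta>" .
    qed (rule C(2)[OF x])
    also have "\<dots> = ennreal (1 + C) * epowr (max_fun \<psi> x) \<delta>"
      using C(1) by (simp add: ennreal_plus distrib_right)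
    also have "\<dots> \<le> ennreal (1 + C) * epowr (max (\<psi> x) (max_fun \<psi> x)) \<delta>"
      using \<delta> by (intro mult_left_mono epowr_mono) auto
    finally show ?thesis .
  qed
  ultimately show ?thesis
    unfolding A1_weight_def using C(1) by (intro conjI exI[of _ "1 + C"]) auto
qed

section \<open>Limited-range weights from \<open>A\<^sub>1\<close> weights\<close>

text \<open>The easy half of the factorisation of limited-range weights: a negative power of one \<open>A\<^sub>1\<close>
  weight takes care of the \<open>A\<^sub>P\<close> condition, a power \<open>1 / s\<close> of another one of the reverse Hoelder
  inequality.\<close>

lemma A1_weight_product:
  fixes u1 u2 :: "real ^ 'n \<Rightarrow> ennreal"
  assumes u1: "A1_weight u1" and u2: "A1_weight u2" and P: "1 < P" and s: "1 < s"
  shows "(\<lambda>x. epowr (u1 x) (- (P - 1)) * epowr (u2 x) (1 / s)) \<in> A_const P \<inter> RH s"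
proof -
  define w where "w x = epowr (u1 x) (- (P - 1)) * epowr (u2 x) (1 / s)" for x
  note [measurable] = A1_weight_measurable[OF u1] A1_weight_measurable[OF u2]
  have w_meas [measurable]: "w \<in> borel_measurable lebesgue" unfolding w_def by measurable
  obtain C1 where C1: "0 < C1" "\<And>a \<rho> x. 0 < \<rho> \<Longrightarrow> x \<in> ball a \<rho> \<Longrightarrow> ball_avg a \<rho> u1 \<le> ennreal C1 * u1 x"
    using A1_weightE[OF u1] by blast
  obtain C2 where C2: "0 < C2" "\<And>a \<rho> x. 0 < \<rho> \<Longrightarrow> x \<in> ball a \<rho> \<Longrightarrow> ball_avg a \<rho> u2 \<le> ennreal C2 * u2 x"
    using A1_weightE[OF u2] by blast
  have lower: "ennreal (r / C) \<le> y" if "ennreal r \<le> ennreal C * y" "0 < C" "0 < r" for r C y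
  proof (cases y rule: ennreal_zero_top_pos_cases)
    case (pos z)
    then have "r \<le> C * z" using that by (simp add: ennreal_mult[symmetric])
    then have "r / C \<le> z" using that by (simp add: field_simps)
    then show ?thesis unfolding pos by (rule ennreal_leI)
  next
    case zero
    then show ?thesis using that by simp
  next
    case top
    then show ?thesis by simp
  qed
  define K where "K = C1 powr (P - 1) * C2 powr (1 / s)"
  have cp: "- 1 / (P - 1) = 1 - conj_exp P"
    using P by (simp add: conj_exp_def divide_simps)
  have main: "ball_avg a \<rho> w * epowr (ball_avg a \<rho> (\<lambda>x. epowr (w x) (1 - conj_exp P))) (P - 1) \<le> ennreal K \<and>
     epowr (ball_avg a \<rho> (\<lambda>x. epowr (w x) s)) (1 / s) / ball_avg a \<rho> w \<le> ennreal K"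
    if \<rho>: "0 < \<rho>" for a \<rho>
  proof -
    obtain r1 where r1: "0 < r1" "ball_avg a \<rho> u1 = ennreal r1" using A1_weight_avg_real[OF u1 \<rho>] by blast
    obtain r2 where r2: "0 < r2" "ball_avg a \<rho> u2 = ennreal r2" using A1_weight_avg_real[OF u2 \<rho>] by blast
    have l1: "ennreal (r1 / C1) \<le> u1 x" and l2: "ennreal (r2 / C2) \<le> u2 x" if "x \<in> ball a \<rho>" for x
      using C1(2)[OF \<rho> that] C2(2)[OF \<rho> that] C1(1) C2(1) r1 r2 by (auto intro!: lower)
    have n1: "epowr (u1 x) (- b) \<le> ennreal ((r1 / C1) powr (- b))"
      and n2: "epowr (u2 x) (- b) \<le> ennreal ((r2 / C2) powr (- b))"
      and p2: "ennreal ((r2 / C2) powr b) \<le> epowr (u2 x) b" if "0 \<le> b" "x \<in> ball a \<rho>" for x b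
      using epowr_antimono[OF l1[OF that(2)], of "- b"] epowr_antimono[OF l2[OF that(2)], of "- b"]
        epowr_mono[OF l2[OF that(2)], of b] r1 r2 C1(1) C2(1) that(1) by (auto simp: epowr_ennreal)
    have avg_w: "ball_avg a \<rho> w \<le> ennreal ((r1 / C1) powr (- (P - 1)) * r2 powr (1 / s))"
    proof -
      have "ball_avg a \<rho> w \<le> ball_avg a \<rho> (\<lambda>x. ennreal ((r1 / C1) powr (- (P - 1))) * epowr (u2 x) (1 / s))"
        unfolding w_def using P by (intro ball_avg_mono_AE AE_I2 impI mult_right_mono n1) auto
      also have "\<dots> = ennreal ((r1 / C1) powr (- (P - 1))) * ball_avg a \<rho> (\<lambda>x. epowr (u2 x) (1 / s))"
        by (rule ball_avg_cmult) simp
      also have "\<dots> \<le> ennreal ((r1 / C1) powr (- (P - 1))) * epowr (ball_avg a \<rho> u2) (1 / s)"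
        using s \<rho> by (intro mult_left_mono ball_avg_epowr_le) auto
      finally show ?thesis using r2 by (simp add: epowr_ennreal ennreal_mult)
    qed
    have avg_dual: "ball_avg a \<rho> (\<lambda>x. epowr (w x) (1 - conj_exp P)) \<le> ennreal (r1 * (r2 / C2) powr (- (1 / (s * (P - 1)))))"
    proof -
      have "ball_avg a \<rho> (\<lambda>x. epowr (w x) (1 - conj_exp P)) \<le> ball_avg a \<rho> (\<lambda>x. ennreal ((r2 / C2) powr (- (1 / (s * (P - 1))))) * u1 x)"
      proof (rule ball_avg_mono_AE)
        show "AE x in lebesgue. x \<in> ball a \<rho> \<longrightarrow> epowr (w x) (1 - conj_exp P) \<le> ennreal ((r2 / C2) powr (- (1 / (s * (P - 1))))) * u1 x"
          using A1_weight_AE[OF u1] A1_weight_AE[OF u2]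
        proof eventually_elim
          case (elim x)
          have "epowr (w x) (1 - conj_exp P) = epowr (u1 x) 1 * epowr (u2 x) (- (1 / (s * (P - 1))))"
          proof -
            have "- (P - 1) * (- 1 / (P - 1)) = 1" "1 / s * (- 1 / (P - 1)) = - (1 / (s * (P - 1)))"
              using P by (auto simp: divide_eq_eq)
            moreover have "epowr (w x) (1 - conj_exp P) =
                epowr (epowr (u1 x) (- (P - 1))) (- 1 / (P - 1)) * epowr (epowr (u2 x) (1 / s)) (- 1 / (P - 1))"
              unfolding w_def cp[symmetric] using elim by (intro epowr_mult_pos epowr_pos epowr_finite) auto
            ultimately show ?thesis by (simp only: epowr_epowr)
          qed
          then show ?case using n2[of "1 / (s * (P - 1))" x] P s by (auto simp: mult.commute intro: mult_left_mono)
        qed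
      qed
      also have "\<dots> = ennreal ((r2 / C2) powr (- (1 / (s * (P - 1))))) * ball_avg a \<rho> u1"
        by (rule ball_avg_cmult) simp
      finally show ?thesis using r1 by (simp add: ennreal_mult mult.commute)
    qed
    have "ball_avg a \<rho> w * epowr (ball_avg a \<rho> (\<lambda>x. epowr (w x) (1 - conj_exp P))) (P - 1)
      \<le> ennreal ((r1 / C1) powr (- (P - 1)) * r2 powr (1 / s)) * epowr (ennreal (r1 * (r2 / C2) powr (- (1 / (s * (P - 1)))))) (P - 1)"
      using P by (intro mult_mono avg_w epowr_mono avg_dual) auto
    also have "\<dots> = ennreal ((r1 / C1) powr (- (P - 1)) * r2 powr (1 / s) * (r1 * (r2 / C2) powr (- (1 / (s * (P - 1))))) powr (P - 1))"
      using r1 r2 C2 by (subst epowr_ennreal) (auto simp: ennreal_mult[symmetric])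
    also have "(r1 / C1) powr (- (P - 1)) * r2 powr (1 / s) * (r1 * (r2 / C2) powr (- (1 / (s * (P - 1))))) powr (P - 1) = K"
    proof -
      have "(r1 * (r2 / C2) powr (- (1 / (s * (P - 1))))) powr (P - 1) = r1 powr (P - 1) * (r2 / C2) powr (- (1 / s))"
        using r1 r2 C2 P s by (simp add: powr_mult powr_powr)
      moreover have "(r1 / C1) powr (- (P - 1)) = C1 powr (P - 1) / r1 powr (P - 1)"
        using r1 C1 by (simp only: powr_minus_divide) (simp add: powr_divide)
      moreover have "(r2 / C2) powr (- (1 / s)) = C2 powr (1 / s) / r2 powr (1 / s)"
        using r2 C2 by (simp only: powr_minus_divide) (simp add: powr_divide)
      ultimately show ?thesis using r1 r2 by (simp add: K_def)
    qed
    finally have A: "ball_avg a \<rho> w * epowr (ball_avg a \<rho> (\<lambda>x. epowr (w x) (1 - conj_exp P))) (P - 1) \<le> ennreal K" .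
    have avg_ws: "ball_avg a \<rho> (\<lambda>x. epowr (w x) s) \<le> ennreal ((r1 / C1) powr (- (s * (P - 1))) * r2)"
    proof -
      have "ball_avg a \<rho> (\<lambda>x. epowr (w x) s) \<le> ball_avg a \<rho> (\<lambda>x. ennreal ((r1 / C1) powr (- (s * (P - 1)))) * u2 x)"
      proof (intro ball_avg_mono_AE AE_I2 impI)
        fix x assume x: "x \<in> ball a \<rho>"
        have "epowr (w x) s = epowr (u1 x) (- (s * (P - 1))) * u2 x"
        proof -
          have "- (P - 1) * s = - (s * (P - 1))" "1 / s * s = 1" "0 \<le> s"
            using s by (auto simp: algebra_simps)
          then show ?thesis
            unfolding w_def by (simp only: epowr_mult[of s] epowr_epowr epowr_one_right)
        qed
        then show "epowr (w x) s \<le> ennreal ((r1 / C1) powr (- (s * (P - 1)))) * u2 x"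
          using n1[of "s * (P - 1)" x] x s P by (auto intro: mult_right_mono)
      qed
      also have "\<dots> = ennreal ((r1 / C1) powr (- (s * (P - 1)))) * ball_avg a \<rho> u2"
        by (rule ball_avg_cmult) simp
      finally show ?thesis using r2 by (simp add: ennreal_mult)
    qed
    have low_w: "ennreal ((r2 / C2) powr (1 / s) * r1 powr (- (P - 1))) \<le> ball_avg a \<rho> w"
    proof -
      have "1 \<le> epowr (ball_avg a \<rho> u1) (1 / 1) * epowr (ball_avg a \<rho> (\<lambda>x. epowr (u1 x) (- (P - 1)))) (1 / (P - 1))"
        using ball_avg_power_mean_neg[OF _ A1_weight_AE[OF u1], of 1 "P - 1" \<rho> a] P \<rho> by simp
      from epowr_mono[OF this, of "P - 1"]
      have "1 \<le> ennreal (r1 powr (P - 1)) * ball_avg a \<rho> (\<lambda>x. epowr (u1 x) (- (P - 1)))"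
        using P r1 by (simp add: epowr_mult epowr_epowr epowr_ennreal)
      from mult_left_mono[OF this, of "ennreal (r1 powr (- (P - 1)))"]
      have *: "ennreal (r1 powr (- (P - 1))) \<le> ball_avg a \<rho> (\<lambda>x. epowr (u1 x) (- (P - 1)))"
        using r1 by (simp add: mult.assoc[symmetric] ennreal_mult[symmetric] powr_add[symmetric])
      have "ennreal ((r2 / C2) powr (1 / s) * r1 powr (- (P - 1))) \<le> ennreal ((r2 / C2) powr (1 / s)) * ball_avg a \<rho> (\<lambda>x. epowr (u1 x) (- (P - 1)))"
        using * by (subst ennreal_mult) (auto intro: mult_left_mono)
      also have "\<dots> = ball_avg a \<rho> (\<lambda>x. ennreal ((r2 / C2) powr (1 / s)) * epowr (u1 x) (- (P - 1)))"
        by (rule ball_avg_cmult[symmetric]) simp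
      also have "\<dots> \<le> ball_avg a \<rho> w"
        unfolding w_def using s by (intro ball_avg_mono_AE AE_I2) (auto simp: mult.commute intro!: mult_left_mono p2)
      finally show ?thesis .
    qed
    have "epowr (ball_avg a \<rho> (\<lambda>x. epowr (w x) s)) (1 / s) \<le> ball_avg a \<rho> w * ennreal K"
    proof -
      have "epowr (ball_avg a \<rho> (\<lambda>x. epowr (w x) s)) (1 / s) \<le> epowr (ennreal ((r1 / C1) powr (- (s * (P - 1))) * r2)) (1 / s)"
        using s by (intro epowr_mono avg_ws) auto
      also have "\<dots> = ennreal (((r1 / C1) powr (- (s * (P - 1))) * r2) powr (1 / s))"
        using r1 r2 C1 by (intro epowr_ennreal) auto
      also have "((r1 / C1) powr (- (s * (P - 1))) * r2) powr (1 / s) = (r2 / C2) powr (1 / s) * r1 powr (- (P - 1)) * K"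
      proof -
        have "((r1 / C1) powr (- (s * (P - 1))) * r2) powr (1 / s) = (r1 / C1) powr (- (P - 1)) * r2 powr (1 / s)"
          using r1 r2 C1 s by (simp add: powr_mult powr_powr)
        moreover have "(r1 / C1) powr (- (P - 1)) = C1 powr (P - 1) * r1 powr (- (P - 1))"
          using r1 C1 by (simp only: powr_minus_divide) (simp add: powr_divide)
        moreover have "(r2 / C2) powr (1 / s) * C2 powr (1 / s) = r2 powr (1 / s)"
          using r2 C2 by (simp add: powr_divide)
        ultimately show ?thesis by (simp add: K_def ac_simps)
      qed
      also have "ennreal \<dots> = ennreal ((r2 / C2) powr (1 / s) * r1 powr (- (P - 1))) * ennreal K"
        using r1 r2 by (intro ennreal_mult) (auto simp: K_def)
      also have "\<dots> \<le> ball_avg a \<rho> w * ennreal K"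
        by (intro mult_right_mono low_w) auto
      finally show ?thesis .
    qed
    moreover have "0 < ball_avg a \<rho> w"
      using low_w r1 r2 C2 by (auto intro: less_le_trans[rotated])
    ultimately have B: "epowr (ball_avg a \<rho> (\<lambda>x. epowr (w x) s)) (1 / s) / ball_avg a \<rho> w \<le> ennreal K"
      by (intro divide_le_posI_ennreal)
    from A B show ?thesis ..
  qed
  have "w \<in> A_const P"
  proof -
    have "(SUP (a, \<rho>) \<in> UNIV \<times> {0<..}. ball_avg a \<rho> w * epowr (ball_avg a \<rho> (\<lambda>x. epowr (w x) (1 - conj_exp P))) (P - 1)) \<le> ennreal K"
      using main by (intro SUP_least) auto
    then show ?thesis by (simp add: A_const_def weight_def le_less_trans)
  qed
  moreover have "w \<in> RH s"
  proof -
    have "(SUP (a, \<rho>) \<in> UNIV \<times> {0<..}. epowr (ball_avg a \<rho> (\<lambda>x. epowr (w x) s)) (1 / s) / ball_avg a \<rho> w) \<le> ennreal K"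
      using main by (intro SUP_least) auto
    then show ?thesis by (simp add: RH_def weight_def le_less_trans)
  qed
  ultimately show ?thesis unfolding w_def[abs_def] by blast
qed

section \<open>Gluing a sequence of pairs\<close>

text \<open>It suffices to have, for each sequence of pairs, constants that grow at most geometrically: from a
  counterexample one can choose pairs that violate the inequality with the constants \<open>(2 K)\<^sup>j\<close>.  This is
  how a hypothesis whose constant depends on the weight is used, since one weight can be adapted to a
  whole sequence of pairs.\<close>

lemma family_ineqI:
  assumes K: "1 \<le> K"
    and glue: "\<And>f g. (\<And>j::nat. (f j, g j) \<in> F \<and> 0 < N (f j) \<and> N (f j) < \<infinity> \<and> N (g j) < N (f j)) \<Longrightarrow>
      \<exists>C. \<forall>j. N (f j) \<le> ennreal (C * K ^ j) * N (g j)"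
  shows "family_ineq F N"
proof (rule ccontr)
  assume neg: "\<not> family_ineq F N"
  have "\<exists>p. p \<in> F \<and> N (fst p) < \<infinity> \<and> ennreal ((2 * K) ^ j) * N (snd p) < N (fst p)" for j :: nat
  proof -
    have "0 < (2 * K) ^ j" using K by simp
    then show ?thesis using neg unfolding family_ineq_def by (force simp: not_le)
  qed
  then obtain p where p: "\<And>j::nat. p j \<in> F \<and> N (fst (p j)) < \<infinity> \<and> ennreal ((2 * K) ^ j) * N (snd (p j)) < N (fst (p j))"
    by metis
  have "(fst (p j), snd (p j)) \<in> F \<and> 0 < N (fst (p j)) \<and> N (fst (p j)) < \<infinity> \<and> N (snd (p j)) < N (fst (p j))" for j
  proof -
    have "1 \<le> (2 * K) ^ j" using K by (intro one_le_power) simp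
    then have "ennreal 1 \<le> ennreal ((2 * K) ^ j)" by (rule ennreal_leI)
    from mult_right_mono[OF this, of "N (snd (p j))"]
    have "N (snd (p j)) \<le> ennreal ((2 * K) ^ j) * N (snd (p j))" by simp
    also have "\<dots> < N (fst (p j))" using p by blast
    finally show ?thesis using p[of j] by (auto intro: le_less_trans[OF zero_le])
  qed
  from glue[of "\<lambda>j. fst (p j)" "\<lambda>j. snd (p j)", OF this] obtain C where C: "\<And>j. N (fst (p j)) \<le> ennreal (C * K ^ j) * N (snd (p j))" by blast
  obtain j where j: "C < 2 ^ j" using real_arch_pow[of 2 C] by auto
  have "C * K ^ j \<le> (2 * K) ^ j"
    using K j by (simp add: power_mult_distrib mult_right_mono)
  then have "ennreal (C * K ^ j) * N (snd (p j)) \<le> ennreal ((2 * K) ^ j) * N (snd (p j))"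
    by (intro mult_right_mono ennreal_leI) auto
  also have "\<dots> < N (fst (p j))" using p by blast
  finally show False using C[of j] by simp
qed

section \<open>Lowering the exponent\<close>

text \<open>To pass from \<open>p0\<close> to the smaller exponent \<open>ps\<close>, the weight \<open>v = u\<^sup>1\<^sup>-\<^sup>p\<^sup>s\<^sup>/\<^sup>q\<^sup>p\<close> is multiplied by
  \<open>U\<^sup>-\<^sup>(\<^sup>p\<^sup>0\<^sup>-\<^sup>p\<^sup>s\<^sup>)\<close> with a majorant \<open>U\<close> of \<open>h\<close> in the same weighted space.  The product has the
  form required in \<open>A1_weight_product\<close> if \<open>U = u1\<^sup>1\<^sup>/\<^sup>\<beta> u\<^sup>1\<^sup>/\<^sup>q\<^sup>p\<close> with \<open>u1 \<in> A\<^sub>1\<close> and \<open>\<beta> = (p0 - ps) / (p0/qm - 1)\<close>.  So \<open>u1\<close> has to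
  majorize a power of \<open>h u\<^sup>-\<^sup>1\<^sup>/\<^sup>q\<^sup>p\<close>, and the integral of \<open>U\<^sup>p\<^sup>s v\<close> becomes that of \<open>u1\<^sup>p\<^sup>s\<^sup>/\<^sup>\<beta> u\<close>, where the
  exponent \<open>ps/\<beta>\<close> exceeds \<open>1\<close> because \<open>qm < ps\<close>.\<close>

lemma auxiliary_limited_range_weight:
  fixes u h :: "real ^ 'n \<Rightarrow> ennreal"
  assumes u: "A1_weight u" and h [measurable]: "h \<in> borel_measurable lebesgue"
    and q: "0 < qm" "qm < ps" "ps < p0" "p0 < qp"
    and fin: "(\<integral>\<^sup>+x. epowr (h x) ps * epowr (u x) (1 - ps / qp) \<partial>lebesgue) < \<infinity>"
    and nz: "\<not> (AE x in lebesgue. h x = 0)"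
  obtains U w where "U \<in> borel_measurable lebesgue" "w \<in> A_const (p0 / qm) \<inter> RH (conj_exp (qp / p0))"
    "AE x in lebesgue. 0 < U x \<and> U x < \<infinity> \<and> h x \<le> U x \<and> w x = epowr (U x) (- (p0 - ps)) * epowr (u x) (1 - ps / qp)"
    "(\<integral>\<^sup>+x. epowr (U x) ps * epowr (u x) (1 - ps / qp) \<partial>lebesgue) < \<infinity>"
proof -
  note [measurable] = A1_weight_measurable[OF u]
  define P where "P = p0 / qm"
  have P: "1 < P" using q by (simp add: P_def)
  define s where "s = conj_exp (qp / p0)"
  have s: "1 < s" "1 / s = 1 - p0 / qp"
    using q by (auto simp: s_def conj_exp_def divide_simps)
  define \<beta> where "\<beta> = (p0 - ps) / (P - 1)"
  have \<beta>: "0 < \<beta>" using q P by (simp add: \<beta>_def)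
  have \<beta>_less: "\<beta> < ps"
  proof -
    have "qm * p0 < ps * p0" using q by (intro mult_strict_right_mono) auto
    then show ?thesis using q P by (simp add: \<beta>_def P_def field_simps)
  qed
  \<comment> \<open>Any \<open>\<delta>\<close> between \<open>\<beta>/ps\<close> and \<open>1\<close>: then the exponent \<open>r\<close> below is still above \<open>1\<close>.\<close>
  define \<delta> where "\<delta> = (\<beta> / ps + 1) / 2"
  have \<delta>: "\<beta> / ps < \<delta>" "\<delta> < 1" "0 < \<delta>"
    using \<beta> \<beta>_less q by (auto simp: \<delta>_def field_simps)
  define r where "r = \<delta> * ps / \<beta>"
  have r: "1 < r" using \<delta>(1) \<beta> q by (simp add: r_def field_simps)
  define \<psi> where "\<psi> x = epowr (h x) (\<beta> / \<delta>) * epowr (u x) (- (\<beta> / (\<delta> * qp)))" for x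
  have [measurable]: "\<psi> \<in> borel_measurable lebesgue" unfolding \<psi>_def by measurable
  define m where "m x = max (\<psi> x) (max_fun \<psi> x)" for x
  have [measurable]: "m \<in> borel_measurable lebesgue" unfolding m_def by measurable
  obtain C where C: "\<And>\<psi>. \<psi> \<in> borel_measurable lebesgue \<Longrightarrow>
    (\<integral>\<^sup>+x. epowr (max_fun \<psi> x) r * u x \<partial>lebesgue) \<le> ennreal C * (\<integral>\<^sup>+x. epowr (\<psi> x) r * u x \<partial>lebesgue)"
    using A1_weight_maximal_bound[OF u r] by blast
  have int_\<psi>: "(\<integral>\<^sup>+x. epowr (\<psi> x) r * u x \<partial>lebesgue) < \<infinity>"
  proof -
    have "(\<integral>\<^sup>+x. epowr (\<psi> x) r * u x \<partial>lebesgue) = (\<integral>\<^sup>+x. epowr (h x) ps * epowr (u x) (1 - ps / qp) \<partial>lebesgue)"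
    proof (rule nn_integral_cong_AE, use A1_weight_AE[OF u] in eventually_elim)
      case (elim x)
      have "\<beta> / \<delta> * r = ps" "- (\<beta> / (\<delta> * qp)) * r = - (ps / qp)"
        using \<beta> \<delta> q by (auto simp: r_def field_simps)
      then have "epowr (\<psi> x) r = epowr (h x) ps * epowr (u x) (- (ps / qp))"
        using r by (simp only: \<psi>_def epowr_mult[of r] epowr_epowr)
      moreover have "epowr (u x) (- (ps / qp)) * u x = epowr (u x) (1 - ps / qp)"
        using epowr_add[of "u x" "- (ps / qp)" 1] elim by simp
      ultimately show ?case by (simp add: mult.assoc)
    qed
    then show ?thesis using fin by simp
  qed
  have int_m: "(\<integral>\<^sup>+x. epowr (m x) r * u x \<partial>lebesgue) < \<infinity>"
  proof -
    have "(\<integral>\<^sup>+x. epowr (m x) r * u x \<partial>lebesgue) \<le> (\<integral>\<^sup>+x. epowr (\<psi> x) r * u x + epowr (max_fun \<psi> x) r * u x \<partial>lebesgue)"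
      by (intro nn_integral_mono) (auto simp: m_def max_def)
    also have "\<dots> = (\<integral>\<^sup>+x. epowr (\<psi> x) r * u x \<partial>lebesgue) + (\<integral>\<^sup>+x. epowr (max_fun \<psi> x) r * u x \<partial>lebesgue)"
      by (rule nn_integral_add) measurable
    also have "\<dots> < \<infinity>"
      using int_\<psi> C[of \<psi>] by (auto simp: ennreal_mult_less_top intro: le_less_trans)
    finally show ?thesis .
  qed
  have m_fin: "AE x in lebesgue. m x < \<infinity>"
  proof -
    have "AE x in lebesgue. epowr (m x) r * u x \<noteq> \<infinity>"
      using int_m by (intro nn_integral_noteq_infinite) auto
    then show ?thesis using A1_weight_AE[OF u]
    proof eventually_elim
      case (elim x)
      then show ?case using r by (cases "m x = \<infinity>") (auto simp: ennreal_top_mult less_top split: if_splits)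
    qed
  qed
  have \<psi>_nz: "\<not> (AE x in lebesgue. \<psi> x = 0)"
  proof
    assume "AE x in lebesgue. \<psi> x = 0"
    then have "AE x in lebesgue. h x = 0" using A1_weight_AE[OF u]
    proof eventually_elim
      case (elim x)
      then show ?case
        using epowr_pos[of "u x" "- (\<beta> / (\<delta> * qp))"] \<beta> \<delta> by (auto simp: \<psi>_def epowr_eq_0_iff)
    qed
    with nz show False ..
  qed
  define u1 where "u1 x = epowr (m x) \<delta>" for x
  have u1: "A1_weight u1"
    unfolding u1_def m_def using \<delta> \<psi>_nz m_fin by (intro A1_weight_majorant) (auto simp: m_def)
  note [measurable] = A1_weight_measurable[OF u1]
  define U where "U x = epowr (u1 x) (1 / \<beta>) * epowr (u x) (1 / qp)" for x
  define w where "w x = epowr (u1 x) (- (P - 1)) * epowr (u x) (1 / s)" for x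
  show thesis
  proof
    show [measurable]: "U \<in> borel_measurable lebesgue" unfolding U_def by measurable
    show "w \<in> A_const (p0 / qm) \<inter> RH (conj_exp (qp / p0))"
      using A1_weight_product[OF u1 u P s(1)] by (simp add: w_def[abs_def] P_def s_def)
    show "AE x in lebesgue. 0 < U x \<and> U x < \<infinity> \<and> h x \<le> U x \<and> w x = epowr (U x) (- (p0 - ps)) * epowr (u x) (1 - ps / qp)"
      using A1_weight_AE[OF u1] A1_weight_AE[OF u]
    proof eventually_elim
      case (elim x)
      have pos: "0 < epowr (u1 x) (1 / \<beta>)" "0 < epowr (u x) (1 / qp)" "epowr (u1 x) (1 / \<beta>) < \<infinity>" "epowr (u x) (1 / qp) < \<infinity>"
        using elim by (auto intro!: epowr_pos epowr_finite)
      have "epowr (\<psi> x) (\<delta> / \<beta>) \<le> epowr (u1 x) (1 / \<beta>)"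
        unfolding u1_def epowr_epowr using \<delta> \<beta> by (auto intro!: epowr_mono simp: m_def)
      moreover have "epowr (\<psi> x) (\<delta> / \<beta>) = h x * epowr (u x) (- (1 / qp))"
      proof -
        have "\<beta> / \<delta> * (\<delta> / \<beta>) = 1" "- (\<beta> / (\<delta> * qp)) * (\<delta> / \<beta>) = - (1 / qp)"
          using \<beta> \<delta> by (auto simp: field_simps)
        moreover have "0 \<le> \<delta> / \<beta>" using \<beta> \<delta> by simp
        ultimately show ?thesis by (simp only: \<psi>_def epowr_mult[of "\<delta> / \<beta>"] epowr_epowr epowr_one_right)
      qed
      ultimately have "h x * epowr (u x) (- (1 / qp)) * epowr (u x) (1 / qp) \<le> U x"
        unfolding U_def by (intro mult_right_mono) auto
      moreover have "epowr (u x) (- (1 / qp)) * epowr (u x) (1 / qp) = 1"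
        using elim epowr_add[of "u x" "- (1 / qp)" "1 / qp"] by simp
      ultimately have "h x \<le> U x" by (simp add: mult.assoc)
      moreover have "w x = epowr (U x) (- (p0 - ps)) * epowr (u x) (1 - ps / qp)"
      proof -
        have "epowr (U x) (- (p0 - ps)) = epowr (u1 x) (1 / \<beta> * - (p0 - ps)) * epowr (u x) (1 / qp * - (p0 - ps))"
          unfolding U_def using pos by (subst epowr_mult_pos) (auto simp only: epowr_epowr)
        also have "1 / \<beta> * - (p0 - ps) = - (P - 1)"
        proof -
          have "(P - 1) / (p0 - ps) * (p0 - ps) = P - 1" using q by simp
          then show ?thesis unfolding \<beta>_def by (simp only: divide_divide_eq_right mult_minus_right mult_1)
        qed
        finally have "epowr (U x) (- (p0 - ps)) * epowr (u x) (1 - ps / qp) =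
          epowr (u1 x) (- (P - 1)) * (epowr (u x) (1 / qp * - (p0 - ps)) * epowr (u x) (1 - ps / qp))"
          by (simp only: mult.assoc)
        also have "epowr (u x) (1 / qp * - (p0 - ps)) * epowr (u x) (1 - ps / qp) = epowr (u x) (1 / qp * - (p0 - ps) + (1 - ps / qp))"
          using elim by (intro epowr_add[symmetric]) auto
        also have "1 / qp * - (p0 - ps) + (1 - ps / qp) = 1 / s" unfolding s(2) using q by (simp add: field_simps)
        finally show ?thesis by (simp add: w_def)
      qed
      ultimately show ?case using pos by (auto simp: U_def ennreal_zero_less_mult_iff ennreal_mult_less_top)
    qed
    have "(\<integral>\<^sup>+x. epowr (U x) ps * epowr (u x) (1 - ps / qp) \<partial>lebesgue) = (\<integral>\<^sup>+x. epowr (m x) r * u x \<partial>lebesgue)"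
    proof (rule nn_integral_cong_AE, use A1_weight_AE[OF u] in eventually_elim)
      case (elim x)
      have "epowr (U x) ps = epowr (m x) (\<delta> * (1 / \<beta>) * ps) * epowr (u x) (1 / qp * ps)"
        unfolding U_def u1_def using q by (simp only: epowr_mult[of ps] epowr_epowr less_imp_le)
      then have "epowr (U x) ps * epowr (u x) (1 - ps / qp) =
         epowr (m x) (\<delta> * (1 / \<beta>) * ps) * (epowr (u x) (1 / qp * ps) * epowr (u x) (1 - ps / qp))"
        by (simp only: mult.assoc)
      also have "epowr (u x) (1 / qp * ps) * epowr (u x) (1 - ps / qp) = epowr (u x) (1 / qp * ps + (1 - ps / qp))"
        using elim by (intro epowr_add[symmetric]) auto
      finally show ?case by (simp add: r_def)
    qed
    then show "(\<integral>\<^sup>+x. epowr (U x) ps * epowr (u x) (1 - ps / qp) \<partial>lebesgue) < \<infinity>"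
      using int_m by simp
  qed
qed

text \<open>One majorant \<open>U\<close> serves all pairs of a sequence: the \<open>ps\<close>-th powers of their functions are
  normalized by the norm of \<open>f\<^sub>j\<close> and summed with the factors \<open>2\<^sup>-\<^sup>j\<close>.  As \<open>f\<^sub>j\<close> is at most a multiple of
  \<open>U\<close>, the integral of \<open>f\<^sub>j\<^sup>p\<^sup>0 w\<close> is bounded by that of \<open>f\<^sub>j\<^sup>p\<^sup>s v\<close>, hence finite, and likewise for \<open>g\<^sub>j\<close>; Hoelder's inequality with the integrable function \<open>U\<^sup>p\<^sup>s v\<close>
  gives the opposite bound for \<open>f\<^sub>j\<close>.\<close>

lemma limited_range_A1_weight:
  fixes F :: "((real ^ 'n \<Rightarrow> ennreal) \<times> (real ^ 'n \<Rightarrow> ennreal)) set"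
  assumes F: "\<forall>(f, g)\<in>F. f \<in> borel_measurable lebesgue \<and> g \<in> borel_measurable lebesgue"
    and q: "0 < qm" "qm < ps" "ps < p0" "p0 < qp"
    and hyp: "\<forall>w0 \<in> A_const (p0 / qm) \<inter> RH (conj_exp (qp / p0)).
           family_ineq F (\<lambda>h. \<integral>\<^sup>+ x. epowr (h x) p0 * w0 x \<partial>lebesgue)"
    and u: "A1_weight u"
  shows "family_ineq F (\<lambda>h. \<integral>\<^sup>+x. epowr (h x) ps * epowr (u x) (1 - ps / qp) \<partial>lebesgue)"
proof -
  note [measurable] = A1_weight_measurable[OF u]
  define v where "v x = epowr (u x) (1 - ps / qp)" for x
  have [measurable]: "v \<in> borel_measurable lebesgue" unfolding v_def by measurable
  have v_AE: "AE x in lebesgue. 0 < v x \<and> v x < \<infinity>"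
    using A1_weight_AE[OF u] by eventually_elim (auto simp: v_def intro!: epowr_pos epowr_finite)
  define N where "N h = (\<integral>\<^sup>+x. epowr (h x) ps * v x \<partial>lebesgue)" for h
  define k where "k = (p0 - ps) / ps"
  have k: "0 < k" using q by (simp add: k_def)
  have "family_ineq F N"
  proof (rule family_ineqI)
    show "1 \<le> 2 powr k" using k by (intro ge_one_powr_ge_zero) auto
  next
    fix f g :: "nat \<Rightarrow> real ^ 'n \<Rightarrow> ennreal"
    assume fg: "\<And>j. (f j, g j) \<in> F \<and> 0 < N (f j) \<and> N (f j) < \<infinity> \<and> N (g j) < N (f j)"
    have [measurable]: "f j \<in> borel_measurable lebesgue" "g j \<in> borel_measurable lebesgue" for j
      using F fg[of j] by auto
    define L where "L j = ennreal (2 ^ Suc j) * N (f j)" for j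
    have L: "0 < L j" "L j < \<infinity>" for j
      using fg[of j] by (auto simp: L_def ennreal_zero_less_mult_iff ennreal_mult_less_top)
    define H where "H x = (\<Sum>j. (epowr (f j x) ps + epowr (g j x) ps) / L j)" for x
    have [measurable]: "H \<in> borel_measurable lebesgue" unfolding H_def by measurable
    define h where "h x = epowr (H x) (1 / ps)" for x
    have h_meas [measurable]: "h \<in> borel_measurable lebesgue" unfolding h_def by measurable
    have hH: "epowr (h x) ps = H x" for x using q by (simp add: h_def epowr_epowr)
    have f_le: "epowr (f j x) ps \<le> L j * H x" and g_le: "epowr (g j x) ps \<le> L j * H x" for j x
    proof -
      have "(\<Sum>i\<in>{j}. (epowr (f i x) ps + epowr (g i x) ps) / L i) \<le> H x"
        unfolding H_def by (rule sum_le_suminf) auto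
      then have "L j * ((epowr (f j x) ps + epowr (g j x) ps) / L j) \<le> L j * H x"
        by (intro mult_left_mono) auto
      moreover have "L j * ((epowr (f j x) ps + epowr (g j x) ps) / L j) = epowr (f j x) ps + epowr (g j x) ps"
        using L[of j] by (simp add: ennreal_times_divide mult.commute[of "L j"] mult_divide_eq_ennreal)
      ultimately have *: "epowr (f j x) ps + epowr (g j x) ps \<le> L j * H x" by simp
      show "epowr (f j x) ps \<le> L j * H x" using * by (rule order_trans[rotated]) simp
      show "epowr (g j x) ps \<le> L j * H x" using * by (rule order_trans[rotated]) simp
    qed
    have "(\<integral>\<^sup>+x. epowr (h x) ps * v x \<partial>lebesgue) = (\<integral>\<^sup>+x. (\<Sum>j. (epowr (f j x) ps * v x + epowr (g j x) ps * v x) * inverse (L j)) \<partial>lebesgue)"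
    proof (rule nn_integral_cong)
      fix x
      have "epowr (h x) ps * v x = (\<Sum>j. (epowr (f j x) ps + epowr (g j x) ps) / L j * v x)"
        unfolding hH H_def by simp
      also have "(\<lambda>j. (epowr (f j x) ps + epowr (g j x) ps) / L j * v x) =
          (\<lambda>j. (epowr (f j x) ps * v x + epowr (g j x) ps * v x) * inverse (L j))"
        by (simp add: divide_ennreal_def distrib_left distrib_right ac_simps)
      finally show "epowr (h x) ps * v x = (\<Sum>j. (epowr (f j x) ps * v x + epowr (g j x) ps * v x) * inverse (L j))" .
    qed
    also have "\<dots> = (\<Sum>j. (N (f j) + N (g j)) * inverse (L j))"
      by (simp add: nn_integral_suminf nn_integral_multc nn_integral_add N_def)
    also have "\<dots> \<le> (\<Sum>j. 2 * ennreal ((1 / 2) ^ Suc j))"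
    proof (intro suminf_le allI)
      fix j
      have "(N (f j) + N (g j)) * inverse (L j) \<le> (2 * N (f j)) * inverse (L j)"
        using fg[of j] by (intro mult_right_mono) (auto simp: mult_2 intro!: add_left_mono)
      also have "\<dots> = 2 * ennreal ((1 / 2) ^ Suc j)"
      proof (cases "N (f j)" rule: ennreal_zero_top_pos_cases)
        case (pos a)
        then have "N (f j) * inverse (L j) = ennreal ((1 / 2) ^ Suc j)"
          by (simp add: L_def inverse_ennreal ennreal_mult[symmetric] power_one_over field_simps)
        then show ?thesis by (simp add: mult.assoc)
      qed (use fg[of j] in auto)
      finally show "(N (f j) + N (g j)) * inverse (L j) \<le> 2 * ennreal ((1 / 2) ^ Suc j)" .
    qed auto
    also have "\<dots> = 2 * (\<Sum>j. ennreal ((1 / 2) ^ Suc j))"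
      by simp
    also have "(\<Sum>j. ennreal ((1 / 2) ^ Suc j)) = ennreal 1"
      using power_half_series by (intro suminf_ennreal_eq) auto
    finally have fin: "(\<integral>\<^sup>+x. epowr (h x) ps * epowr (u x) (1 - ps / qp) \<partial>lebesgue) < \<infinity>"
      by (simp add: v_def le_less_trans[of _ 2] del: epowr_zero_right)
    have nz: "\<not> (AE x in lebesgue. h x = 0)"
    proof
      assume "AE x in lebesgue. h x = 0"
      then have "AE x in lebesgue. epowr (f 0 x) ps * v x = 0"
      proof eventually_elim
        case (elim x)
        then have "H x = 0" using hH[of x] q by simp
        then show ?case using f_le[of 0 x] by simp
      qed
      then have "N (f 0) = 0" by (simp add: N_def nn_integral_0_iff_AE)
      then show False using fg[of 0] by simp
    qed
    obtain U w where [measurable]: "U \<in> borel_measurable lebesgue" and w: "w \<in> A_const (p0 / qm) \<inter> RH (conj_exp (qp / p0))"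
      and Uw: "AE x in lebesgue. 0 < U x \<and> U x < \<infinity> \<and> h x \<le> U x \<and> w x = epowr (U x) (- (p0 - ps)) * v x"
      and U_fin: "(\<integral>\<^sup>+x. epowr (U x) ps * v x \<partial>lebesgue) < \<infinity>"
      unfolding v_def by (rule auxiliary_limited_range_weight[OF u h_meas q fin nz])
    have [measurable]: "w \<in> borel_measurable lebesgue" using w by (auto simp: RH_def weight_def)
    obtain C where C: "0 < C" "\<And>f g. (f, g) \<in> F \<Longrightarrow> (\<integral>\<^sup>+ x. epowr (f x) p0 * w x \<partial>lebesgue) < \<infinity> \<Longrightarrow>
      (\<integral>\<^sup>+ x. epowr (f x) p0 * w x \<partial>lebesgue) \<le> ennreal C * (\<integral>\<^sup>+ x. epowr (g x) p0 * w x \<partial>lebesgue)"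
      using hyp[rule_format, OF w] unfolding family_ineq_def by blast
    have upper: "(\<integral>\<^sup>+ x. epowr (y x) p0 * w x \<partial>lebesgue) \<le> epowr (L j) k * N y"
      if y [measurable]: "y \<in> borel_measurable lebesgue" and le: "\<And>x. epowr (y x) ps \<le> L j * H x" for y j
    proof -
      have "(\<integral>\<^sup>+ x. epowr (y x) p0 * w x \<partial>lebesgue) \<le> (\<integral>\<^sup>+ x. epowr (L j) k * (epowr (y x) ps * v x) \<partial>lebesgue)"
      proof (rule nn_integral_mono_AE, use Uw in eventually_elim)
        case (elim x)
        have "epowr (y x) (p0 - ps) \<le> epowr (L j * H x) k"
          using epowr_mono[OF le[of x], of k] k q by (simp add: epowr_epowr k_def)
        also have "\<dots> = epowr (L j) k * epowr (h x) (p0 - ps)"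
          using k q by (simp add: epowr_mult h_def epowr_epowr k_def)
        also have "\<dots> \<le> epowr (L j) k * epowr (U x) (p0 - ps)"
          using elim q by (intro mult_left_mono epowr_mono) auto
        finally have "epowr (y x) (p0 - ps) * epowr (U x) (- (p0 - ps)) \<le>
            epowr (L j) k * epowr (U x) (p0 - ps) * epowr (U x) (- (p0 - ps))"
          by (rule mult_right_mono) simp
        also have "\<dots> = epowr (L j) k"
          using elim epowr_add[of "U x" "p0 - ps" "- (p0 - ps)"] by (simp add: mult.assoc)
        finally have *: "epowr (y x) (p0 - ps) * epowr (U x) (- (p0 - ps)) \<le> epowr (L j) k" .
        have "epowr (y x) p0 = epowr (y x) ps * epowr (y x) (p0 - ps)"
          using epowr_add_nonneg[of ps "p0 - ps" "y x"] q by simp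
        then have "epowr (y x) p0 * w x = (epowr (y x) ps * v x) * (epowr (y x) (p0 - ps) * epowr (U x) (- (p0 - ps)))"
          using elim by (simp only: ac_simps)
        also have "\<dots> \<le> (epowr (y x) ps * v x) * epowr (L j) k"
          by (intro mult_left_mono *) simp
        finally show ?case by (simp only: ac_simps)
      qed
      also have "\<dots> = epowr (L j) k * N y"
        unfolding N_def by (rule nn_integral_cmult) measurable
      finally show ?thesis .
    qed
    define D where "D = (\<integral>\<^sup>+x. epowr (U x) ps * v x \<partial>lebesgue)"
    have "epowr D k < \<infinity>" using U_fin k by (intro epowr_finite_nonneg) (auto simp: D_def)
    then obtain d where d: "0 < d" "epowr D k \<le> ennreal d"
      by (cases "epowr D k" rule: ennreal_zero_top_pos_cases) (auto intro: that[of 1])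
    have bound: "N (f j) \<le> ennreal (d * C * 2 powr k * (2 powr k) ^ j) * N (g j)" for j
    proof -
      let ?X = "\<integral>\<^sup>+ x. epowr (f j x) p0 * w x \<partial>lebesgue"
      have X: "?X \<le> epowr (L j) k * N (f j)" by (rule upper[OF _ f_le]) simp
      have "?X < \<infinity>"
        using X fg[of j] L[of j] k by (auto simp: ennreal_mult_less_top epowr_finite intro: le_less_trans)
      then have "?X \<le> ennreal C * (\<integral>\<^sup>+ x. epowr (g j x) p0 * w x \<partial>lebesgue)"
        using fg[of j] by (intro C(2)) auto
      also have "\<dots> \<le> ennreal C * (epowr (L j) k * N (g j))"
        by (intro mult_left_mono upper[OF _ g_le]) auto
      finally have X': "?X \<le> ennreal C * (epowr (L j) k * N (g j))" .
      have "N (f j) = (\<integral>\<^sup>+x. epowr (epowr (f j x) p0 * w x) (ps / p0) * epowr (epowr (U x) ps * v x) (1 - ps / p0) \<partial>lebesgue)"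
        unfolding N_def
      proof (rule nn_integral_cong_AE, use Uw v_AE in eventually_elim)
        case (elim x)
        have "epowr (epowr (f j x) p0 * w x) (ps / p0) =
            epowr (f j x) ps * (epowr (U x) (- (p0 - ps) * (ps / p0)) * epowr (v x) (ps / p0))"
          using elim q by (simp add: epowr_mult epowr_epowr)
        moreover have "epowr (epowr (U x) ps * v x) (1 - ps / p0) = epowr (U x) (ps * (1 - ps / p0)) * epowr (v x) (1 - ps / p0)"
          using q by (simp add: epowr_mult epowr_epowr)
        moreover have "epowr (U x) (- (p0 - ps) * (ps / p0)) * epowr (U x) (ps * (1 - ps / p0)) = 1"
        proof -
          have "- (p0 - ps) * (ps / p0) + ps * (1 - ps / p0) = 0" using q by (simp add: field_simps)
          then show ?thesis using elim epowr_add[of "U x" "- (p0 - ps) * (ps / p0)" "ps * (1 - ps / p0)"] by simp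
        qed
        moreover have "epowr (v x) (ps / p0) * epowr (v x) (1 - ps / p0) = v x"
          using elim epowr_add[of "v x" "ps / p0" "1 - ps / p0"] by simp
        moreover have "epowr (f j x) ps * (epowr (U x) (- (p0 - ps) * (ps / p0)) * epowr (v x) (ps / p0)) *
            (epowr (U x) (ps * (1 - ps / p0)) * epowr (v x) (1 - ps / p0)) =
          epowr (f j x) ps * (epowr (U x) (- (p0 - ps) * (ps / p0)) * epowr (U x) (ps * (1 - ps / p0))) *
            (epowr (v x) (ps / p0) * epowr (v x) (1 - ps / p0))"
          by (simp only: ac_simps)
        ultimately show ?case by (simp only: mult_1_right)
      qed
      also have "\<dots> \<le> epowr ?X (ps / p0) * epowr D (1 - ps / p0)"
        unfolding D_def using q by (intro nn_integral_Holder) auto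
      finally have "epowr (N (f j)) (p0 / ps) \<le> epowr (epowr ?X (ps / p0) * epowr D (1 - ps / p0)) (p0 / ps)"
        using q by (intro epowr_mono) auto
      also have "\<dots> = ?X * epowr D k"
      proof -
        have "(1 - ps / p0) * (p0 / ps) = k" using q by (simp add: k_def field_simps)
        then show ?thesis using q by (simp add: epowr_mult epowr_epowr)
      qed
      also have "\<dots> \<le> (ennreal C * (epowr (L j) k * N (g j))) * ennreal d"
        by (intro mult_mono X' d) auto
      also have "epowr (L j) k = ennreal ((2 ^ Suc j) powr k) * epowr (N (f j)) k"
        unfolding L_def using k by (subst epowr_mult) (auto simp: epowr_ennreal)
      finally have "epowr (N (f j)) (p0 / ps) \<le>
          epowr (N (f j)) k * ((ennreal C * ennreal ((2 ^ Suc j) powr k) * ennreal d) * N (g j))"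
        by (simp only: ac_simps)
      moreover have "epowr (N (f j)) (p0 / ps) = epowr (N (f j)) k * N (f j)"
        using fg[of j] q epowr_add[of "N (f j)" k 1] by (simp add: k_def diff_divide_distrib)
      ultimately have "epowr (N (f j)) k * N (f j) \<le> epowr (N (f j)) k * ((ennreal C * ennreal ((2 ^ Suc j) powr k) * ennreal d) * N (g j))"
        by simp
      then have "N (f j) \<le> (ennreal C * ennreal ((2 ^ Suc j) powr k) * ennreal d) * N (g j)"
        using fg[of j] epowr_pos[of "N (f j)" k] epowr_finite[of "N (f j)" k]
        by (subst (asm) ennreal_mult_le_mult_iff) auto
      also have "ennreal C * ennreal ((2 ^ Suc j) powr k) * ennreal d = ennreal (C * (2 ^ Suc j) powr k * d)"
        using C d by (simp add: ennreal_mult)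
      also have "C * (2 ^ Suc j) powr k * d = d * C * 2 powr k * (2 powr k) ^ j"
        by (simp add: powr_mult powr_realpow[symmetric] powr_powr mult.commute)
      finally show ?thesis .
    qed
    then show "\<exists>C. \<forall>j. N (f j) \<le> ennreal (C * (2 powr k) ^ j) * N (g j)" by blast
  qed
  then show ?thesis by (simp add: N_def[abs_def] v_def)
qed

section \<open>Weights with comparable power means\<close>

lemma ennreal_le_divide_real:
  assumes "ennreal q * x \<le> ennreal y" "0 < q" "0 \<le> y"
  shows "x \<le> ennreal (y / q)"
  using ennreal_le_divideI[OF assms(1,2)] assms(2,3) by (simp add: divide_ennreal)

text \<open>By Hoelder's inequality the product in \<open>bound\<close> is at least \<open>1\<close>.  The assumption thus means that all
  power means of \<open>z\<close> over a ball with exponents between \<open>-a2\<close> and \<open>a1\<close> are comparable to one number,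
  which is called \<open>Z\<close> below.\<close>

locale power_mean_weight =
  fixes z :: "real ^ 'n \<Rightarrow> ennreal" and a1 a2 A :: real
  assumes z_meas [measurable]: "z \<in> borel_measurable lebesgue"
    and z_AE: "AE x in lebesgue. 0 < z x \<and> z x < \<infinity>"
    and a1: "0 < a1" and a2: "0 < a2" and A: "0 < A"
    and bound: "0 < \<rho> \<Longrightarrow> epowr (ball_avg a \<rho> (\<lambda>x. epowr (z x) a1)) (1 / a1) *
       epowr (ball_avg a \<rho> (\<lambda>x. epowr (z x) (- a2))) (1 / a2) \<le> ennreal A"
begin

definition Z :: "real ^ 'n \<Rightarrow> real \<Rightarrow> real" where
  "Z a \<rho> = enn2real (epowr (ball_avg a \<rho> (\<lambda>x. epowr (z x) a1)) (1 / a1))"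

lemma powers_AE: "AE x in lebesgue. 0 < epowr (z x) b \<and> epowr (z x) b < \<infinity>"
  using z_AE by eventually_elim (auto intro: epowr_pos epowr_finite)

lemma Z:
  assumes "0 < \<rho>"
  shows "0 < Z a \<rho>" "epowr (ball_avg a \<rho> (\<lambda>x. epowr (z x) a1)) (1 / a1) = ennreal (Z a \<rho>)"
proof -
  let ?X = "epowr (ball_avg a \<rho> (\<lambda>x. epowr (z x) a1)) (1 / a1)"
  let ?Y = "epowr (ball_avg a \<rho> (\<lambda>x. epowr (z x) (- a2))) (1 / a2)"
  have X: "0 < ?X" using a1 assms powers_AE[of a1]
    by (intro epowr_pos_nonneg ball_avg_pos) (auto elim!: eventually_mono)
  have Y: "0 < ?Y" using a2 assms powers_AE[of "- a2"]
    by (intro epowr_pos_nonneg ball_avg_pos) (auto elim!: eventually_mono)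
  have "?X \<noteq> \<infinity>" using bound[OF assms, of a] Y by (auto simp: ennreal_top_mult top_unique split: if_splits)
  with X show "0 < Z a \<rho>" "?X = ennreal (Z a \<rho>)"
    by (auto simp: Z_def enn2real_positive_iff less_top)
qed

lemma negative_mean_le:
  assumes "0 < \<rho>" "0 < b" "b \<le> a2"
  shows "ball_avg a \<rho> (\<lambda>x. epowr (z x) (- b)) \<le> ennreal ((A / Z a \<rho>) powr b)"
proof -
  have "epowr (ball_avg a \<rho> (\<lambda>x. epowr (inverse (z x)) b)) (1 / b) \<le> epowr (ball_avg a \<rho> (\<lambda>x. epowr (inverse (z x)) a2)) (1 / a2)"
    using assms by (intro ball_avg_power_mean) auto
  also have "\<dots> \<le> ennreal (A / Z a \<rho>)"
    using bound[OF assms(1), of a] Z[OF assms(1), of a] A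
    by (intro ennreal_le_divide_real) (auto simp: epowr_inverse)
  finally have "epowr (epowr (ball_avg a \<rho> (\<lambda>x. epowr (z x) (- b))) (1 / b)) b \<le> epowr (ennreal (A / Z a \<rho>)) b"
    using assms by (intro epowr_mono) (auto simp: epowr_inverse)
  then show ?thesis using assms A Z(1)[OF assms(1), of a] by (simp add: epowr_epowr epowr_ennreal)
qed

lemma positive_mean_le:
  assumes "0 < \<rho>" "0 < e" "e \<le> a1"
  shows "ball_avg a \<rho> (\<lambda>x. epowr (z x) e) \<le> ennreal (Z a \<rho> powr e)"
proof -
  have "epowr (ball_avg a \<rho> (\<lambda>x. epowr (z x) e)) (1 / e) \<le> ennreal (Z a \<rho>)"
    using ball_avg_power_mean[OF z_meas assms(2,3,1), of a] by (simp add: Z[OF assms(1)])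
  then have "epowr (epowr (ball_avg a \<rho> (\<lambda>x. epowr (z x) e)) (1 / e)) e \<le> epowr (ennreal (Z a \<rho>)) e"
    using assms by (intro epowr_mono) auto
  then show ?thesis using assms Z(1)[OF assms(1), of a] by (simp add: epowr_epowr epowr_ennreal)
qed

lemma positive_mean_ge:
  assumes "0 < \<rho>" "0 < e"
  shows "ennreal ((Z a \<rho> / A) powr e) \<le> ball_avg a \<rho> (\<lambda>x. epowr (z x) e)"
proof -
  let ?X = "epowr (ball_avg a \<rho> (\<lambda>x. epowr (z x) e)) (1 / e)"
  have Zp: "0 < Z a \<rho>" by (rule Z[OF assms(1)])
  have neg: "epowr (ball_avg a \<rho> (\<lambda>x. epowr (z x) (- a2))) (1 / a2) \<le> ennreal (A / Z a \<rho>)"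
  proof -
    have "epowr (ball_avg a \<rho> (\<lambda>x. epowr (z x) (- a2))) (1 / a2) \<le> epowr (ennreal ((A / Z a \<rho>) powr a2)) (1 / a2)"
      using a2 assms by (intro epowr_mono negative_mean_le) auto
    then show ?thesis using A Zp a2 by (simp add: epowr_ennreal powr_powr)
  qed
  have "1 \<le> ?X * epowr (ball_avg a \<rho> (\<lambda>x. epowr (z x) (- a2))) (1 / a2)"
    by (rule ball_avg_power_mean_neg[OF z_meas z_AE assms(2) a2 assms(1)])
  also have "\<dots> \<le> ?X * ennreal (A / Z a \<rho>)" by (intro mult_left_mono neg) simp
  finally have "ennreal (Z a \<rho> / A) * 1 \<le> ennreal (Z a \<rho> / A) * (?X * ennreal (A / Z a \<rho>))"
    by (rule mult_left_mono) simp
  also have "\<dots> = ?X * ennreal (Z a \<rho> / A * (A / Z a \<rho>))"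
    using A Zp by (subst ennreal_mult) (auto simp: ac_simps)
  finally have "ennreal (Z a \<rho> / A) \<le> ?X" using A Zp by simp
  then have "epowr (ennreal (Z a \<rho> / A)) e \<le> epowr ?X e" using assms by (intro epowr_mono) auto
  then show ?thesis using assms A Zp by (simp add: epowr_epowr epowr_ennreal)
qed

lemma Z_doubling:
  assumes "0 < \<rho>"
  shows "Z a (5 * \<rho>) \<le> (5 ^ CARD('n)) powr (1 / a2) * A * Z a \<rho>"
proof -
  let ?n = "CARD('n)"
  have \<rho>5: "0 < 5 * \<rho>" using assms by simp
  have Zp: "0 < Z a \<rho>" "0 < Z a (5 * \<rho>)" using Z[OF assms] Z[OF \<rho>5] by auto
  have "ball_avg a \<rho> (\<lambda>x. epowr (z x) (- a2)) \<le> ennreal (5 ^ ?n) * ball_avg a (5 * \<rho>) (\<lambda>x. epowr (z x) (- a2))"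
    using assms by (intro ball_avg_le_larger) auto
  also have "\<dots> \<le> ennreal (5 ^ ?n) * ennreal ((A / Z a (5 * \<rho>)) powr a2)"
    using a2 assms by (intro mult_left_mono negative_mean_le) auto
  also have "\<dots> = ennreal (5 ^ ?n * (A / Z a (5 * \<rho>)) powr a2)" by (simp add: ennreal_mult)
  finally have "epowr (ball_avg a \<rho> (\<lambda>x. epowr (z x) (- a2))) (1 / a2) \<le> epowr (ennreal (5 ^ ?n * (A / Z a (5 * \<rho>)) powr a2)) (1 / a2)"
    using a2 by (intro epowr_mono) auto
  also have "\<dots> = ennreal ((5 ^ ?n * (A / Z a (5 * \<rho>)) powr a2) powr (1 / a2))"
    using A Zp by (intro epowr_ennreal) auto
  also have "(5 ^ ?n * (A / Z a (5 * \<rho>)) powr a2) powr (1 / a2) = (5 ^ ?n) powr (1 / a2) * (A / Z a (5 * \<rho>))"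
    using A Zp a2 by (simp add: powr_mult powr_powr)
  finally have *: "epowr (ball_avg a \<rho> (\<lambda>x. epowr (z x) (- a2))) (1 / a2) \<le> ennreal ((5 ^ ?n) powr (1 / a2) * (A / Z a (5 * \<rho>)))" .
  have "1 \<le> ennreal (Z a \<rho>) * epowr (ball_avg a \<rho> (\<lambda>x. epowr (z x) (- a2))) (1 / a2)"
    using ball_avg_power_mean_neg[OF z_meas z_AE a1 a2 assms, of a] by (simp add: Z(2)[OF assms])
  also have "\<dots> \<le> ennreal (Z a \<rho>) * ennreal ((5 ^ ?n) powr (1 / a2) * (A / Z a (5 * \<rho>)))"
    by (intro mult_left_mono *) simp
  also have "\<dots> = ennreal (Z a \<rho> * ((5 ^ ?n) powr (1 / a2) * (A / Z a (5 * \<rho>))))"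
    using A Zp by (intro ennreal_mult[symmetric]) auto
  finally have "1 \<le> Z a \<rho> * ((5 ^ ?n) powr (1 / a2) * (A / Z a (5 * \<rho>)))"
    by (simp only: ennreal_ge_1)
  then show ?thesis using Zp by (simp add: field_simps)
qed

text \<open>The number \<open>Z\<close> is comparable to a mean with a negative exponent, and such means grow at most by a
  constant factor when the ball is enlarged.\<close>

lemma doubling_density:
  assumes e: "0 < e" "e \<le> a1"
  shows "\<exists>D. doubling_measure (density lebesgue (\<lambda>x. epowr (z x) e)) D"
proof -
  let ?n = "CARD('n)"
  let ?\<nu> = "density lebesgue (\<lambda>x. epowr (z x) e)"
  define d where "d = (5 ^ ?n) powr (1 / a2) * A"
  have d: "0 < d" using A by (simp add: d_def)
  have dens: "emeasure ?\<nu> (ball a \<rho>) = ball_avg a \<rho> (\<lambda>x. epowr (z x) e) * emeasure lebesgue (ball a \<rho>)" if "0 < \<rho>" for a \<rho>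
    using that by (simp add: emeasure_density ball_avg_mult_volume)
  show ?thesis
  proof (intro exI[of _ "(d * A) powr e * 5 ^ ?n"], standard)
    fix \<rho> :: real and a :: "real ^ 'n"
    show "sets ?\<nu> = sets lebesgue" by simp
    { assume \<rho>: "0 < \<rho>"
      then have \<rho>5: "0 < 5 * \<rho>" by simp
      have Zp: "0 < Z a \<rho>" "0 < Z a (5 * \<rho>)" using Z[OF \<rho>] Z[OF \<rho>5] by auto
      have "0 < ball_avg a \<rho> (\<lambda>x. epowr (z x) e)"
        using powers_AE[of e] \<rho> by (intro ball_avg_pos) (auto elim!: eventually_mono)
      then show "0 < emeasure ?\<nu> (ball a \<rho>)"
        using dens[OF \<rho>, of a] emeasure_lebesgue_ball_pos[OF \<rho>, of a] by (simp add: ennreal_zero_less_mult_iff)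
      have "ball_avg a (5 * \<rho>) (\<lambda>x. epowr (z x) e) \<le> ennreal (Z a (5 * \<rho>) powr e)"
        using e \<rho> by (intro positive_mean_le) auto
      also have "\<dots> \<le> ennreal ((d * A) powr e * (Z a \<rho> / A) powr e)"
      proof -
        have "Z a (5 * \<rho>) powr e \<le> ((d * A) * (Z a \<rho> / A)) powr e"
          using Z_doubling[OF \<rho>, of a] Zp A e by (intro powr_mono2) (auto simp: d_def)
        also have "\<dots> = (d * A) powr e * (Z a \<rho> / A) powr e" by (rule powr_mult)
        finally show ?thesis by (rule ennreal_leI)
      qed
      also have "\<dots> = ennreal ((d * A) powr e) * ennreal ((Z a \<rho> / A) powr e)"
        by (rule ennreal_mult) auto
      also have "\<dots> \<le> ennreal ((d * A) powr e) * ball_avg a \<rho> (\<lambda>x. epowr (z x) e)"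
        using e \<rho> by (intro mult_left_mono positive_mean_ge) auto
      finally have "ball_avg a (5 * \<rho>) (\<lambda>x. epowr (z x) e) * emeasure lebesgue (ball a (5 * \<rho>)) \<le>
         ennreal ((d * A) powr e) * ball_avg a \<rho> (\<lambda>x. epowr (z x) e) * (ennreal (5 ^ ?n) * emeasure lebesgue (ball a \<rho>))"
        using \<rho> by (subst emeasure_lebesgue_ball_scale[of 5 \<rho> a a]) (auto intro: mult_mono)
      then show "emeasure ?\<nu> (ball a (5 * \<rho>)) \<le> ennreal ((d * A) powr e * 5 ^ ?n) * emeasure ?\<nu> (ball a \<rho>)"
        using \<rho> by (simp add: dens ennreal_mult ac_simps) }
    show "emeasure ?\<nu> (ball a \<rho>) < \<infinity>"
    proof (cases "0 < \<rho>")
      case True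
      have "ball_avg a \<rho> (\<lambda>x. epowr (z x) e) < top"
        using positive_mean_le[OF True e, of a] by (rule le_less_trans) simp
      then show ?thesis using dens[OF True, of a] emeasure_lebesgue_ball_finite[of a \<rho>]
        by (simp add: ennreal_mult_less_top)
    next
      case False
      then have "ball a \<rho> = {}" by (intro ball_empty) simp
      then show ?thesis by (simp only: emeasure_empty) simp
    qed
  qed
qed

text \<open>Hoelder's inequality with exponent \<open>\<kappa>\<close> moves the average of \<open>K\<^sup>\<theta>\<close> to the measure
  \<open>z\<^sup>e dx\<close>; the value of \<open>\<kappa>\<close> is the one for which the remaining power of \<open>z\<close> is exactly \<open>-a2\<close>.
  Since \<open>\<kappa> \<theta> < 1\<close>, the maximal function of that doubling measure is bounded on the
  resulting space.\<close>

lemma weighted_maximal_majorant: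
  assumes e: "0 < e" "e \<le> a1" and \<theta>: "0 < \<theta>" "\<theta> < 1" and K [measurable]: "K \<in> borel_measurable lebesgue"
    and fin: "(\<integral>\<^sup>+x. K x \<partial>lebesgue) < \<infinity>"
  obtains \<Phi> where "\<Phi> \<in> borel_measurable lebesgue"
    "\<And>a \<rho> x. 0 < \<rho> \<Longrightarrow> x \<in> ball a \<rho> \<Longrightarrow>
       epowr (ball_avg a \<rho> (\<lambda>y. epowr (K y) \<theta>)) (1 / \<theta>) \<le> ennreal (Z a \<rho> powr e) * \<Phi> x"
    "(\<integral>\<^sup>+x. \<Phi> x * epowr (z x) e \<partial>lebesgue) < \<infinity>"
proof -
  let ?\<nu> = "density lebesgue (\<lambda>x. epowr (z x) e)"
  obtain D where "doubling_measure ?\<nu> D" using doubling_density[OF e] by blast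
  then interpret \<nu>: doubling_measure ?\<nu> D .
  \<comment> \<open>the solution of \<open>e (1 - \<theta> \<kappa>) = a2 (\<kappa> - 1)\<close>\<close>
  define \<kappa> where "\<kappa> = (a2 + e) / (a2 + e * \<theta>)"
  have den: "0 < a2 + e * \<theta>" using a2 e \<theta> by (simp add: add_pos_pos)
  have \<kappa>: "1 < \<kappa>" using a2 e \<theta> den by (simp add: \<kappa>_def)
  have \<kappa>\<theta>: "\<kappa> * \<theta> < 1"
  proof -
    have "(a2 + e) * \<theta> < a2 + e * \<theta>" using a2 \<theta> by (simp add: distrib_right)
    then show ?thesis using den by (simp add: \<kappa>_def)
  qed
  have rel: "e * (1 - \<theta> * \<kappa>) = a2 * (\<kappa> - 1)"
  proof -
    have "\<kappa> * (a2 + e * \<theta>) = a2 + e" using den by (simp add: \<kappa>_def)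
    then show ?thesis by (simp add: algebra_simps)
  qed
  define r where "r = 1 / (\<kappa> * \<theta>)"
  have r: "1 < r" using \<kappa> \<theta> \<kappa>\<theta> by (simp add: r_def)
  define g where "g x = epowr (K x * epowr (z x) (- e)) (\<theta> * \<kappa>)" for x
  have [measurable]: "g \<in> borel_measurable lebesgue" unfolding g_def by measurable
  define c where "c = A powr (a2 * (1 - 1 / \<kappa>) / \<theta>)"
  obtain C where C: "0 < C" "\<And>f. f \<in> borel_measurable lebesgue \<Longrightarrow>
    (\<integral>\<^sup>+x. epowr (maximal_fun ?\<nu> f x) r \<partial>?\<nu>) \<le> ennreal C * (\<integral>\<^sup>+x. epowr (f x) r \<partial>?\<nu>)"
    using \<nu>.maximal_strong_type[OF r] by blast
  show thesis
  proof
    show "(\<lambda>x. ennreal c * epowr (maximal_fun ?\<nu> g x) r) \<in> borel_measurable lebesgue"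
      by measurable
    have "(\<integral>\<^sup>+x. (ennreal c * epowr (maximal_fun ?\<nu> g x) r) * epowr (z x) e \<partial>lebesgue)
        = (\<integral>\<^sup>+x. ennreal c * epowr (maximal_fun ?\<nu> g x) r \<partial>?\<nu>)"
      by (simp add: nn_integral_density mult.commute)
    also have "\<dots> = ennreal c * (\<integral>\<^sup>+x. epowr (maximal_fun ?\<nu> g x) r \<partial>?\<nu>)"
      by (rule nn_integral_cmult) simp
    also have "\<dots> \<le> ennreal c * (ennreal C * (\<integral>\<^sup>+x. epowr (g x) r \<partial>?\<nu>))"
      by (intro mult_left_mono C) auto
    also have "(\<integral>\<^sup>+x. epowr (g x) r \<partial>?\<nu>) = (\<integral>\<^sup>+x. K x \<partial>lebesgue)"
    proof -
      have "(\<integral>\<^sup>+x. epowr (g x) r \<partial>?\<nu>) = (\<integral>\<^sup>+x. epowr (z x) e * epowr (g x) r \<partial>lebesgue)"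
        by (simp add: nn_integral_density)
      also have "\<dots> = (\<integral>\<^sup>+x. K x \<partial>lebesgue)"
      proof (rule nn_integral_cong_AE, use z_AE in eventually_elim)
        case (elim x)
        have "\<theta> * \<kappa> * r = 1" using \<theta> \<kappa> by (simp add: r_def)
        then have "epowr (g x) r = K x * epowr (z x) (- e)" by (simp only: g_def epowr_epowr epowr_one_right)
        moreover have "epowr (z x) (- e) * epowr (z x) e = 1"
          using elim epowr_add[of "z x" "- e" e] by simp
        ultimately show ?case by (simp add: mult.commute[of "epowr (z x) e"] mult.assoc)
      qed
      finally show ?thesis .
    qed
    finally show "(\<integral>\<^sup>+x. (ennreal c * epowr (maximal_fun ?\<nu> g x) r) * epowr (z x) e \<partial>lebesgue) < \<infinity>"
      using fin by (auto simp: ennreal_mult_less_top intro: le_less_trans)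
  next
    fix a :: "real ^ 'n" and \<rho> :: real and x assume \<rho>: "0 < \<rho>" and x: "x \<in> ball a \<rho>"
    let ?v = "emeasure lebesgue (ball a \<rho>)"
    have v: "0 < ?v" "?v < \<infinity>" using emeasure_lebesgue_ball_pos[OF \<rho>, of a] emeasure_lebesgue_ball_finite by auto
    have Zp: "0 < Z a \<rho>" by (rule Z[OF \<rho>])
    have avg_g: "ball_avg a \<rho> (\<lambda>y. g y * epowr (z y) e) \<le> ennreal (Z a \<rho> powr e) * maximal_fun ?\<nu> g x"
    proof -
      let ?I = "\<integral>\<^sup>+y\<in>ball a \<rho>. g y \<partial>?\<nu>" and ?m = "emeasure ?\<nu> (ball a \<rho>)"
      have m: "0 < ?m" "?m < \<infinity>" using \<nu>.ball_pos[OF \<rho>, of a] \<nu>.ball_finite[of a \<rho>] by auto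
      have m_eq: "?m / ?v = ball_avg a \<rho> (\<lambda>y. epowr (z y) e)"
        by (simp add: emeasure_density ball_avg_def)
      have "ball_avg a \<rho> (\<lambda>y. g y * epowr (z y) e) = ?I / ?v"
        by (simp add: ball_avg_def nn_integral_density ac_simps)
      also have "\<dots> = (?I / ?m) * (?m / ?v)"
      proof -
        have "inverse ?m * ?m = 1"
          using m by (cases ?m rule: ennreal_zero_top_pos_cases) (auto simp: inverse_ennreal ennreal_mult[symmetric])
        then have "?I * inverse ?v = ?I * (inverse ?m * ?m) * inverse ?v" by simp
        then show ?thesis unfolding divide_ennreal_def by (simp only: mult.assoc)
      qed
      also have "\<dots> \<le> maximal_fun ?\<nu> g x * ennreal (Z a \<rho> powr e)"
        unfolding m_eq using \<rho> x e by (intro mult_mono maximal_fun_upper positive_mean_le) auto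
      finally show ?thesis by (simp add: mult.commute)
    qed
    have "ball_avg a \<rho> (\<lambda>y. epowr (K y) \<theta>) = ball_avg a \<rho> (\<lambda>y. epowr (g y * epowr (z y) e) (1 / \<kappa>) * epowr (epowr (z y) (- a2)) (1 - 1 / \<kappa>))"
    proof (rule ball_avg_cong_AE)
      show "AE y in lebesgue. y \<in> ball a \<rho> \<longrightarrow> epowr (K y) \<theta> = epowr (g y * epowr (z y) e) (1 / \<kappa>) * epowr (epowr (z y) (- a2)) (1 - 1 / \<kappa>)"
        using z_AE
      proof eventually_elim
        case (elim y)
        have ex: "\<theta> * \<kappa> * (1 / \<kappa>) = \<theta>" "0 \<le> 1 / \<kappa>" "0 \<le> \<theta>" using \<kappa> \<theta> by auto
        have "epowr (g y * epowr (z y) e) (1 / \<kappa>) = epowr (K y) \<theta> * epowr (z y) (- e * \<theta>) * epowr (z y) (e * (1 / \<kappa>))"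
          unfolding g_def by (simp only: epowr_mult[OF ex(2)] epowr_mult[OF ex(3)] epowr_epowr ex)
        moreover have "epowr (z y) (- e * \<theta>) * epowr (z y) (e * (1 / \<kappa>)) * epowr (z y) (- a2 * (1 - 1 / \<kappa>)) = 1"
        proof -
          have "- e * \<theta> + e * (1 / \<kappa>) + - a2 * (1 - 1 / \<kappa>) = 0"
          proof -
            have "1 / \<kappa> * (e * (1 - \<theta> * \<kappa>)) = 1 / \<kappa> * (a2 * (\<kappa> - 1))" using rel by simp
            moreover have "1 / \<kappa> * (e * (1 - \<theta> * \<kappa>)) = e * (1 / \<kappa>) - e * \<theta>"
              "1 / \<kappa> * (a2 * (\<kappa> - 1)) = a2 * (1 - 1 / \<kappa>)"
              using \<kappa> by (auto simp: field_simps)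
            ultimately have "e * (1 / \<kappa>) - e * \<theta> = a2 * (1 - 1 / \<kappa>)" by (simp only:)
            then show ?thesis by linarith
          qed
          then show ?thesis using elim
            epowr_add[of "z y" "- e * \<theta> + e * (1 / \<kappa>)" "- a2 * (1 - 1 / \<kappa>)"]
            epowr_add[of "z y" "- e * \<theta>" "e * (1 / \<kappa>)"] by simp
        qed
        ultimately show ?case by (simp only: epowr_epowr mult.assoc mult_1_right simp_thms)
      qed
    qed
    also have "\<dots> \<le> epowr (ball_avg a \<rho> (\<lambda>y. g y * epowr (z y) e)) (1 / \<kappa>) * epowr (ball_avg a \<rho> (\<lambda>y. epowr (z y) (- a2))) (1 - 1 / \<kappa>)"
      using \<kappa> by (intro ball_avg_Holder) auto
    also have "\<dots> \<le> epowr (ennreal (Z a \<rho> powr e) * maximal_fun ?\<nu> g x) (1 / \<kappa>) * epowr (ennreal ((A / Z a \<rho>) powr a2)) (1 - 1 / \<kappa>)"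
      using \<kappa> \<rho> a2 by (intro mult_mono epowr_mono avg_g negative_mean_le) auto
    finally have "epowr (ball_avg a \<rho> (\<lambda>y. epowr (K y) \<theta>)) (1 / \<theta>) \<le>
       epowr (epowr (ennreal (Z a \<rho> powr e) * maximal_fun ?\<nu> g x) (1 / \<kappa>) * epowr (ennreal ((A / Z a \<rho>) powr a2)) (1 - 1 / \<kappa>)) (1 / \<theta>)"
      using \<theta> by (intro epowr_mono) auto
    also have "\<dots> = ennreal (Z a \<rho> powr (e * (1 / \<kappa>) * (1 / \<theta>))) * epowr (maximal_fun ?\<nu> g x) r * ennreal ((A / Z a \<rho>) powr (a2 * (1 - 1 / \<kappa>) * (1 / \<theta>)))"
    proof -
      have ex: "1 / \<kappa> * (1 / \<theta>) = r" "0 \<le> 1 / \<kappa>" "0 \<le> 1 / \<theta>" using \<kappa> \<theta> by (auto simp: r_def)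
      show ?thesis using Zp A by (simp only: epowr_mult[OF ex(2)] epowr_mult[OF ex(3)] epowr_epowr ex(1))
        (simp add: epowr_ennreal powr_powr ex(1)[symmetric] mult.assoc)
    qed
    also have "\<dots> = ennreal (Z a \<rho> powr (e * (1 / \<kappa>) * (1 / \<theta>)) * (A / Z a \<rho>) powr (a2 * (1 - 1 / \<kappa>) * (1 / \<theta>))) * epowr (maximal_fun ?\<nu> g x) r"
      by (subst ennreal_mult) (auto simp: ac_simps)
    also have "Z a \<rho> powr (e * (1 / \<kappa>) * (1 / \<theta>)) * (A / Z a \<rho>) powr (a2 * (1 - 1 / \<kappa>) * (1 / \<theta>)) = Z a \<rho> powr e * c"
    proof -
      have "e * (1 / \<kappa>) * (1 / \<theta>) = e + a2 * (1 - 1 / \<kappa>) / \<theta>"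
        using rel \<kappa> \<theta> by (simp add: field_simps)
      then show ?thesis
        using A Zp by (simp add: powr_divide powr_add c_def)
    qed
    also have "ennreal (Z a \<rho> powr e * c) * epowr (maximal_fun ?\<nu> g x) r = ennreal (Z a \<rho> powr e) * (ennreal c * epowr (maximal_fun ?\<nu> g x) r)"
      by (subst ennreal_mult) (auto simp: c_def mult.assoc)
    finally show "epowr (ball_avg a \<rho> (\<lambda>y. epowr (K y) \<theta>)) (1 / \<theta>) \<le> ennreal (Z a \<rho> powr e) * (ennreal c * epowr (maximal_fun ?\<nu> g x) r)" .
  qed
qed

text \<open>Hoelder's inequality with the exponents \<open>t\<close> and \<open>t / (t - 1)\<close> takes the weight out of an average.\<close>

lemma average_le_power_mean:
  assumes g [measurable]: "g \<in> borel_measurable lebesgue" and t: "1 < t" "t / (t - 1) \<le> a2" and \<rho>: "0 < \<rho>"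
  shows "ball_avg a \<rho> (\<lambda>y. g y * epowr (z y) (- 1)) \<le> epowr (ball_avg a \<rho> (\<lambda>y. epowr (g y) t)) (1 / t) * ennreal (A / Z a \<rho>)"
proof -
  let ?s = "t / (t - 1)"
  have "ball_avg a \<rho> (\<lambda>y. g y * epowr (z y) (- 1)) = ball_avg a \<rho> (\<lambda>y. epowr (epowr (g y) t) (1 / t) * epowr (epowr (z y) (- ?s)) (1 - 1 / t))"
  proof -
    have "t * (1 / t) = 1" "- ?s * (1 - 1 / t) = - 1" using t by (auto simp: field_simps)
    then show ?thesis by (simp only: epowr_epowr epowr_one_right)
  qed
  also have "\<dots> \<le> epowr (ball_avg a \<rho> (\<lambda>y. epowr (g y) t)) (1 / t) * epowr (ball_avg a \<rho> (\<lambda>y. epowr (z y) (- ?s))) (1 - 1 / t)"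
    using t by (intro ball_avg_Holder) auto
  also have "\<dots> \<le> epowr (ball_avg a \<rho> (\<lambda>y. epowr (g y) t)) (1 / t) * epowr (ennreal ((A / Z a \<rho>) powr ?s)) (1 - 1 / t)"
    using t \<rho> by (intro mult_left_mono epowr_mono negative_mean_le) auto
  also have "epowr (ennreal ((A / Z a \<rho>) powr ?s)) (1 - 1 / t) = ennreal (A / Z a \<rho>)"
  proof -
    have "?s * (1 - 1 / t) = 1" using t by (simp add: field_simps)
    moreover have "epowr (ennreal ((A / Z a \<rho>) powr ?s)) (1 - 1 / t) = ennreal ((A / Z a \<rho>) powr (?s * (1 - 1 / t)))"
      using A Z(1)[OF \<rho>, of a] by (subst epowr_ennreal) (auto simp: powr_powr)
    moreover have "(A / Z a \<rho>) powr 1 = A / Z a \<rho>"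
      using A Z(1)[OF \<rho>, of a] by simp
    ultimately show ?thesis by (simp only:)
  qed
  finally show ?thesis .
qed

end

section \<open>Log-Hoelder continuity\<close>

definition log_Holder_local :: "real \<Rightarrow> (real ^ 'n \<Rightarrow> real) \<Rightarrow> bool" where
  "log_Holder_local C E \<longleftrightarrow> 0 < C \<and> (\<forall>x y. dist x y < 1 / 2 \<longrightarrow> \<bar>E x - E y\<bar> \<le> C / (- ln (dist x y)))"

definition log_Holder_decay :: "real \<Rightarrow> real \<Rightarrow> (real ^ 'n \<Rightarrow> real) \<Rightarrow> bool" where
  "log_Holder_decay C l E \<longleftrightarrow> 0 < C \<and> (\<forall>x. \<bar>E x - l\<bar> \<le> C / ln (exp 1 + norm x))"

definition ball_vol :: "nat \<Rightarrow> real \<Rightarrow> real" where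
  "ball_vol n \<rho> = unit_ball_vol (real n) * \<rho> ^ n"

lemma emeasure_ball_vol:
  "0 \<le> \<rho> \<Longrightarrow> emeasure lebesgue (ball (a :: real ^ 'n) \<rho>) = ennreal (ball_vol CARD('n) \<rho>)"
  by (subst emeasure_lebesgue_ball) (auto simp: ball_vol_def)

lemma ball_vol_pos: "0 < \<rho> \<Longrightarrow> 0 < ball_vol n \<rho>"
  by (simp add: ball_vol_def)

text \<open>On a ball of small radius the oscillation of \<open>E\<close> is so small that volume raised to it stays
  bounded; this is the only use of the local condition.\<close>

lemma log_Holder_ball:
  fixes E :: "real ^ 'n \<Rightarrow> real"
  assumes loc: "log_Holder_local C E" and osc: "\<And>x y. \<bar>E x - E y\<bar> \<le> M"
  shows "\<exists>L\<ge>1. \<forall>a \<rho>. \<forall>x\<in>ball a \<rho>. \<forall>y\<in>ball a \<rho>.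
    max 1 (1 / ball_vol CARD('n) \<rho>) powr \<bar>E x - E y\<bar> \<le> L"
proof -
  let ?n = "CARD('n)"
  define V where "V = unit_ball_vol (real ?n)"
  have V: "0 < V" by (simp add: V_def)
  define W where "W = max 1 (8 ^ ?n / V)"
  have W: "1 \<le> W" by (simp add: W_def)
  have M: "0 \<le> M" using osc[of 0 0] by simp
  have C: "0 < C" using loc by (simp add: log_Holder_local_def)
  define L where "L = W powr M * exp (2 * real ?n * C)"
  have WM: "1 \<le> W powr M" using W M by (rule ge_one_powr_ge_zero)
  have L: "W powr M \<le> L" "1 \<le> L"
  proof -
    have "1 \<le> exp (2 * real ?n * C)" using C by simp
    then have "W powr M * 1 \<le> L" unfolding L_def using WM by (intro mult_left_mono) auto
    then show "W powr M \<le> L" "1 \<le> L" using WM by auto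
  qed
  have "max 1 (1 / ball_vol CARD('n) \<rho>) powr \<bar>E x - E y\<bar> \<le> L"
    if x: "x \<in> ball a \<rho>" and y: "y \<in> ball a \<rho>" for a \<rho> x y
  proof -
    have \<rho>: "0 < \<rho>" using x by (metis le_less_trans mem_ball zero_le_dist)
    let ?d = "\<bar>E x - E y\<bar>"
    show ?thesis
    proof (cases "1 / 8 \<le> \<rho>")
      case True
      have "(1 / 8) ^ ?n \<le> \<rho> ^ ?n" using True by (intro power_mono) auto
      then have "V * (1 / 8) ^ ?n \<le> V * \<rho> ^ ?n" using V by (intro mult_left_mono) auto
      then have "1 / ball_vol CARD('n) \<rho> \<le> 1 / (V * (1 / 8) ^ ?n)"
        unfolding ball_vol_def V_def[symmetric] using V \<rho> by (intro divide_left_mono) auto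
      also have "1 / (V * (1 / 8) ^ ?n) = 8 ^ ?n / V" by (simp add: power_one_over)
      finally have "max 1 (1 / ball_vol CARD('n) \<rho>) \<le> W" by (simp add: W_def max_def)
      then have "max 1 (1 / ball_vol CARD('n) \<rho>) powr ?d \<le> W powr ?d" by (intro powr_mono2) auto
      also have "\<dots> \<le> W powr M" using W osc by (intro powr_mono) auto
      finally show ?thesis using L by simp
    next
      case False
      then have \<rho>8: "\<rho> < 1 / 8" by simp
      have dxy: "dist x y < 2 * \<rho>" using x y dist_triangle_less_add[of x a \<rho> y \<rho>] by (simp add: dist_commute)
      have ln\<rho>: "0 < - ln \<rho>" using \<rho> \<rho>8 by simp
      have small: "?d * (- ln \<rho>) \<le> 2 * C"
      proof (cases "x = y")
        case True then show ?thesis using C by simp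
      next
        case neq: False
        have ln2: "ln (2 * \<rho>) \<le> ln \<rho> / 2"
        proof -
          have "ln \<rho> \<le> ln (1 / 4 :: real)" using \<rho> \<rho>8 by (subst ln_le_cancel_iff) auto
          also have "ln (1 / 4 :: real) = - 2 * ln 2"
            using ln_realpow[of "2::real" 2] by (simp add: ln_div)
          finally show ?thesis using \<rho> by (simp add: ln_mult)
        qed
        have "ln (dist x y) \<le> ln (2 * \<rho>)" using neq dxy \<rho> by (subst ln_le_cancel_iff) auto
        then have ln3: "- ln \<rho> / 2 \<le> - ln (dist x y)" using ln2 by simp
        have "?d \<le> C / (- ln (dist x y))"
          using loc dxy \<rho>8 by (auto simp: log_Holder_local_def)
        also have "\<dots> \<le> C / (- ln \<rho> / 2)"
          using ln3 ln\<rho> C by (intro divide_left_mono mult_pos_pos) auto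
        finally have "?d * (- ln \<rho>) \<le> C / (- ln \<rho> / 2) * (- ln \<rho>)"
          using ln\<rho> by (intro mult_right_mono) auto
        also have "\<dots> = 2 * C" using ln\<rho> by simp
        finally show ?thesis .
      qed
      have "max 1 (1 / ball_vol CARD('n) \<rho>) \<le> W * \<rho> powr (- real ?n)"
      proof -
        have p: "\<rho> powr (- real ?n) = 1 / \<rho> ^ ?n" using \<rho> by (simp add: powr_minus_divide powr_realpow)
        have "1 \<le> 1 / \<rho> ^ ?n" using \<rho> \<rho>8 by (simp add: power_le_one)
        moreover have "1 / V \<le> W"
        proof -
          have "1 / V \<le> 8 ^ ?n / V" using V by (intro divide_right_mono) auto
          then show ?thesis by (simp add: W_def)
        qed
        moreover have "0 \<le> \<rho> ^ ?n" using \<rho> by simp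
        ultimately have "1 * 1 \<le> W * (1 / \<rho> ^ ?n)" "1 / V * (1 / \<rho> ^ ?n) \<le> W * (1 / \<rho> ^ ?n)"
          using W by (intro mult_mono; simp)+
        then show ?thesis unfolding p ball_vol_def V_def[symmetric] by simp
      qed
      then have "max 1 (1 / ball_vol CARD('n) \<rho>) powr ?d \<le> (W * \<rho> powr (- real ?n)) powr ?d"
        by (intro powr_mono2) auto
      also have "\<dots> = W powr ?d * exp (real ?n * (?d * (- ln \<rho>)))"
        using \<rho> by (simp add: powr_mult powr_powr) (simp add: powr_def mult_ac)
      also have "\<dots> \<le> W powr M * exp (2 * real ?n * C)"
      proof (rule mult_mono)
        show "W powr ?d \<le> W powr M" using W osc by (intro powr_mono) auto
        have "real ?n * (?d * (- ln \<rho>)) \<le> real ?n * (2 * C)" by (intro mult_left_mono small) simp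
        then show "exp (real ?n * (?d * (- ln \<rho>))) \<le> exp (2 * real ?n * C)" by (simp add: mult_ac)
      qed auto
      finally show ?thesis by (simp add: L_def)
    qed
  qed
  then show ?thesis using L(2) by blast
qed

definition decay_tail :: "real ^ 'n \<Rightarrow> real" where
  "decay_tail x = (exp 1 + norm x) powr - (real CARD('n) + 1)"

text \<open>The exponent is one more than the dimension, which makes the tail integrable; the integral is
  compared with a sum over the balls of radius \<open>2\<^sup>k\<close>.\<close>

lemma decay_tail_measurable [measurable]: "decay_tail \<in> borel_measurable lebesgue"
proof -
  have "(decay_tail :: real ^ 'n \<Rightarrow> real) \<in> borel_measurable borel" unfolding decay_tail_def[abs_def] by measurable
  then show ?thesis by (intro measurable_completion) simp
qed

lemma decay_tail_integral: "(\<integral>\<^sup>+x. ennreal (decay_tail x) \<partial>(lebesgue :: (real ^ 'n) measure)) < \<infinity>"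
proof -
  let ?n = "CARD('n)"
  define V where "V = unit_ball_vol (real ?n)"
  have V: "0 < V" by (simp add: V_def)
  define c :: "nat \<Rightarrow> real" where "c k = 2 ^ (?n + 1) * (1 / 2 ^ (?n + 1)) ^ k" for k :: nat
  have c: "0 \<le> c k" for k by (simp add: c_def)
  have pt: "ennreal (decay_tail x) \<le> (\<Sum>k. ennreal (c k) * indicator (ball 0 (2 ^ k)) x)" for x :: "real ^ 'n"
  proof -
    have "\<exists>k. norm x < 2 ^ k" using real_arch_pow[of 2 "norm x"] by auto
    define k where "k = (LEAST k. norm x < 2 ^ k)"
    have k: "norm x < 2 ^ k" unfolding k_def by (rule LeastI_ex) fact
    have "decay_tail x \<le> c k"
    proof (cases k)
      case 0
      have "decay_tail x \<le> 1 powr - (real ?n + 1)" unfolding decay_tail_def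
        by (intro powr_mono2') (auto simp: add_increasing2)
      also have "\<dots> \<le> c k" using 0 one_le_power[of "2 :: real" "?n + 1"] by (simp add: c_def)
      finally show ?thesis .
    next
      case (Suc m)
      then have "\<not> norm x < 2 ^ m" using not_less_Least[of m "\<lambda>k. norm x < 2 ^ k"] by (simp add: k_def)
      then have "decay_tail x \<le> (2 ^ m) powr - (real ?n + 1)" unfolding decay_tail_def
        by (intro powr_mono2') (auto simp: add_increasing)
      also have "\<dots> = 1 / (2 ^ m) ^ (?n + 1)"
        by (subst powr_minus_divide, subst powr_realpow[symmetric]) (auto simp: add.commute)
      also have "\<dots> = c k"
        using Suc by (simp add: c_def power_one_over power_mult[symmetric] power_add[symmetric] mult.commute field_simps)
      finally show ?thesis .
    qed
    then have "ennreal (decay_tail x) \<le> (\<Sum>i\<in>{k}. ennreal (c i) * indicator (ball 0 (2 ^ i)) x)"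
      using k by (simp add: ennreal_leI)
    also have "\<dots> \<le> (\<Sum>k. ennreal (c k) * indicator (ball 0 (2 ^ k)) x)"
      by (rule sum_le_suminf) auto
    finally show ?thesis .
  qed
  have "(\<integral>\<^sup>+x. ennreal (decay_tail x) \<partial>(lebesgue :: (real ^ 'n) measure)) \<le>
      (\<integral>\<^sup>+x. (\<Sum>k. ennreal (c k) * indicator (ball 0 (2 ^ k)) x) \<partial>(lebesgue :: (real ^ 'n) measure))"
    by (intro nn_integral_mono pt)
  also have "\<dots> = (\<Sum>k. ennreal (c k) * emeasure lebesgue (ball (0 :: real ^ 'n) (2 ^ k)))"
    by (subst nn_integral_suminf) (auto simp: nn_integral_cmult_indicator)
  also have "\<dots> = (\<Sum>k. ennreal (2 ^ (?n + 1) * V * (1 / 2) ^ k))"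
  proof (rule suminf_cong)
    fix k
    have "emeasure lebesgue (ball (0 :: real ^ 'n) (2 ^ k)) = ennreal (V * (2 ^ k) ^ ?n)"
      by (subst emeasure_lebesgue_ball) (auto simp: V_def)
    then have "ennreal (c k) * emeasure lebesgue (ball (0 :: real ^ 'n) (2 ^ k)) = ennreal (c k * (V * (2 ^ k) ^ ?n))"
      using c V by (simp add: ennreal_mult)
    also have "c k * (V * (2 ^ k) ^ ?n) = 2 ^ (?n + 1) * V * (1 / 2) ^ k"
    proof -
      have p: "(2 ^ (?n + 1)) ^ k = (2 ^ k) ^ ?n * (2 :: real) ^ k"
        by (simp only: power_mult[symmetric] power_add[symmetric]) (simp add: algebra_simps)
      show ?thesis unfolding c_def power_one_over p by simp
    qed
    finally show "ennreal (c k) * emeasure lebesgue (ball (0 :: real ^ 'n) (2 ^ k)) = ennreal (2 ^ (?n + 1) * V * (1 / 2) ^ k)" .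
  qed
  also have "\<dots> = ennreal (2 ^ (?n + 1) * V * 2)"
  proof (rule suminf_ennreal_eq)
    have "(\<lambda>k. (1 / 2 :: real) ^ k) sums 2" using geometric_sums[of "1 / 2 :: real"] by simp
    then show "(\<lambda>k. 2 ^ (?n + 1) * V * (1 / 2) ^ k) sums (2 ^ (?n + 1) * V * 2)" by (rule sums_mult)
  qed (use V in auto)
  finally show ?thesis by (simp add: le_less_trans)
qed

text \<open>Away from the origin the exponent may be replaced by its limit at infinity: either \<open>y\<close> is below
  the integrable tail, or \<open>y\<close> raised to the difference of the exponents is bounded.\<close>

lemma log_Holder_exponent_change:
  fixes x :: "real ^ 'n"
  assumes y: "y \<le> 1" and ab: "1 \<le> a" "1 \<le> b" and d: "\<bar>a - b\<bar> \<le> C / ln (exp 1 + norm x)"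
  shows "epowr y b \<le> ennreal (exp ((real CARD('n) + 1) * C)) * epowr y a + ennreal (decay_tail x)"
proof (cases y rule: ennreal_zero_top_pos_cases)
  case zero with ab show ?thesis by simp
next
  case top with y show ?thesis by (simp add: top_unique)
next
  case (pos r)
  let ?N = "real CARD('n) + 1" and ?e = "exp 1 + norm x"
  have r: "r \<le> 1" using y pos by simp
  have e: "1 < ?e" using exp_gt_one[of "1 :: real"] norm_ge_zero[of x] by linarith
  have "r powr b \<le> exp (?N * C) * r powr a + decay_tail x"
  proof (cases "r \<le> decay_tail x")
    case True
    have "r powr b \<le> r powr 1" using r pos ab by (intro powr_mono') auto
    also have "\<dots> \<le> decay_tail x" using True pos by simp
    finally show ?thesis by (simp add: add_increasing)
  next
    case False
    have "r powr b = r powr a * r powr (b - a)" by (simp add: powr_add[symmetric])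
    also have "r powr (b - a) \<le> r powr (- \<bar>a - b\<bar>)" using r pos by (intro powr_mono') auto
    also have "\<dots> \<le> decay_tail x powr (- \<bar>a - b\<bar>)"
      using False e by (intro powr_mono2') (auto simp: decay_tail_def)
    also have "\<dots> = exp (?N * (\<bar>a - b\<bar> * ln ?e))"
      using e by (simp add: decay_tail_def powr_powr) (simp add: powr_def algebra_simps)
    also have "\<dots> \<le> exp (?N * C)"
    proof -
      have "0 < ln ?e" using e by simp
      then have "\<bar>a - b\<bar> * ln ?e \<le> C" using d by (simp add: pos_le_divide_eq)
      then show ?thesis by (simp add: mult_left_mono)
    qed
    finally have "r powr b \<le> r powr a * exp (?N * C)" by (simp add: mult_left_mono)
    moreover have "0 \<le> decay_tail x" by (simp add: decay_tail_def)
    ultimately show ?thesis by (simp add: mult.commute)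
  qed
  then have "ennreal (r powr b) \<le> ennreal (exp (?N * C) * r powr a + decay_tail x)" by (rule ennreal_leI)
  also have "\<dots> = ennreal (exp (?N * C)) * ennreal (r powr a) + ennreal (decay_tail x)"
    by (simp add: ennreal_plus ennreal_mult decay_tail_def)
  finally show ?thesis using pos by (simp add: epowr_ennreal)
qed

text \<open>The limit at infinity is approached along points of large norm.\<close>

lemma log_Holder_decay_bounds:
  fixes E :: "real ^ 'n \<Rightarrow> real"
  assumes dec: "log_Holder_decay C l E" and E: "\<And>x. e1 \<le> E x" "\<And>x. E x \<le> e2"
  shows "e1 \<le> l" "l \<le> e2"
proof -
  have close: "\<exists>x. \<bar>E x - l\<bar> < \<epsilon>" if "0 < \<epsilon>" for \<epsilon>
  proof -
    have C: "0 < C" using dec by (simp add: log_Holder_decay_def)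
    define x :: "real ^ 'n" where "x = (\<chi> i. exp (C / \<epsilon> + 1))"
    have "exp (C / \<epsilon> + 1) \<le> norm x" using component_le_norm_cart[of x undefined] by (simp add: x_def)
    then have "exp (C / \<epsilon> + 1) < exp 1 + norm x" using exp_gt_zero[of "1::real"] by linarith
    then have "C / \<epsilon> + 1 < ln (exp 1 + norm x)"
      by (metis exp_gt_zero ln_exp ln_less_cancel_iff less_trans)
    then have *: "C / \<epsilon> < ln (exp 1 + norm x)" by simp
    moreover have "0 < C / \<epsilon>" using C that by simp
    ultimately have pos: "0 < ln (exp 1 + norm x)" by (rule less_trans[rotated])
    have "C / ln (exp 1 + norm x) < \<epsilon>" using * pos that by (simp add: field_simps)
    moreover have "\<bar>E x - l\<bar> \<le> C / ln (exp 1 + norm x)" using dec by (simp add: log_Holder_decay_def)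
    ultimately show ?thesis by (intro exI[of _ x]) simp
  qed
  show "e1 \<le> l"
  proof (rule ccontr)
    assume "\<not> e1 \<le> l"
    then obtain x where "\<bar>E x - l\<bar> < e1 - l" using close[of "e1 - l"] by auto
    then show False using E(1)[of x] by simp
  qed
  show "l \<le> e2"
  proof (rule ccontr)
    assume "\<not> l \<le> e2"
    then obtain x where "\<bar>E x - l\<bar> < l - e2" using close[of "l - e2"] by auto
    then show False using E(2)[of x] by simp
  qed
qed

section \<open>The maximal function on weighted variable spaces\<close>

text \<open>With the infimum \<open>EB\<close> of the exponent over the ball, \<open>g\<^sup>E\<^sup>B \<le> g\<^sup>E\<close> because \<open>g \<ge> 1\<close> where it does
  not vanish.  This bounds the power mean of \<open>g\<close> by the power \<open>1 / (\<theta> EB)\<close> of an average \<open>X\<close> that is at most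
  the reciprocal volume to the power \<open>\<theta>\<close>, and the change of the exponent of \<open>X\<close> from \<open>EB\<close> to \<open>E x\<close>
  costs a constant by the local log-Hoelder condition.\<close>

lemma large_values_average:
  fixes g :: "real ^ 'n \<Rightarrow> ennreal" and E :: "real ^ 'n \<Rightarrow> real"
  assumes [measurable]: "g \<in> borel_measurable lebesgue" "E \<in> borel_measurable lebesgue"
    and range: "\<And>y. g y = 0 \<or> 1 \<le> g y" and \<theta>: "0 < \<theta>" "\<theta> < 1" and e1: "1 \<le> e1"
    and E: "\<And>y. e1 \<le> E y" and int: "(\<integral>\<^sup>+y. epowr (g y) (E y) \<partial>lebesgue) \<le> 1"
    and L: "1 \<le> L" "\<And>y. y \<in> ball a \<rho> \<Longrightarrow> max 1 (1 / ball_vol CARD('n) \<rho>) powr \<bar>E x - E y\<bar> \<le> L"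
    and \<rho>: "0 < \<rho>" and x: "x \<in> ball a \<rho>"
  shows "epowr (epowr (ball_avg a \<rho> (\<lambda>y. epowr (g y) (\<theta> * e1))) (1 / (\<theta> * e1))) (E x)
    \<le> ennreal L * epowr (ball_avg a \<rho> (\<lambda>y. epowr (epowr (g y) (E y)) \<theta>)) (1 / \<theta>)"
proof -
  define m where "m = max 1 (1 / ball_vol CARD('n) \<rho>)"
  have m: "1 \<le> m" by (simp add: m_def)
  define EB where "EB = Inf (E ` ball a \<rho>)"
  have bdd: "bdd_below (E ` ball a \<rho>)" using E by (intro bdd_belowI2)
  have EB_le: "EB \<le> E y" if "y \<in> ball a \<rho>" for y
    unfolding EB_def using that by (intro cInf_lower bdd) auto
  have EB_ge: "b \<le> EB" if "\<And>y. y \<in> ball a \<rho> \<Longrightarrow> b \<le> E y" for b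
    unfolding EB_def using that x by (intro cInf_greatest) (blast+)
  have EB: "e1 \<le> EB" using E by (intro EB_ge)
  have mL: "m powr (E x - EB) \<le> L"
  proof (cases "m = 1")
    case True then show ?thesis using L by simp
  next
    case False
    then have lm: "0 < ln m" using m by simp
    have "E x - ln L / ln m \<le> E y" if y: "y \<in> ball a \<rho>" for y
    proof -
      have "m powr (E x - E y) \<le> m powr \<bar>E x - E y\<bar>" using m by (intro powr_mono) auto
      also have "\<dots> \<le> L" using L(2)[OF y] by (simp add: m_def)
      finally have "ln (m powr (E x - E y)) \<le> ln L" using m L by (subst ln_le_cancel_iff) auto
      then have "(E x - E y) * ln m \<le> ln L" using m by (simp add: ln_powr)
      then show ?thesis using lm by (simp add: field_simps)
    qed
    then have "E x - ln L / ln m \<le> EB" by (rule EB_ge)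
    then have "(E x - EB) * ln m \<le> ln L" using lm by (simp add: field_simps)
    then have "exp ((E x - EB) * ln m) \<le> exp (ln L)" by simp
    then show ?thesis using m L by (simp add: powr_def)
  qed
  let ?X = "ball_avg a \<rho> (\<lambda>y. epowr (epowr (g y) (E y)) \<theta>)"
  have vol: "emeasure lebesgue (ball a \<rho>) = ennreal (ball_vol CARD('n) \<rho>)" "0 < ball_vol CARD('n) \<rho>"
    using \<rho> by (auto intro: emeasure_ball_vol ball_vol_pos)
  have X_le: "?X \<le> ennreal (m powr \<theta>)"
  proof -
    have "ball_avg a \<rho> (\<lambda>y. epowr (g y) (E y)) \<le> 1 / ennreal (ball_vol CARD('n) \<rho>)"
      unfolding ball_avg_def vol(1)
      by (intro divide_right_mono_ennreal order_trans[OF nn_integral_mono int]) (auto simp: indicator_def)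
    also have "\<dots> = ennreal (1 / ball_vol CARD('n) \<rho>)" using vol by (simp add: divide_ennreal flip: ennreal_1)
    also have "\<dots> \<le> ennreal m" by (intro ennreal_leI) (simp add: m_def)
    finally have *: "ball_avg a \<rho> (\<lambda>y. epowr (g y) (E y)) \<le> ennreal m" .
    have "?X \<le> epowr (ball_avg a \<rho> (\<lambda>y. epowr (g y) (E y))) \<theta>"
      using \<theta> \<rho> by (intro ball_avg_epowr_le) auto
    also have "\<dots> \<le> epowr (ennreal m) \<theta>" using \<theta> by (intro epowr_mono *) auto
    finally show ?thesis using m by (simp add: epowr_ennreal)
  qed
  have "epowr (ball_avg a \<rho> (\<lambda>y. epowr (g y) (\<theta> * e1))) (1 / (\<theta> * e1)) \<le> epowr (ball_avg a \<rho> (\<lambda>y. epowr (g y) (\<theta> * EB))) (1 / (\<theta> * EB))"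
    using \<theta> e1 EB \<rho> by (intro ball_avg_power_mean) auto
  also have "\<dots> \<le> epowr ?X (1 / (\<theta> * EB))"
  proof (intro epowr_mono ball_avg_mono_AE AE_I2 impI)
    fix y assume y: "y \<in> ball a \<rho>"
    have "0 < E y" "0 < \<theta> * EB" using e1 E[of y] EB \<theta> by (auto intro: mult_pos_pos)
    from range[of y] show "epowr (g y) (\<theta> * EB) \<le> epowr (epowr (g y) (E y)) \<theta>"
    proof
      assume "g y = 0"
      then show ?thesis using \<open>0 < \<theta> * EB\<close> by simp
    next
      assume "1 \<le> g y"
      moreover have "\<theta> * EB \<le> E y * \<theta>" using \<theta> EB_le[OF y] by (simp add: mult.commute)
      ultimately show ?thesis
        unfolding epowr_epowr using \<open>0 < \<theta> * EB\<close> by (intro epowr_exponent_mono)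
    qed
  qed (use \<theta> EB e1 in auto)
  finally have "epowr (epowr (ball_avg a \<rho> (\<lambda>y. epowr (g y) (\<theta> * e1))) (1 / (\<theta> * e1))) (E x) \<le> epowr (epowr ?X (1 / (\<theta> * EB))) (E x)"
    using e1 E[of x] by (intro epowr_mono) auto
  also have "\<dots> = epowr ?X (E x / (\<theta> * EB))" by (simp add: epowr_epowr)
  also have "\<dots> \<le> ennreal L * epowr ?X (1 / \<theta>)"
  proof (cases ?X rule: ennreal_zero_top_pos_cases)
    case zero
    have "0 < E x / (\<theta> * EB)" using \<theta> EB e1 E[of x] by (intro divide_pos_pos mult_pos_pos) auto
    then show ?thesis using zero \<theta> by simp
  next
    case top
    then show ?thesis using X_le by (simp add: top_unique)
  next
    case (pos r)
    have r: "r \<le> m powr \<theta>" using X_le pos by simp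
    define d where "d = E x - EB"
    have d: "0 \<le> d" using EB_le[OF x] by (simp add: d_def)
    have "r powr (E x / (\<theta> * EB)) = r powr (1 / \<theta>) * r powr (d / (\<theta> * EB))"
    proof -
      have "E x / (\<theta> * EB) = 1 / \<theta> + d / (\<theta> * EB)"
        using \<theta> EB e1 by (simp add: d_def field_simps)
      then show ?thesis by (simp add: powr_add)
    qed
    moreover have "r powr (d / (\<theta> * EB)) \<le> L"
    proof -
      have "r powr (d / (\<theta> * EB)) \<le> (m powr \<theta>) powr (d / (\<theta> * EB))"
        using r pos d \<theta> EB e1 by (intro powr_mono2) auto
      also have "\<dots> = m powr (d / EB)" using \<theta> by (simp add: powr_powr)
      also have "\<dots> \<le> m powr d"
      proof -
        have "d * 1 \<le> d * EB" using d EB e1 by (intro mult_left_mono) auto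
        then have "d / EB \<le> d" using EB e1 by (simp add: pos_divide_le_eq)
        then show ?thesis using m by (intro powr_mono) auto
      qed
      also have "\<dots> \<le> L" using mL by (simp add: d_def)
      finally show ?thesis .
    qed
    ultimately have "r powr (E x / (\<theta> * EB)) \<le> L * r powr (1 / \<theta>)"
      by (simp add: mult.commute[of L] mult_left_mono)
    then have "ennreal (r powr (E x / (\<theta> * EB))) \<le> ennreal (L * r powr (1 / \<theta>))" by (rule ennreal_leI)
    then show ?thesis using pos L by (simp add: epowr_ennreal ennreal_mult)
  qed
  finally show ?thesis .
qed

text \<open>The function \<open>\<psi> z\<close> is split at height \<open>1\<close>.  Where it is large, the local log-Hoelder condition
  replaces the variable exponent on a ball by its infimum there, at the price of a constant; where it is
  small, the decay condition replaces the exponent by its limit at infinity.  In both cases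
  the remaining factor is a power of \<open>z(x)\<close> divided by its mean, whose variable exponent is
  dominated by the two extreme exponents, so that only estimates with constant exponents remain.\<close>

theorem (in power_mean_weight) variable_maximal_finite:
  fixes E :: "real ^ 'n \<Rightarrow> real"
  assumes E_meas [measurable]: "E \<in> borel_measurable lebesgue" and E: "\<And>x. e1 \<le> E x" "\<And>x. E x \<le> e2"
    and e1: "1 < e1" and e2: "e2 \<le> a1"
    and loc: "log_Holder_local C0 E" and dec: "log_Holder_decay Ci l E"
    and t: "1 < t" "t < e1" "t / (t - 1) \<le> a2"
    and \<psi> [measurable]: "\<psi> \<in> borel_measurable lebesgue"
    and int: "(\<integral>\<^sup>+x. epowr (\<psi> x * z x) (E x) \<partial>lebesgue) \<le> 1"
  shows "(\<integral>\<^sup>+x. epowr (max (\<psi> x) (max_fun \<psi> x) * z x) (E x) \<partial>lebesgue) < \<infinity>"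
proof -
  have l: "e1 \<le> l" "l \<le> e2" using log_Holder_decay_bounds[OF dec E] by auto
  have e12: "e1 \<le> e2" using E[of 0] by simp
  define c where "c = exp ((real CARD('n) + 1) * Ci)"
  have osc: "\<bar>E x - E y\<bar> \<le> e2 - e1" for x y using E(1)[of x] E(2)[of x] E(1)[of y] E(2)[of y] by auto
  obtain L where L: "1 \<le> L" "\<And>a \<rho> x y. x \<in> ball a \<rho> \<Longrightarrow> y \<in> ball a \<rho> \<Longrightarrow>
      max 1 (1 / ball_vol CARD('n) \<rho>) powr \<bar>E x - E y\<bar> \<le> L"
    using log_Holder_ball[OF loc osc] by blast
  define \<theta> where "\<theta> = t / e1"
  have \<theta>: "0 < \<theta>" "\<theta> < 1" "\<theta> * e1 = t" using t e1 by (auto simp: \<theta>_def)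
  define G where "G x = \<psi> x * z x" for x
  define G1 where "G1 x = (if 1 < G x then G x else 0)" for x
  define G2 where "G2 x = (if 1 < G x then 0 else G x)" for x
  have [measurable]: "G \<in> borel_measurable lebesgue" unfolding G_def by measurable
  have [measurable]: "G1 \<in> borel_measurable lebesgue" "G2 \<in> borel_measurable lebesgue"
    unfolding G1_def G2_def by measurable
  have G12: "G x = G1 x + G2 x" for x by (simp add: G1_def G2_def)
  have G2_le: "G2 x \<le> 1" for x by (simp add: G2_def not_less)
  have intG: "(\<integral>\<^sup>+x. epowr (G x) (E x) \<partial>lebesgue) \<le> 1" using int by (simp add: G_def)
  have int1: "(\<integral>\<^sup>+x. epowr (G1 x) (E x) \<partial>lebesgue) \<le> 1"
  proof (rule order_trans[OF nn_integral_mono intG])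
    fix x show "epowr (G1 x) (E x) \<le> epowr (G x) (E x)"
      using E(1)[of x] e1 by (intro epowr_mono) (auto simp: G1_def)
  qed
  have int2: "(\<integral>\<^sup>+x. epowr (G2 x) (E x) \<partial>lebesgue) \<le> 1"
  proof (rule order_trans[OF nn_integral_mono intG])
    fix x show "epowr (G2 x) (E x) \<le> epowr (G x) (E x)"
      using E(1)[of x] e1 by (intro epowr_mono) (auto simp: G2_def)
  qed
  have int2_e2: "(\<integral>\<^sup>+x. epowr (G2 x) e2 \<partial>lebesgue) < \<infinity>"
  proof -
    have "(\<integral>\<^sup>+x. epowr (G2 x) e2 \<partial>lebesgue) \<le> (\<integral>\<^sup>+x. epowr (G2 x) (E x) \<partial>lebesgue)"
    proof (rule nn_integral_mono)
      fix x show "epowr (G2 x) e2 \<le> epowr (G2 x) (E x)"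
        using G2_le E(1)[of x] E(2)[of x] e1 by (intro epowr_exponent_antimono) auto
    qed
    also note int2
    finally show ?thesis by (simp add: le_less_trans[of _ 1])
  qed
  have int2_l: "(\<integral>\<^sup>+x. epowr (G2 x) l \<partial>lebesgue) < \<infinity>"
  proof -
    have "(\<integral>\<^sup>+x. epowr (G2 x) l \<partial>lebesgue) \<le> (\<integral>\<^sup>+x. ennreal c * epowr (G2 x) (E x) + ennreal (decay_tail x) \<partial>lebesgue)"
    proof (rule nn_integral_mono)
      fix x show "epowr (G2 x) l \<le> ennreal c * epowr (G2 x) (E x) + ennreal (decay_tail x)"
        unfolding c_def using G2_le E(1)[of x] l e1 dec
        by (intro log_Holder_exponent_change) (auto simp: log_Holder_decay_def)
    qed
    also have "\<dots> = ennreal c * (\<integral>\<^sup>+x. epowr (G2 x) (E x) \<partial>lebesgue) + (\<integral>\<^sup>+x. ennreal (decay_tail x) \<partial>(lebesgue :: (real ^ 'n) measure))"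
      by (simp add: nn_integral_add nn_integral_cmult)
    also have "\<dots> < \<infinity>"
      using int2 decay_tail_integral[where 'n = 'n] by (auto simp: ennreal_mult_less_top intro: le_less_trans)
    finally show ?thesis .
  qed
  have int1': "(\<integral>\<^sup>+x. epowr (G1 x) (E x) \<partial>lebesgue) < \<infinity>"
    using int1 by (simp add: le_less_trans[of _ 1])
  \<comment> \<open>\<open>\<Phi>1\<close> and \<open>\<Phi>2\<close> serve the large values, \<open>\<Phi>3\<close> and \<open>\<Phi>4\<close> the small ones; \<open>\<Theta>\<close> collects the final bound.\<close>
  obtain \<Phi>1 where [measurable]: "\<Phi>1 \<in> borel_measurable lebesgue" and \<Phi>1: "\<And>a \<rho> x. 0 < \<rho> \<Longrightarrow> x \<in> ball a \<rho> \<Longrightarrow>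
       epowr (ball_avg a \<rho> (\<lambda>y. epowr (epowr (G1 y) (E y)) \<theta>)) (1 / \<theta>) \<le> ennreal (Z a \<rho> powr e1) * \<Phi>1 x"
    "(\<integral>\<^sup>+x. \<Phi>1 x * epowr (z x) e1 \<partial>lebesgue) < \<infinity>"
    by (rule weighted_maximal_majorant[OF _ _ \<theta>(1,2) _ int1', of e1]) (use e1 e12 e2 in auto)
  obtain \<Phi>2 where [measurable]: "\<Phi>2 \<in> borel_measurable lebesgue" and \<Phi>2: "\<And>a \<rho> x. 0 < \<rho> \<Longrightarrow> x \<in> ball a \<rho> \<Longrightarrow>
       epowr (ball_avg a \<rho> (\<lambda>y. epowr (epowr (G1 y) (E y)) \<theta>)) (1 / \<theta>) \<le> ennreal (Z a \<rho> powr e2) * \<Phi>2 x"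
    "(\<integral>\<^sup>+x. \<Phi>2 x * epowr (z x) e2 \<partial>lebesgue) < \<infinity>"
    by (rule weighted_maximal_majorant[OF _ _ \<theta>(1,2) _ int1', of e2]) (use e1 e12 e2 in auto)
  have tl: "0 < t / l" "t / l < 1" "0 < t / e2" "t / e2 < 1" using t l e1 e12 by (auto simp: field_simps)
  obtain \<Phi>3 where [measurable]: "\<Phi>3 \<in> borel_measurable lebesgue" and \<Phi>3: "\<And>a \<rho> x. 0 < \<rho> \<Longrightarrow> x \<in> ball a \<rho> \<Longrightarrow>
       epowr (ball_avg a \<rho> (\<lambda>y. epowr (epowr (G2 y) l) (t / l))) (1 / (t / l)) \<le> ennreal (Z a \<rho> powr l) * \<Phi>3 x"
    "(\<integral>\<^sup>+x. \<Phi>3 x * epowr (z x) l \<partial>lebesgue) < \<infinity>"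
    by (rule weighted_maximal_majorant[OF _ _ tl(1,2) _ int2_l, of l]) (use e1 e12 e2 l in auto)
  obtain \<Phi>4 where [measurable]: "\<Phi>4 \<in> borel_measurable lebesgue" and \<Phi>4: "\<And>a \<rho> x. 0 < \<rho> \<Longrightarrow> x \<in> ball a \<rho> \<Longrightarrow>
       epowr (ball_avg a \<rho> (\<lambda>y. epowr (epowr (G2 y) e2) (t / e2))) (1 / (t / e2)) \<le> ennreal (Z a \<rho> powr e2) * \<Phi>4 x"
    "(\<integral>\<^sup>+x. \<Phi>4 x * epowr (z x) e2 \<partial>lebesgue) < \<infinity>"
    by (rule weighted_maximal_majorant[OF _ _ tl(3,4) _ int2_e2, of e2]) (use e1 e12 e2 l in auto)
  define \<Theta> where "\<Theta> x = ennreal (2 powr e2) *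
    (ennreal L * (ennreal (A powr e1) * (\<Phi>1 x * epowr (z x) e1) + ennreal (A powr e2) * (\<Phi>2 x * epowr (z x) e2)) +
     (ennreal (A powr e2) * (\<Phi>4 x * epowr (z x) e2) +
      (ennreal c * (ennreal (A powr l) * (\<Phi>3 x * epowr (z x) l)) + ennreal (decay_tail x))))" for x
  have [measurable]: "\<Theta> \<in> borel_measurable lebesgue" unfolding \<Theta>_def by measurable
  have \<Theta>_fin: "(\<integral>\<^sup>+x. \<Theta> x \<partial>lebesgue) < \<infinity>"
    using \<Phi>1(2) \<Phi>2(2) \<Phi>3(2) \<Phi>4(2) decay_tail_integral[where 'n = 'n]
    unfolding \<Theta>_def by (simp add: nn_integral_add nn_integral_cmult ennreal_mult_less_top)
  have on_ball: "epowr (ball_avg a \<rho> \<psi> * z x) (E x) \<le> \<Theta> x"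
    if \<rho>: "0 < \<rho>" and x: "x \<in> ball a \<rho>" and zx: "0 < z x" "z x < \<infinity>" for a \<rho> x
  proof -
    have Zp: "0 < Z a \<rho>" by (rule Z[OF \<rho>])
    have Ex: "e1 \<le> E x" "E x \<le> e2" "0 \<le> E x" using E[of x] e1 by auto
    define q where "q = ennreal (A / Z a \<rho>) * z x"
    define Y1 where "Y1 = epowr (ball_avg a \<rho> (\<lambda>y. epowr (G1 y) t)) (1 / t)"
    define Y2 where "Y2 = epowr (ball_avg a \<rho> (\<lambda>y. epowr (G2 y) t)) (1 / t)"
    \<comment> \<open>The factor \<open>Z\<^sup>e\<close> in the majorant cancels against the mean of the weight in \<open>q\<close>.\<close>
    have scale: "X * epowr q e \<le> ennreal (A powr e) * (\<Phi> * epowr (z x) e)"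
      if X: "X \<le> ennreal (Z a \<rho> powr e) * \<Phi>" and e: "0 < e" for X \<Phi> e
    proof -
      have "X * epowr q e \<le> (ennreal (Z a \<rho> powr e) * \<Phi>) * (ennreal ((A / Z a \<rho>) powr e) * epowr (z x) e)"
        unfolding q_def using e A Zp by (intro mult_mono X) (auto simp: epowr_mult epowr_ennreal)
      also have "\<dots> = ennreal (Z a \<rho> powr e * (A / Z a \<rho>) powr e) * (\<Phi> * epowr (z x) e)"
        by (subst ennreal_mult) (auto simp: ac_simps)
      also have "Z a \<rho> powr e * (A / Z a \<rho>) powr e = A powr e"
        using Zp A by (simp add: powr_divide)
      finally show ?thesis .
    qed
    have "ball_avg a \<rho> \<psi> = ball_avg a \<rho> (\<lambda>y. G1 y * epowr (z y) (- 1) + G2 y * epowr (z y) (- 1))"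
    proof (rule ball_avg_cong_AE)
      show "AE y in lebesgue. y \<in> ball a \<rho> \<longrightarrow> \<psi> y = G1 y * epowr (z y) (- 1) + G2 y * epowr (z y) (- 1)"
        using z_AE
      proof eventually_elim
        case (elim y)
        have "z y * epowr (z y) (- 1) = 1" using elim epowr_add[of "z y" 1 "- 1"] by simp
        then have "\<psi> y = G y * epowr (z y) (- 1)" by (simp add: G_def mult.assoc)
        then show ?case by (simp add: G12 distrib_right)
      qed
    qed
    also have "\<dots> = ball_avg a \<rho> (\<lambda>y. G1 y * epowr (z y) (- 1)) + ball_avg a \<rho> (\<lambda>y. G2 y * epowr (z y) (- 1))"
      by (rule ball_avg_add) auto
    also have "\<dots> \<le> Y1 * ennreal (A / Z a \<rho>) + Y2 * ennreal (A / Z a \<rho>)"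
      unfolding Y1_def Y2_def using t \<rho> by (intro add_mono average_le_power_mean) auto
    finally have "ball_avg a \<rho> \<psi> * z x \<le> (Y1 * ennreal (A / Z a \<rho>) + Y2 * ennreal (A / Z a \<rho>)) * z x"
      by (rule mult_right_mono) simp
    also have "\<dots> = Y1 * q + Y2 * q" by (simp add: q_def distrib_right mult.assoc)
    finally have "epowr (ball_avg a \<rho> \<psi> * z x) (E x) \<le> epowr (Y1 * q + Y2 * q) (E x)"
      using Ex by (intro epowr_mono) auto
    also have "\<dots> \<le> ennreal (2 powr E x) * (epowr (Y1 * q) (E x) + epowr (Y2 * q) (E x))"
      using Ex by (intro epowr_sum_le) auto
    also have "\<dots> \<le> ennreal (2 powr e2) * (epowr (Y1 * q) (E x) + epowr (Y2 * q) (E x))"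
      using Ex by (intro mult_right_mono ennreal_leI powr_mono) auto
    also have "\<dots> \<le> \<Theta> x"
      unfolding \<Theta>_def
    proof (intro mult_left_mono add_mono)
      let ?X = "epowr (ball_avg a \<rho> (\<lambda>y. epowr (epowr (G1 y) (E y)) \<theta>)) (1 / \<theta>)"
      have large: "epowr Y1 (E x) \<le> ennreal L * ?X"
        unfolding Y1_def \<theta>(3)[symmetric] using e1 E L \<theta> x \<rho> int1
        by (intro large_values_average) (auto simp: G1_def)
      have "epowr (Y1 * q) (E x) = epowr Y1 (E x) * epowr q (E x)" using Ex by (intro epowr_mult) auto
      also have "\<dots> \<le> (ennreal L * ?X) * (epowr q e1 + epowr q e2)"
        using Ex e1 by (intro mult_mono large epowr_le_endpoints) auto
      also have "\<dots> = ennreal L * (?X * epowr q e1 + ?X * epowr q e2)"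
        by (simp add: distrib_left mult.assoc)
      also have "\<dots> \<le> ennreal L * (ennreal (A powr e1) * (\<Phi>1 x * epowr (z x) e1) + ennreal (A powr e2) * (\<Phi>2 x * epowr (z x) e2))"
        using e1 e12 by (intro mult_left_mono add_mono scale \<Phi>1 \<Phi>2 \<rho> x) auto
      finally show "epowr (Y1 * q) (E x) \<le> ennreal L * (ennreal (A powr e1) * (\<Phi>1 x * epowr (z x) e1) + ennreal (A powr e2) * (\<Phi>2 x * epowr (z x) e2))" .
      have Y2_pow: "epowr Y2 e = epowr (ball_avg a \<rho> (\<lambda>y. epowr (epowr (G2 y) e) (t / e))) (1 / (t / e))" if "0 < e" for e
      proof -
        have "e * (t / e) = t" "1 / t * e = 1 / (t / e)" using that by auto
        then show ?thesis by (simp only: Y2_def epowr_epowr)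
      qed
      have small_e2: "epowr (Y2 * q) e2 \<le> ennreal (A powr e2) * (\<Phi>4 x * epowr (z x) e2)"
        using e1 e12 Y2_pow[of e2] \<Phi>4(1)[OF \<rho> x] by (subst epowr_mult) (auto intro: scale)
      have small_l: "epowr (Y2 * q) l \<le> ennreal (A powr l) * (\<Phi>3 x * epowr (z x) l)"
        using e1 l Y2_pow[of l] \<Phi>3(1)[OF \<rho> x] by (subst epowr_mult) (auto intro: scale)
      have "epowr (Y2 * q) (E x) \<le> epowr (Y2 * q) e2 + (ennreal c * epowr (Y2 * q) l + ennreal (decay_tail x))"
      proof (cases "Y2 * q \<le> 1")
        case True
        have "epowr (Y2 * q) (E x) \<le> ennreal c * epowr (Y2 * q) l + ennreal (decay_tail x)"
          unfolding c_def using True Ex e1 l dec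
          by (intro log_Holder_exponent_change) (auto simp: log_Holder_decay_def abs_minus_commute)
        then show ?thesis by (simp add: add_increasing)
      next
        case False
        then have "epowr (Y2 * q) (E x) \<le> epowr (Y2 * q) e2"
          using Ex e1 by (intro epowr_exponent_mono) auto
        then show ?thesis by (simp add: add_increasing2)
      qed
      also have "\<dots> \<le> ennreal (A powr e2) * (\<Phi>4 x * epowr (z x) e2) +
          (ennreal c * (ennreal (A powr l) * (\<Phi>3 x * epowr (z x) l)) + ennreal (decay_tail x))"
        by (intro add_mono mult_left_mono small_e2 small_l) auto
      finally show "epowr (Y2 * q) (E x) \<le> ennreal (A powr e2) * (\<Phi>4 x * epowr (z x) e2) +
          (ennreal c * (ennreal (A powr l) * (\<Phi>3 x * epowr (z x) l)) + ennreal (decay_tail x))" .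
    qed simp
    finally show ?thesis .
  qed
  have "(\<integral>\<^sup>+x. epowr (max (\<psi> x) (max_fun \<psi> x) * z x) (E x) \<partial>lebesgue) \<le> (\<integral>\<^sup>+x. epowr (G x) (E x) + \<Theta> x \<partial>lebesgue)"
  proof (rule nn_integral_mono_AE, use z_AE in eventually_elim)
    case (elim x)
    have Ex: "0 < E x" using E(1)[of x] e1 by simp
    have zz: "z x * epowr (z x) (- 1) = 1" using elim epowr_add[of "z x" 1 "- 1"] by simp
    have "max_fun \<psi> x \<le> epowr (\<Theta> x) (1 / E x) * epowr (z x) (- 1)"
    proof (rule max_fun_least)
      fix a \<rho> assume "0 < \<rho>" "x \<in> ball a \<rho>"
      then have "ball_avg a \<rho> \<psi> * z x \<le> epowr (\<Theta> x) (1 / E x)"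
        using elim Ex by (intro le_epowr_inverse on_ball) auto
      then have "ball_avg a \<rho> \<psi> * z x * epowr (z x) (- 1) \<le> epowr (\<Theta> x) (1 / E x) * epowr (z x) (- 1)"
        by (rule mult_right_mono) simp
      then show "ball_avg a \<rho> \<psi> \<le> epowr (\<Theta> x) (1 / E x) * epowr (z x) (- 1)"
        by (simp add: mult.assoc zz)
    qed
    then have "max_fun \<psi> x * z x \<le> epowr (\<Theta> x) (1 / E x) * epowr (z x) (- 1) * z x"
      by (rule mult_right_mono) simp
    then have "max_fun \<psi> x * z x \<le> epowr (\<Theta> x) (1 / E x)"
      by (simp only: mult.assoc mult.commute[of "epowr (z x) (- 1)"] zz mult_1_right)
    then have M: "epowr (max_fun \<psi> x * z x) (E x) \<le> \<Theta> x" using Ex by (rule epowr_inverse_le)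
    show ?case
    proof (cases "\<psi> x \<le> max_fun \<psi> x")
      case True
      then show ?thesis using M by (simp add: max_def add_increasing)
    next
      case False
      then show ?thesis by (simp add: max_def G_def add_increasing2)
    qed
  qed
  also have "\<dots> = (\<integral>\<^sup>+x. epowr (G x) (E x) \<partial>lebesgue) + (\<integral>\<^sup>+x. \<Theta> x \<partial>lebesgue)"
    by (rule nn_integral_add) measurable
  also have "\<dots> < \<infinity>" using intG \<Theta>_fin by (auto intro: le_less_trans)
  finally show ?thesis .
qed

section \<open>The variable norm\<close>

text \<open>For a finite exponent the supremum in the modular runs over the empty set and vanishes.\<close>

lemma var_modular_finite_exponent:
  fixes p :: "real ^ 'n \<Rightarrow> real"
  shows "var_modular (\<lambda>x. ereal (p x)) f l = (\<integral>\<^sup>+x. epowr (f x / ennreal l) (p x) \<partial>lebesgue)"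
proof -
  have meas: "f \<in> borel_measurable (restrict_space lebesgue {})"
    by (simp add: measurable_def space_restrict_space)
  have "esssup (restrict_space lebesgue {}) f = Inf {z. AE x in restrict_space lebesgue {}. f x \<le> z}"
    using meas by (rule esssup_eq_AE)
  also have "{z. AE x in restrict_space lebesgue {}. f x \<le> z} = UNIV"
    by (auto simp: AE_restrict_space_iff)
  finally have "esssup (restrict_space lebesgue {}) f = 0" by (simp add: bot_ennreal)
  then show ?thesis by (simp add: var_modular_def)
qed

lemma ennreal_inverse_antimono_real:
  assumes "l \<le> k"
  shows "inverse (ennreal k) \<le> inverse (ennreal l)"
proof (cases "0 < l")
  case True
  then show ?thesis using assms by (auto simp: inverse_ennreal intro!: ennreal_leI le_imp_inverse_le)
next
  case False
  then have "ennreal l = 0" by (simp add: ennreal_eq_0_iff)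
  then show ?thesis by simp
qed

lemma var_modular_mono:
  fixes p :: "real ^ 'n \<Rightarrow> real"
  assumes "l \<le> k" "\<And>x. 0 \<le> p x"
  shows "var_modular (\<lambda>x. ereal (p x)) f k \<le> var_modular (\<lambda>x. ereal (p x)) f l"
  unfolding var_modular_finite_exponent
  unfolding divide_ennreal_def
  using assms by (intro nn_integral_mono epowr_mono mult_left_mono) (auto intro: ennreal_inverse_antimono_real)

lemma var_norm_le:
  "0 < l \<Longrightarrow> var_modular p f l \<le> 1 \<Longrightarrow> var_norm p f \<le> ennreal l"
  unfolding var_norm_def by (rule Inf_lower) auto

lemma var_modular_le_one:
  fixes p :: "real ^ 'n \<Rightarrow> real"
  assumes "var_norm (\<lambda>x. ereal (p x)) f < ennreal l" "\<And>x. 0 \<le> p x"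
  shows "var_modular (\<lambda>x. ereal (p x)) f l \<le> 1"
proof -
  obtain k where k: "0 < k" "var_modular (\<lambda>x. ereal (p x)) f k \<le> 1" "ennreal k < ennreal l"
    using assms(1) unfolding var_norm_def Inf_less_iff by auto
  then have "k \<le> l" by (simp add: ennreal_less_iff)
  from var_modular_mono[OF this assms(2)] k(2) show ?thesis by (rule order_trans)
qed

text \<open>If the norm vanishes, the modular at every height \<open>l \<le> 1\<close> is at most \<open>1\<close>; as \<open>p \<ge> 1\<close>, the modular at
  height \<open>1\<close> is then at most \<open>l\<close>.\<close>

lemma var_norm_pos:
  fixes p :: "real ^ 'n \<Rightarrow> real"
  assumes [measurable]: "f \<in> borel_measurable lebesgue" "p \<in> borel_measurable lebesgue"
    and p: "\<And>x. 1 \<le> p x" and nz: "\<not> (AE x in lebesgue. f x = 0)"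
  shows "0 < var_norm (\<lambda>x. ereal (p x)) f"
proof (rule ccontr)
  assume "\<not> ?thesis"
  then have z: "var_norm (\<lambda>x. ereal (p x)) f = 0" by simp
  have p0: "0 \<le> p x" "0 < p x" for x using p[of x] by auto
  have le: "(\<integral>\<^sup>+x. epowr (f x) (p x) \<partial>lebesgue) \<le> ennreal l" if l: "0 < l" "l \<le> 1" for l
  proof -
    have "(\<integral>\<^sup>+x. epowr (f x) (p x) \<partial>lebesgue) \<le> (\<integral>\<^sup>+x. ennreal l * epowr (f x / ennreal l) (p x) \<partial>lebesgue)"
    proof (rule nn_integral_mono)
      fix x
      have "f x = ennreal l * (f x / ennreal l)"
        using l by (simp add: ennreal_times_divide mult.commute[of "ennreal l"] mult_divide_eq_ennreal)
      then have "epowr (f x) (p x) = epowr (ennreal l) (p x) * epowr (f x / ennreal l) (p x)"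
        using p0[of x] epowr_mult[of "p x" "ennreal l" "f x / ennreal l"] by simp
      also have "epowr (ennreal l) (p x) \<le> epowr (ennreal l) 1"
        using l p[of x] by (intro epowr_exponent_antimono) auto
      finally show "epowr (f x) (p x) \<le> ennreal l * epowr (f x / ennreal l) (p x)"
        by (simp add: mult_right_mono)
    qed
    also have "\<dots> = ennreal l * var_modular (\<lambda>x. ereal (p x)) f l"
      unfolding var_modular_finite_exponent by (rule nn_integral_cmult) measurable
    also have "\<dots> \<le> ennreal l * 1"
      using z l p0 by (intro mult_left_mono var_modular_le_one) auto
    finally show ?thesis by simp
  qed
  have "(\<integral>\<^sup>+x. epowr (f x) (p x) \<partial>lebesgue) \<le> 0"
  proof (rule ennreal_le_epsilon)
    fix e :: real assume "0 < e"
    then have "(\<integral>\<^sup>+x. epowr (f x) (p x) \<partial>lebesgue) \<le> ennreal (min e 1)" by (intro le) auto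
    also have "\<dots> \<le> ennreal e" by (intro ennreal_leI) simp
    finally show "(\<integral>\<^sup>+x. epowr (f x) (p x) \<partial>lebesgue) \<le> 0 + ennreal e" by simp
  qed
  then have "AE x in lebesgue. epowr (f x) (p x) = 0" by (simp add: nn_integral_0_iff_AE)
  then have "AE x in lebesgue. f x = 0" by eventually_elim (simp add: epowr_eq_0_iff p0)
  with nz show False ..
qed

section \<open>From variable to constant weight conditions\<close>

text \<open>A bound for the power means of a function in the unit ball of a variable space, by the power of
  the volume that one expects if the exponent were constant: on small balls equal to its
  value at the centre, on large balls equal to its limit at infinity.\<close>

lemma power_mean_le_volume:
  fixes r :: "real ^ 'n \<Rightarrow> real"
  assumes r_meas [measurable]: "r \<in> borel_measurable lebesgue" and r: "\<And>x. e \<le> r x" "\<And>x. r x \<le> r2" and e: "1 \<le> e"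
    and loc: "log_Holder_local C0 r" and dec: "log_Holder_decay Ci l r"
  shows "\<exists>C>0. \<forall>a. \<forall>\<rho>>0. \<forall>V\<in>borel_measurable lebesgue.
    (\<integral>\<^sup>+y\<in>ball a \<rho>. epowr (V y) (r y) \<partial>lebesgue) \<le> 1 \<longrightarrow>
    epowr (ball_avg a \<rho> (\<lambda>y. epowr (V y) e)) (1 / e) \<le>
      ennreal (C * ball_vol CARD('n) \<rho> powr (- 1 / (if ball_vol CARD('n) \<rho> \<le> 1 then r a else l)))"
proof -
  have osc: "\<bar>r x - r y\<bar> \<le> r2 - e" for x y using r(1)[of x] r(2)[of x] r(1)[of y] r(2)[of y] by auto
  obtain L where L: "1 \<le> L" "\<And>a \<rho> x y. x \<in> ball a \<rho> \<Longrightarrow> y \<in> ball a \<rho> \<Longrightarrow>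
      max 1 (1 / ball_vol CARD('n) \<rho>) powr \<bar>r x - r y\<bar> \<le> L"
    using log_Holder_ball[OF loc osc] by blast
  have l: "e \<le> l" using log_Holder_decay_bounds[OF dec r] by auto
  define c where "c = exp ((real CARD('n) + 1) * Ci)"
  have c: "1 \<le> c" using dec by (simp add: c_def log_Holder_decay_def)
  obtain T where T: "0 \<le> T" "(\<integral>\<^sup>+x. ennreal (decay_tail x) \<partial>(lebesgue :: (real ^ 'n) measure)) = ennreal T"
    using decay_tail_integral[where 'n = 'n]
    by (cases "\<integral>\<^sup>+x. ennreal (decay_tail x) \<partial>(lebesgue :: (real ^ 'n) measure)") auto
  define C where "C = 1 + L + c + T"
  have C: "1 \<le> C" "0 < C" using L c T by (auto simp: C_def)
  have finish: "epowr (ball_avg a \<rho> (\<lambda>y. epowr (V y) e)) (1 / e) \<le> ennreal (C * v powr (- 1 / s))"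
    if le: "ball_avg a \<rho> (\<lambda>y. epowr (V y) e) \<le> ennreal (B * v powr (- e / s))" and B: "0 < B" "B \<le> C" and v: "0 < v"
    for a \<rho> V B v s
  proof -
    have "epowr (ball_avg a \<rho> (\<lambda>y. epowr (V y) e)) (1 / e) \<le> epowr (ennreal (B * v powr (- e / s))) (1 / e)"
      using e by (intro epowr_mono le) auto
    also have "\<dots> = ennreal ((B * v powr (- e / s)) powr (1 / e))"
      using B v by (intro epowr_ennreal) auto
    also have "(B * v powr (- e / s)) powr (1 / e) = B powr (1 / e) * v powr (- 1 / s)"
      using e by (simp add: powr_mult powr_powr)
    also have "B powr (1 / e) \<le> C powr (1 / e)" using B e by (intro powr_mono2) auto
    also have "C powr (1 / e) \<le> C powr 1" using C e by (intro powr_mono) auto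
    finally show ?thesis using C by (simp add: mult_right_mono ennreal_leI)
  qed
  have "epowr (ball_avg a \<rho> (\<lambda>y. epowr (V y) e)) (1 / e) \<le>
      ennreal (C * ball_vol CARD('n) \<rho> powr (- 1 / (if ball_vol CARD('n) \<rho> \<le> 1 then r a else l)))"
    if \<rho>: "0 < \<rho>" and [measurable]: "V \<in> borel_measurable lebesgue"
      and int: "(\<integral>\<^sup>+y\<in>ball a \<rho>. epowr (V y) (r y) \<partial>lebesgue) \<le> 1" for a \<rho> V
  proof -
    define v where "v = ball_vol CARD('n) \<rho>"
    have v: "0 < v" using \<rho> by (simp add: v_def ball_vol_pos)
    have vol: "emeasure lebesgue (ball a \<rho>) = ennreal v" using \<rho> by (simp add: v_def emeasure_ball_vol)
    have avg1: "ball_avg a \<rho> h \<le> ennreal (k / v)" if "(\<integral>\<^sup>+y\<in>ball a \<rho>. h y \<partial>lebesgue) \<le> ennreal k" "0 \<le> k" for h k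
      unfolding ball_avg_def vol using divide_right_mono_ennreal[OF that(1), of "ennreal v"] v that(2)
      by (simp add: divide_ennreal)
    have avgV: "ball_avg a \<rho> (\<lambda>y. epowr (V y) (r y)) \<le> ennreal (1 / v)"
      using int by (intro avg1) auto
    show ?thesis
    proof (cases "v \<le> 1")
      case small: True
      have ra: "1 \<le> r a" using r(1)[of a] e by simp
      have "ennreal (v powr (e / r a)) * ball_avg a \<rho> (\<lambda>y. epowr (V y) e) = ball_avg a \<rho> (\<lambda>y. ennreal (v powr (e / r a)) * epowr (V y) e)"
        by (rule ball_avg_cmult[symmetric]) measurable
      also have "\<dots> \<le> ball_avg a \<rho> (\<lambda>y. 1 + ennreal (L * v) * epowr (V y) (r y))"
      proof (intro ball_avg_mono_AE AE_I2 impI)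
        fix y assume y: "y \<in> ball a \<rho>"
        define X where "X = ennreal (v powr (1 / r a)) * V y"
        have ry: "0 < r y" "e \<le> r y" using r(1)[of y] e by auto
        have "epowr X e \<le> 1 + epowr X (r y)"
        proof (cases "X \<le> 1")
          case True
          then have "epowr X e \<le> epowr 1 e" using e by (intro epowr_mono) auto
          then show ?thesis by (simp add: add_increasing2)
        next
          case False
          then have "epowr X e \<le> epowr X (r y)" using ry e by (intro epowr_exponent_mono) auto
          then show ?thesis by (simp add: add_increasing)
        qed
        moreover have "epowr X e = ennreal (v powr (e / r a)) * epowr (V y) e"
          using e v by (simp add: X_def epowr_mult epowr_ennreal powr_powr)
        moreover have "epowr X (r y) \<le> ennreal (L * v) * epowr (V y) (r y)"
        proof -
          have "v powr (r y / r a) = v * v powr ((r y - r a) / r a)"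
          proof -
            have "r y / r a = 1 + (r y - r a) / r a" using ra by (simp add: field_simps)
            then show ?thesis using v by (simp add: powr_add)
          qed
          also have "v powr ((r y - r a) / r a) \<le> v powr (- \<bar>r a - r y\<bar>)"
          proof -
            have "\<bar>r a - r y\<bar> * 1 \<le> \<bar>r a - r y\<bar> * r a" using ra by (intro mult_left_mono) auto
            then have "- (\<bar>r a - r y\<bar> * r a) \<le> - \<bar>r a - r y\<bar>" by simp
            also have "\<dots> \<le> r y - r a" by simp
            finally have "- \<bar>r a - r y\<bar> * r a \<le> r y - r a" by simp
            then have "- \<bar>r a - r y\<bar> \<le> (r y - r a) / r a" using ra by (simp add: pos_le_divide_eq)
            then show ?thesis using v small by (intro powr_mono') auto
          qed
          also have "v powr (- \<bar>r a - r y\<bar>) = (1 / v) powr \<bar>r a - r y\<bar>"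
            using v by (simp add: powr_minus_divide powr_divide)
          also have "\<dots> \<le> L" using L(2)[of a a \<rho> y] y \<rho> v small by (simp add: v_def[symmetric] max_def)
          finally have "v powr (r y / r a) \<le> L * v" using v by (simp add: mult.commute mult_left_mono)
          moreover have "epowr X (r y) = ennreal (v powr (r y / r a)) * epowr (V y) (r y)"
            using ry v by (simp add: X_def epowr_mult epowr_ennreal powr_powr)
          ultimately show ?thesis by (auto intro!: mult_right_mono ennreal_leI)
        qed
        ultimately show "ennreal (v powr (e / r a)) * epowr (V y) e \<le> 1 + ennreal (L * v) * epowr (V y) (r y)"
          by (auto intro: order_trans add_left_mono)
      qed
      also have "\<dots> = 1 + ennreal (L * v) * ball_avg a \<rho> (\<lambda>y. epowr (V y) (r y))"
        using \<rho> by (simp add: ball_avg_add ball_avg_const ball_avg_cmult)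
      also have "\<dots> \<le> 1 + ennreal (L * v) * ennreal (1 / v)"
        by (intro add_left_mono mult_left_mono avgV) auto
      also have "\<dots> = ennreal (1 + L)"
        using v L by (simp add: ennreal_mult[symmetric] ennreal_plus)
      finally have "ball_avg a \<rho> (\<lambda>y. epowr (V y) e) \<le> ennreal ((1 + L) / v powr (e / r a))"
        using v L by (intro ennreal_le_divide_real) auto
      also have "(1 + L) / v powr (e / r a) = (1 + L) * v powr (- e / r a)"
        using v by (simp add: powr_minus_divide)
      finally show ?thesis
        using small L c T v finish[of a \<rho> V "1 + L" v "r a"] by (simp add: v_def[symmetric] C_def)
    next
      case large: False
      define V1 where "V1 y = (if V y \<le> 1 then V y else 0)" for y
      have [measurable]: "V1 \<in> borel_measurable lebesgue" unfolding V1_def by measurable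
      have el: "0 < e / l" "e / l \<le> 1" using e l by auto
      have V1l: "ball_avg a \<rho> (\<lambda>y. epowr (V1 y) l) \<le> ennreal ((c + T) / v)"
      proof (rule avg1)
        have "(\<integral>\<^sup>+y\<in>ball a \<rho>. epowr (V1 y) l \<partial>lebesgue) \<le>
          (\<integral>\<^sup>+y. ennreal c * (epowr (V y) (r y) * indicator (ball a \<rho>) y) + ennreal (decay_tail y) \<partial>lebesgue)"
        proof (rule nn_integral_mono)
          fix y
          have "epowr (V1 y) l \<le> ennreal c * epowr (V1 y) (r y) + ennreal (decay_tail y)"
            unfolding c_def using r(1)[of y] l e dec
            by (intro log_Holder_exponent_change) (auto simp: log_Holder_decay_def V1_def)
          also have "\<dots> \<le> ennreal c * epowr (V y) (r y) + ennreal (decay_tail y)"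
            using r(1)[of y] e by (intro add_right_mono mult_left_mono epowr_mono) (auto simp: V1_def)
          finally show "epowr (V1 y) l * indicator (ball a \<rho>) y \<le>
              ennreal c * (epowr (V y) (r y) * indicator (ball a \<rho>) y) + ennreal (decay_tail y)"
            by (auto simp: indicator_def)
        qed
        also have "\<dots> = ennreal c * (\<integral>\<^sup>+y\<in>ball a \<rho>. epowr (V y) (r y) \<partial>lebesgue) + ennreal T"
          by (simp add: nn_integral_add nn_integral_cmult T(2))
        also have "\<dots> \<le> ennreal c * 1 + ennreal T"
          by (intro add_right_mono mult_left_mono int) simp
        also have "\<dots> = ennreal (c + T)" using c T by (simp add: ennreal_plus)
        finally show "(\<integral>\<^sup>+y\<in>ball a \<rho>. epowr (V1 y) l \<partial>lebesgue) \<le> ennreal (c + T)" .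
      qed (use c T in simp)
      have "ball_avg a \<rho> (\<lambda>y. epowr (V y) e) \<le> ball_avg a \<rho> (\<lambda>y. epowr (epowr (V1 y) l) (e / l) + epowr (V y) (r y))"
      proof (intro ball_avg_mono_AE AE_I2 impI)
        fix y
        show "epowr (V y) e \<le> epowr (epowr (V1 y) l) (e / l) + epowr (V y) (r y)"
        proof (cases "V y \<le> 1")
          case True
          then show ?thesis using e l by (simp add: V1_def epowr_epowr add_increasing2)
        next
          case False
          then have "epowr (V y) e \<le> epowr (V y) (r y)" using e r(1)[of y] by (intro epowr_exponent_mono) auto
          then show ?thesis by (simp add: add_increasing)
        qed
      qed
      also have "\<dots> = ball_avg a \<rho> (\<lambda>y. epowr (epowr (V1 y) l) (e / l)) + ball_avg a \<rho> (\<lambda>y. epowr (V y) (r y))"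
        by (rule ball_avg_add) measurable
      also have "\<dots> \<le> epowr (ball_avg a \<rho> (\<lambda>y. epowr (V1 y) l)) (e / l) + ennreal (1 / v)"
        using el \<rho> by (intro add_mono ball_avg_epowr_le avgV) auto
      also have "\<dots> \<le> epowr (ennreal ((c + T) / v)) (e / l) + ennreal (1 / v)"
        using el by (intro add_right_mono epowr_mono V1l) auto
      also have "\<dots> = ennreal (((c + T) / v) powr (e / l) + 1 / v)"
        using c T v by (simp add: epowr_ennreal ennreal_plus)
      also have "\<dots> \<le> ennreal ((c + T + 1) * v powr (- e / l))"
      proof (rule ennreal_leI)
        have "((c + T) / v) powr (e / l) = (c + T) powr (e / l) * v powr (- e / l)"
          using c T v by (simp add: powr_divide powr_minus_divide)
        also have "(c + T) powr (e / l) \<le> (c + T) powr 1" using c T el by (intro powr_mono) auto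
        finally have "((c + T) / v) powr (e / l) \<le> (c + T) * v powr (- e / l)"
          using c T by (simp add: mult_right_mono)
        moreover have "1 / v \<le> v powr (- e / l)"
        proof -
          have "1 / v = v powr (- 1)" using v by (simp add: powr_minus_divide)
          also have "\<dots> \<le> v powr (- e / l)" using large el by (intro powr_mono) auto
          finally show ?thesis .
        qed
        ultimately show "((c + T) / v) powr (e / l) + 1 / v \<le> (c + T + 1) * v powr (- e / l)"
          by (simp add: distrib_right)
      qed
      finally show ?thesis
        using large L c T v finish[of a \<rho> V "c + T + 1" v l] by (simp add: v_def[symmetric] C_def)
    qed
  qed
  then show ?thesis using C(2) by (intro exI[of _ C] conjI) auto
qed

lemma log_Holder_local_Lipschitz:
  assumes "log_Holder_local C r" "0 < K" "\<And>x y. \<bar>s x - s y\<bar> \<le> K * \<bar>r x - r y\<bar>"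
  shows "log_Holder_local (K * C) s"
  unfolding log_Holder_local_def
proof (intro conjI allI impI)
  show "0 < K * C" using assms by (simp add: log_Holder_local_def)
  fix x y :: "real ^ 'a" assume "dist x y < 1 / 2"
  then have "K * \<bar>r x - r y\<bar> \<le> K * (C / - ln (dist x y))"
    using assms by (intro mult_left_mono) (auto simp: log_Holder_local_def)
  then show "\<bar>s x - s y\<bar> \<le> K * C / - ln (dist x y)" using assms(3)[of x y] by simp
qed

lemma log_Holder_decay_Lipschitz:
  assumes "log_Holder_decay C l r" "0 < K" "\<And>x. \<bar>s x - m\<bar> \<le> K * \<bar>r x - l\<bar>"
  shows "log_Holder_decay (K * C) m s"
  unfolding log_Holder_decay_def
proof (intro conjI allI)
  show "0 < K * C" using assms by (simp add: log_Holder_decay_def)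
  fix x :: "real ^ 'a"
  have "K * \<bar>r x - l\<bar> \<le> K * (C / ln (exp 1 + norm x))"
    using assms by (intro mult_left_mono) (auto simp: log_Holder_decay_def)
  then show "\<bar>s x - m\<bar> \<le> K * C / ln (exp 1 + norm x)" using assms(3)[of x] by simp
qed

lemma conjugate_Lipschitz:
  fixes u v r1 :: real
  assumes "1 < r1" "r1 \<le> u" "r1 \<le> v"
  shows "\<bar>u / (u - 1) - v / (v - 1)\<bar> \<le> 1 / (r1 - 1)\<^sup>2 * \<bar>u - v\<bar>"
proof -
  have "u / (u - 1) - v / (v - 1) = (v - u) / ((u - 1) * (v - 1))"
    using assms by (simp add: field_simps)
  then have "\<bar>u / (u - 1) - v / (v - 1)\<bar> = \<bar>u - v\<bar> / ((u - 1) * (v - 1))"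
    using assms by (simp add: abs_mult abs_minus_commute)
  also have "\<dots> \<le> \<bar>u - v\<bar> / (r1 - 1)\<^sup>2"
    using assms by (intro divide_left_mono) (auto simp: power2_eq_square intro!: mult_mono mult_pos_pos)
  finally show ?thesis by simp
qed

lemma conj_exp_ereal_real: "1 < r \<Longrightarrow> conj_exp (ereal r) = ereal (r / (r - 1))"
  by (simp add: conj_exp_def one_ereal_def field_simps)

text \<open>The previous lemma is applied to \<open>W\<close> and to \<open>1/W\<close>, normalized in the spaces with exponents \<open>r\<close>
  and \<open>r'\<close>.  On each ball the same reference value serves for both, so the two powers of the volume have
  conjugate exponents and multiply to the reciprocal volume.\<close>

lemma A_var_imp_power_means:
  fixes W :: "real ^ 'n \<Rightarrow> ennreal" and r :: "real ^ 'n \<Rightarrow> real"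
  assumes W: "W \<in> A_var (\<lambda>x. ereal (r x))"
    and r_meas [measurable]: "r \<in> borel_measurable lebesgue" and r: "\<And>x. r1 \<le> r x" "\<And>x. r x \<le> r2" and r1: "1 < r1"
    and loc: "log_Holder_local C0 r" and dec: "log_Holder_decay Ci l r"
  shows "\<exists>A>0. \<forall>a. \<forall>\<rho>>0. epowr (ball_avg a \<rho> (\<lambda>x. epowr (W x) r1)) (1 / r1) *
    ball_avg a \<rho> (\<lambda>x. inverse (W x)) \<le> ennreal A"
proof -
  define r' where "r' x = r x / (r x - 1)" for x
  have [measurable]: "W \<in> borel_measurable lebesgue" using W by (simp add: A_var_def weight_def)
  have W_AE: "AE x in lebesgue. 0 < W x \<and> W x < \<infinity>" using W by (simp add: A_var_def)
  have [measurable]: "r' \<in> borel_measurable lebesgue" unfolding r'_def by measurable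
  have rx: "1 < r x" for x using r(1)[of x] r1 by simp
  have r'1: "1 \<le> r' x" for x using rx[of x] by (simp add: r'_def)
  have r'2: "r' x \<le> r1 / (r1 - 1)" for x
  proof -
    have "r' x = 1 + 1 / (r x - 1)" using rx[of x] by (simp add: r'_def field_simps)
    also have "\<dots> \<le> 1 + 1 / (r1 - 1)" using r(1)[of x] r1 by (intro add_left_mono divide_left_mono) auto
    also have "\<dots> = r1 / (r1 - 1)" using r1 by (simp add: field_simps)
    finally show ?thesis .
  qed
  have l: "r1 \<le> l" using log_Holder_decay_bounds[OF dec r] by auto
  define K where "K = 1 / (r1 - 1)\<^sup>2"
  have K: "0 < K" using r1 by (simp add: K_def)
  have loc': "log_Holder_local (K * C0) r'"
    using loc K by (rule log_Holder_local_Lipschitz) (use conjugate_Lipschitz[OF r1 r(1) r(1)] in \<open>auto simp: r'_def K_def\<close>)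
  have dec': "log_Holder_decay (K * Ci) (l / (l - 1)) r'"
    using dec K by (rule log_Holder_decay_Lipschitz) (use conjugate_Lipschitz[OF r1 r(1) l] in \<open>auto simp: r'_def K_def\<close>)
  define s where "s a \<rho> = (if ball_vol CARD('n) \<rho> \<le> 1 then r a else l)" for a \<rho>
  obtain C1 where C1: "0 < C1" "\<And>a \<rho> V. 0 < \<rho> \<Longrightarrow> V \<in> borel_measurable lebesgue \<Longrightarrow>
    (\<integral>\<^sup>+y\<in>ball a \<rho>. epowr (V y) (r y) \<partial>lebesgue) \<le> 1 \<Longrightarrow>
    epowr (ball_avg a \<rho> (\<lambda>y. epowr (V y) r1)) (1 / r1) \<le> ennreal (C1 * ball_vol CARD('n) \<rho> powr (- 1 / s a \<rho>))"
    using power_mean_le_volume[OF r_meas r _ loc dec] r1 unfolding s_def by auto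
  obtain C2 where C2: "0 < C2" "\<And>a \<rho> V. 0 < \<rho> \<Longrightarrow> V \<in> borel_measurable lebesgue \<Longrightarrow>
    (\<integral>\<^sup>+y\<in>ball a \<rho>. epowr (V y) (r' y) \<partial>lebesgue) \<le> 1 \<Longrightarrow>
    ball_avg a \<rho> V \<le> ennreal (C2 * ball_vol CARD('n) \<rho> powr (- 1 / (s a \<rho> / (s a \<rho> - 1))))"
  proof -
    have eq: "(if b then r' a else l / (l - 1)) = (if b then r a else l) / ((if b then r a else l) - 1)" for b a
      by (simp add: r'_def)
    show thesis
      using that power_mean_le_volume[of r' 1, OF _ r'1 r'2 _ loc' dec'] unfolding s_def eq by auto
  qed
  define S where "S = (SUP (a, \<rho>) \<in> UNIV \<times> {0<..}.
        inverse (emeasure lebesgue (ball a \<rho>))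
        * var_norm (\<lambda>x. ereal (r x)) (\<lambda>x. W x * indicator (ball a \<rho>) x)
        * var_norm (\<lambda>x. conj_exp (ereal (r x))) (\<lambda>x. inverse (W x) * indicator (ball a \<rho>) x))"
  have "S < \<infinity>" using W by (simp add: A_var_def S_def)
  then obtain A0 where A0: "0 \<le> A0" "S = ennreal A0" by (cases S) auto
  have conj: "(\<lambda>x. conj_exp (ereal (r x))) = (\<lambda>x. ereal (r' x))"
    using rx by (simp add: conj_exp_ereal_real r'_def)
  define A where "A = 4 * (A0 + 1) * C1 * C2"
  have A: "0 < A" using A0 C1 C2 by (simp add: A_def)
  have "epowr (ball_avg a \<rho> (\<lambda>x. epowr (W x) r1)) (1 / r1) * ball_avg a \<rho> (\<lambda>x. inverse (W x)) \<le> ennreal A"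
    if \<rho>: "0 < \<rho>" for a \<rho>
  proof -
    define v where "v = ball_vol CARD('n) \<rho>"
    have v: "0 < v" using \<rho> by (simp add: v_def ball_vol_pos)
    have vol: "emeasure lebesgue (ball a \<rho>) = ennreal v" using \<rho> by (simp add: v_def emeasure_ball_vol)
    let ?f = "\<lambda>x. W x * indicator (ball a \<rho>) x" and ?g = "\<lambda>x. inverse (W x) * indicator (ball a \<rho>) x"
    define N1 where "N1 = var_norm (\<lambda>x. ereal (r x)) ?f"
    define N2 where "N2 = var_norm (\<lambda>x. ereal (r' x)) ?g"
    have nz: "\<not> (AE x in lebesgue. h x * indicator (ball a \<rho>) x = (0::ennreal))" if "AE x in lebesgue. 0 < h x" for h :: "real ^ 'n \<Rightarrow> ennreal"
    proof
      assume "AE x in lebesgue. h x * indicator (ball a \<rho>) x = 0"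
      with that have "AE x in lebesgue. x \<notin> ball a \<rho>"
        by eventually_elim (auto simp: indicator_def split: if_splits)
      then obtain x where "x \<in> ball a \<rho>" "x \<notin> ball a \<rho>" using ball_ex_AE[OF _ \<rho>] by blast
      then show False by blast
    qed
    have N1: "0 < N1" unfolding N1_def
      using W_AE rx by (intro var_norm_pos nz) (auto elim!: eventually_mono simp: less_imp_le)
    have N2: "0 < N2" unfolding N2_def
    proof (intro var_norm_pos nz r'1)
      show "AE x in lebesgue. 0 < inverse (W x)" using W_AE
      proof eventually_elim
        case (elim x)
        then show ?case by (simp add: zero_less_iff_neq_zero less_top)
      qed
    qed measurable
    have prod: "inverse (ennreal v) * N1 * N2 \<le> ennreal A0"
    proof -
      have "inverse (ennreal v) * N1 * N2 \<le> S"
        unfolding S_def N1_def N2_def conj vol[symmetric] using \<rho> by (intro SUP_upper2[of "(a, \<rho>)"]) auto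
      then show ?thesis using A0 by simp
    qed
    have iv: "inverse (ennreal v) = ennreal (1 / v)" using v by (simp add: inverse_ennreal divide_inverse)
    have "N1 \<noteq> \<infinity>" "N2 \<noteq> \<infinity>"
      using prod N1 N2 v unfolding iv by (auto simp: ennreal_mult_top ennreal_top_mult top_unique split: if_splits)
    then obtain n1 n2 where n: "0 < n1" "N1 = ennreal n1" "0 < n2" "N2 = ennreal n2"
      using N1 N2 by (cases N1 rule: ennreal_zero_top_pos_cases; cases N2 rule: ennreal_zero_top_pos_cases) auto
    have nn: "n1 * n2 \<le> A0 * v"
    proof -
      have "1 / v * n1 * n2 \<le> A0"
        using prod n v A0 unfolding iv by (simp add: ennreal_mult[symmetric])
      then show ?thesis using v by (simp add: field_simps)
    qed
    have mod: "(\<integral>\<^sup>+y\<in>ball a \<rho>. epowr (ennreal (1 / (2 * k)) * h y) (q y) \<partial>lebesgue) \<le> 1"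
      if "var_norm (\<lambda>x. ereal (q x)) (\<lambda>x. h x * indicator (ball a \<rho>) x) = ennreal k" "0 < k" "\<And>x. 1 \<le> q x" for q h k
    proof -
      have q: "0 < q x" "0 \<le> q x" for x using that(3)[of x] by auto
      have "var_modular (\<lambda>x. ereal (q x)) (\<lambda>x. h x * indicator (ball a \<rho>) x) (2 * k) \<le> 1"
      proof (rule var_modular_le_one)
        show "var_norm (\<lambda>x. ereal (q x)) (\<lambda>x. h x * indicator (ball a \<rho>) x) < ennreal (2 * k)"
          unfolding that(1) using that(2) by (simp add: ennreal_less_iff)
      qed (rule q(2))
      moreover have "(\<integral>\<^sup>+y\<in>ball a \<rho>. epowr (ennreal (1 / (2 * k)) * h y) (q y) \<partial>lebesgue) =
          (\<integral>\<^sup>+y. epowr (h y * indicator (ball a \<rho>) y / ennreal (2 * k)) (q y) \<partial>lebesgue)"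
      proof (rule nn_integral_cong)
        fix y
        have "0 < 2 * k" using that(2) by simp
        then have "inverse (ennreal (2 * k)) = ennreal (1 / (2 * k))"
          by (simp only: inverse_ennreal inverse_eq_divide)
        then have eq: "h y / ennreal (2 * k) = ennreal (1 / (2 * k)) * h y"
          unfolding divide_ennreal_def by (simp only: mult.commute)
        show "epowr (ennreal (1 / (2 * k)) * h y) (q y) * indicator (ball a \<rho>) y = epowr (h y * indicator (ball a \<rho>) y / ennreal (2 * k)) (q y)"
        proof (cases "y \<in> ball a \<rho>")
          case True
          then show ?thesis by (simp only: indicator_simps mult_1_right eq)
        next
          case False
          then show ?thesis using q(1)[of y] by simp
        qed
      qed
      ultimately show ?thesis by (simp add: var_modular_finite_exponent)
    qed
    have b1: "epowr (ball_avg a \<rho> (\<lambda>y. epowr (W y) r1)) (1 / r1) \<le> ennreal (2 * n1 * (C1 * v powr (- 1 / s a \<rho>)))"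
    proof -
      have "epowr (ball_avg a \<rho> (\<lambda>y. epowr (ennreal (1 / (2 * n1)) * W y) r1)) (1 / r1) \<le> ennreal (C1 * v powr (- 1 / s a \<rho>))"
        unfolding v_def using n(1,2) rx \<rho> by (intro C1(2) mod) (auto simp: N1_def less_imp_le)
      moreover have "ball_avg a \<rho> (\<lambda>y. epowr (ennreal (1 / (2 * n1)) * W y) r1) = epowr (ennreal (1 / (2 * n1))) r1 * ball_avg a \<rho> (\<lambda>y. epowr (W y) r1)"
        using r1 by (simp add: epowr_mult ball_avg_cmult)
      ultimately have "ennreal (1 / (2 * n1)) * epowr (ball_avg a \<rho> (\<lambda>y. epowr (W y) r1)) (1 / r1) \<le> ennreal (C1 * v powr (- 1 / s a \<rho>))"
        using r1 by (simp add: epowr_mult epowr_epowr)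
      then have "epowr (ball_avg a \<rho> (\<lambda>y. epowr (W y) r1)) (1 / r1) \<le> ennreal (C1 * v powr (- 1 / s a \<rho>) / (1 / (2 * n1)))"
        using n C1 by (intro ennreal_le_divide_real) auto
      then show ?thesis by (simp add: mult.commute)
    qed
    have b2: "ball_avg a \<rho> (\<lambda>y. inverse (W y)) \<le> ennreal (2 * n2 * (C2 * v powr (- 1 / (s a \<rho> / (s a \<rho> - 1)))))"
    proof -
      have "ball_avg a \<rho> (\<lambda>y. ennreal (1 / (2 * n2)) * inverse (W y)) \<le> ennreal (C2 * v powr (- 1 / (s a \<rho> / (s a \<rho> - 1))))"
        unfolding v_def using n(3,4) r'1 \<rho> by (intro C2(2) mod) (auto simp: N2_def less_imp_le)
      then have "ennreal (1 / (2 * n2)) * ball_avg a \<rho> (\<lambda>y. inverse (W y)) \<le> ennreal (C2 * v powr (- 1 / (s a \<rho> / (s a \<rho> - 1))))"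
        by (simp add: ball_avg_cmult)
      then have "ball_avg a \<rho> (\<lambda>y. inverse (W y)) \<le> ennreal (C2 * v powr (- 1 / (s a \<rho> / (s a \<rho> - 1))) / (1 / (2 * n2)))"
        using n C2 by (intro ennreal_le_divide_real) auto
      then show ?thesis by (simp add: mult.commute)
    qed
    have "epowr (ball_avg a \<rho> (\<lambda>x. epowr (W x) r1)) (1 / r1) * ball_avg a \<rho> (\<lambda>x. inverse (W x)) \<le>
        ennreal (2 * n1 * (C1 * v powr (- 1 / s a \<rho>))) * ennreal (2 * n2 * (C2 * v powr (- 1 / (s a \<rho> / (s a \<rho> - 1)))))"
      by (intro mult_mono b1 b2) auto
    also have "\<dots> = ennreal (2 * n1 * (C1 * v powr (- 1 / s a \<rho>)) * (2 * n2 * (C2 * v powr (- 1 / (s a \<rho> / (s a \<rho> - 1))))))"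
      using n C1 C2 by (intro ennreal_mult[symmetric]) auto
    also have "2 * n1 * (C1 * v powr (- 1 / s a \<rho>)) * (2 * n2 * (C2 * v powr (- 1 / (s a \<rho> / (s a \<rho> - 1))))) =
        4 * C1 * C2 * (n1 * n2) * (v powr (- 1 / s a \<rho>) * v powr (- 1 / (s a \<rho> / (s a \<rho> - 1))))"
      by simp
    also have "v powr (- 1 / s a \<rho>) * v powr (- 1 / (s a \<rho> / (s a \<rho> - 1))) = 1 / v"
    proof -
      have "1 < s a \<rho>" using rx l r1 by (simp add: s_def)
      then have "- 1 / s a \<rho> + - 1 / (s a \<rho> / (s a \<rho> - 1)) = - 1" by (simp add: field_simps)
      then have "v powr (- 1 / s a \<rho>) * v powr (- 1 / (s a \<rho> / (s a \<rho> - 1))) = v powr (- 1)"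
        by (simp only: powr_add[symmetric])
      then show ?thesis using v by (simp only: powr_minus_divide powr_one less_imp_le)
    qed
    also have "ennreal (4 * C1 * C2 * (n1 * n2) * (1 / v)) \<le> ennreal A"
    proof (rule ennreal_leI)
      have "4 * C1 * C2 * (n1 * n2) * (1 / v) \<le> 4 * C1 * C2 * (A0 * v) * (1 / v)"
        using C1 C2 v by (intro mult_right_mono mult_left_mono nn) auto
      also have "\<dots> = 4 * C1 * C2 * A0" using v by simp
      also have "\<dots> \<le> A" using C1 C2 A0 by (simp add: A_def algebra_simps)
      finally show "4 * C1 * C2 * (n1 * n2) * (1 / v) \<le> A" .
    qed
    finally show ?thesis .
  qed
  then show ?thesis using A by blast
qed

section \<open>Extrapolation to the variable norm\<close>

lemma dual_exponent_Lipschitz: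
  fixes a b ps pm :: real
  assumes "0 < ps" "ps < pm" "pm \<le> a" "pm \<le> b"
  shows "\<bar>a / (a - ps) - b / (b - ps)\<bar> \<le> ps / (pm - ps)\<^sup>2 * \<bar>a - b\<bar>"
proof -
  have "a / (a - ps) - b / (b - ps) = ps * (b - a) / ((a - ps) * (b - ps))"
    using assms by (simp add: field_simps)
  then have "\<bar>a / (a - ps) - b / (b - ps)\<bar> = ps * \<bar>a - b\<bar> / ((a - ps) * (b - ps))"
    using assms by (simp add: abs_mult abs_minus_commute)
  also have "\<dots> \<le> ps * \<bar>a - b\<bar> / (pm - ps)\<^sup>2"
    using assms by (intro divide_left_mono) (auto simp: power2_eq_square intro!: mult_mono mult_pos_pos)
  finally show ?thesis by simp
qed

lemma dual_exponent_antimono: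
  fixes a b ps :: real
  assumes "0 < ps" "ps < a" "a \<le> b"
  shows "b / (b - ps) \<le> a / (a - ps)"
proof -
  have "a * ps \<le> b * ps" using assms by (intro mult_right_mono) auto
  then show ?thesis using assms by (simp add: field_simps)
qed

text \<open>The parameters satisfy the following.  With \<open>b = 1 - ps/qp\<close> the inequality with exponent \<open>ps\<close> holds
  for the weights \<open>u\<^sup>b\<close>, \<open>u \<in> A\<^sub>1\<close>, and \<open>u\<^sup>b w\<^sup>-\<^sup>p\<^sup>s\<close> has to lie in the space with exponent \<open>es = P / (P - ps)\<close>, conjugate to
  \<open>P/ps\<close>.  For \<open>u = m\<^sup>\<delta>\<close> with a majorant \<open>m\<close> obtained from the maximal operator this says that \<open>m w\<^sup>-\<^sup>\<rho>\<close>
  lies in the space with exponent \<open>E = \<delta> b es\<close>, where \<open>\<rho> = ps / (\<delta> b)\<close>.  The condition on \<open>t\<close> makes \<open>E\<close>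
  larger than \<open>t > 1\<close>; the condition \<open>harm\<close> ensures that \<open>\<sigma>\<close> is at least \<open>\<rho>\<close> times the
  largest value of \<open>E\<close>; the condition on \<open>\<alpha>\<close> concerns Hoelder's inequality with exponent \<open>t\<close>.\<close>

theorem variable_extrapolation:
  fixes F :: "((real ^ 'n \<Rightarrow> ennreal) \<times> (real ^ 'n \<Rightarrow> ennreal)) set" and P :: "real ^ 'n \<Rightarrow> real"
  assumes F: "\<forall>(f, g)\<in>F. f \<in> borel_measurable lebesgue \<and> g \<in> borel_measurable lebesgue"
    and hyp: "\<forall>w0 \<in> A_const (p0 / qm) \<inter> RH (conj_exp (qp / p0)).
           family_ineq F (\<lambda>h. \<integral>\<^sup>+ x. epowr (h x) p0 * w0 x \<partial>lebesgue)"
    and q: "0 < qm" "qm < ps" "ps < p0" "p0 < qp"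
    and P_meas [measurable]: "P \<in> borel_measurable lebesgue" and P: "\<And>x. pm \<le> P x" "\<And>x. P x \<le> pp" and ps: "ps < pm"
    and loc: "log_Holder_local C0 P" and dec: "log_Holder_decay Ci l P"
    and \<sigma>: "\<sigma> = ps * qm / (ps - qm)" and harm: "ps * (qm + pm) < 2 * qm * pm"
    and \<delta>: "0 < \<delta>" "\<delta> < 1" and t: "1 < t" "t < \<delta> * (1 - ps / qp) * (pp / (pp - ps))"
    and \<alpha>: "0 < \<alpha>" "t / (t - 1) \<le> \<alpha> * \<delta> * (1 - ps / qp) / ps"
    and w_meas [measurable]: "w \<in> borel_measurable lebesgue" and w_AE: "AE x in lebesgue. 0 < w x \<and> w x < \<infinity>"
    and A: "0 < A" and w_bound: "\<And>a \<rho>. 0 < \<rho> \<Longrightarrow> epowr (ball_avg a \<rho> (\<lambda>x. epowr (w x) \<alpha>)) (1 / \<alpha>) *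
       epowr (ball_avg a \<rho> (\<lambda>x. epowr (w x) (- \<sigma>))) (1 / \<sigma>) \<le> ennreal A"
  shows "family_ineq F (\<lambda>h. var_norm (\<lambda>x. ereal (P x)) (\<lambda>x. h x * w x))"
proof -
  define b where "b = 1 - ps / qp"
  have b: "0 < b" using q by (simp add: b_def)
  have ps0: "0 < ps" using q by simp
  have pmp: "pm \<le> pp" using P(1)[of 0] P(2)[of 0] by simp
  have Px: "ps < P x" "0 < P x" "0 \<le> P x" for x using P(1)[of x] ps ps0 by auto
  define \<rho> where "\<rho> = ps / (\<delta> * b)"
  have \<rho>: "0 < \<rho>" "\<rho> * (\<delta> * b) = ps" using ps0 \<delta> b by (auto simp: \<rho>_def)
  have \<sigma>0: "0 < \<sigma>" using q by (simp add: \<sigma>)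
  define es where "es x = P x / (P x - ps)" for x
  have es: "1 < es x" for x using Px[of x] ps0 by (simp add: es_def)
  define E where "E x = \<delta> * b * es x" for x
  have [measurable]: "es \<in> borel_measurable lebesgue" unfolding es_def by measurable
  have [measurable]: "E \<in> borel_measurable lebesgue" unfolding E_def by measurable
  define e1 where "e1 = \<delta> * b * (pp / (pp - ps))"
  define e2 where "e2 = \<delta> * b * (pm / (pm - ps))"
  have E_bounds: "e1 \<le> E x" "E x \<le> e2" for x
    unfolding e1_def e2_def E_def es_def using \<delta> b P ps ps0 Px
    by (intro mult_left_mono dual_exponent_antimono; simp)+
  have E0: "0 < E x" for x using \<delta> b es[of x] by (simp add: E_def)
  have e1: "1 < e1" "t < e1" using t by (auto simp: e1_def b_def)
  define Kl where "Kl = \<delta> * b * (ps / (pm - ps)\<^sup>2)"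
  have Kl: "0 < Kl" using \<delta> b ps ps0 by (simp add: Kl_def)
  have Lip: "\<bar>\<delta> * b * (u / (u - ps)) - \<delta> * b * (v / (v - ps))\<bar> \<le> Kl * \<bar>u - v\<bar>" if "pm \<le> u" "pm \<le> v" for u v
  proof -
    have "\<bar>\<delta> * b * (u / (u - ps)) - \<delta> * b * (v / (v - ps))\<bar> = \<delta> * b * \<bar>u / (u - ps) - v / (v - ps)\<bar>"
      unfolding right_diff_distrib[symmetric] abs_mult using \<delta> b by simp
    also have "\<dots> \<le> \<delta> * b * (ps / (pm - ps)\<^sup>2 * \<bar>u - v\<bar>)"
      using \<delta> b that ps ps0 by (intro mult_left_mono dual_exponent_Lipschitz) auto
    finally show ?thesis by (simp add: Kl_def mult.assoc)
  qed
  have l: "pm \<le> l" using log_Holder_decay_bounds[OF dec P] by auto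
  have locE: "log_Holder_local (Kl * C0) E"
    using loc Kl by (rule log_Holder_local_Lipschitz) (use Lip P(1) in \<open>auto simp: E_def es_def\<close>)
  have decE: "log_Holder_decay (Kl * Ci) (\<delta> * b * (l / (l - ps))) E"
    using dec Kl by (rule log_Holder_decay_Lipschitz) (use Lip P(1) l in \<open>auto simp: E_def es_def\<close>)
  define z where "z x = epowr (w x) (- \<rho>)" for x
  have [measurable]: "z \<in> borel_measurable lebesgue" unfolding z_def by measurable
  have e2_a1: "e2 \<le> \<sigma> / \<rho>"
  proof -
    have "\<rho> * e2 = ps * (pm / (pm - ps))"
      using \<rho>(2) by (simp add: e2_def mult.assoc[symmetric])
    also have "\<dots> \<le> \<sigma>"
    proof -
      have "ps * pm * (ps - qm) \<le> ps * qm * (pm - ps)"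
        using mult_left_mono[OF less_imp_le[OF harm], of ps] ps0 by (simp add: algebra_simps)
      then show ?thesis unfolding \<sigma> using ps q by (simp add: field_simps)
    qed
    finally show ?thesis using \<rho>(1) by (simp add: field_simps)
  qed
  interpret power_mean_weight z "\<sigma> / \<rho>" "\<alpha> / \<rho>" "A powr \<rho>"
  proof
    show "AE x in lebesgue. 0 < z x \<and> z x < \<infinity>"
      using w_AE by eventually_elim (auto simp: z_def intro: epowr_pos epowr_finite)
    fix r :: real and a :: "real ^ 'n" assume r: "0 < r"
    have "- \<rho> * (\<sigma> / \<rho>) = - \<sigma>" "- \<rho> * - (\<alpha> / \<rho>) = \<alpha>" using \<rho> by auto
    then have "epowr (ball_avg a r (\<lambda>x. epowr (z x) (\<sigma> / \<rho>))) (1 / (\<sigma> / \<rho>)) * epowr (ball_avg a r (\<lambda>x. epowr (z x) (- (\<alpha> / \<rho>)))) (1 / (\<alpha> / \<rho>))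
      = epowr (ball_avg a r (\<lambda>x. epowr (w x) (- \<sigma>))) (1 / (\<sigma> / \<rho>)) * epowr (ball_avg a r (\<lambda>x. epowr (w x) \<alpha>)) (1 / (\<alpha> / \<rho>))"
      by (simp only: z_def epowr_epowr)
    also have "\<dots> = epowr (epowr (ball_avg a r (\<lambda>x. epowr (w x) \<alpha>)) (1 / \<alpha>) * epowr (ball_avg a r (\<lambda>x. epowr (w x) (- \<sigma>))) (1 / \<sigma>)) \<rho>"
      using \<rho> by (simp add: epowr_mult epowr_epowr mult.commute)
    also have "\<dots> \<le> epowr (ennreal A) \<rho>" using \<rho> by (intro epowr_mono w_bound r) auto
    finally show "epowr (ball_avg a r (\<lambda>x. epowr (z x) (\<sigma> / \<rho>))) (1 / (\<sigma> / \<rho>)) *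
        epowr (ball_avg a r (\<lambda>x. epowr (z x) (- (\<alpha> / \<rho>)))) (1 / (\<alpha> / \<rho>)) \<le> ennreal (A powr \<rho>)"
      using A by (simp add: epowr_ennreal)
  qed (use \<rho> \<sigma>0 \<alpha> A in auto)
  have t_a2: "t / (t - 1) \<le> \<alpha> / \<rho>"
    using \<alpha>(2) by (simp add: \<rho>_def b_def mult.assoc)
  define N where "N h = var_norm (\<lambda>x. ereal (P x)) (\<lambda>x. h x * w x)" for h
  have "family_ineq F N"
  proof (rule family_ineqI)
    show "1 \<le> (2 :: real) powr (1 / ps)" using ps0 by (intro ge_one_powr_ge_zero) auto
  next
    fix f g :: "nat \<Rightarrow> real ^ 'n \<Rightarrow> ennreal"
    assume fg: "\<And>j. (f j, g j) \<in> F \<and> 0 < N (f j) \<and> N (f j) < \<infinity> \<and> N (g j) < N (f j)"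
    have [measurable]: "f j \<in> borel_measurable lebesgue" "g j \<in> borel_measurable lebesgue" for j
      using F fg[of j] by auto
    have "\<exists>n. 0 < n \<and> N (f j) = ennreal n" for j
      using fg[of j] by (cases "N (f j)" rule: ennreal_zero_top_pos_cases) auto
    then obtain n where n: "\<And>j. 0 < n j" "\<And>j. N (f j) = ennreal (n j)" by metis
    \<comment> \<open>Twice the norm, so that the modular is at most \<open>1\<close> without a limit argument; it is bounded below
      because at half the norm the modular exceeds \<open>1\<close>.\<close>
    define Y where "Y j x = f j x * w x / ennreal (2 * n j)" for j x
    have [measurable]: "Y j \<in> borel_measurable lebesgue" for j unfolding Y_def by measurable
    have Y_le: "(\<integral>\<^sup>+x. epowr (Y j x) (P x) \<partial>lebesgue) \<le> 1" for j
    proof -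
      have "var_modular (\<lambda>x. ereal (P x)) (\<lambda>x. f j x * w x) (2 * n j) \<le> 1"
        using n[of j] Px by (intro var_modular_le_one) (auto simp: N_def ennreal_less_iff)
      then show ?thesis by (simp add: var_modular_finite_exponent Y_def)
    qed
    have Y_ge: "1 \<le> ennreal (4 powr pp) * (\<integral>\<^sup>+x. epowr (Y j x) (P x) \<partial>lebesgue)" for j
    proof -
      have "\<not> var_modular (\<lambda>x. ereal (P x)) (\<lambda>x. f j x * w x) (n j / 2) \<le> 1"
      proof
        assume "var_modular (\<lambda>x. ereal (P x)) (\<lambda>x. f j x * w x) (n j / 2) \<le> 1"
        then have "N (f j) \<le> ennreal (n j / 2)" unfolding N_def using n(1)[of j] by (intro var_norm_le) auto
        then show False using n[of j] by (simp add: ennreal_le_iff)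
      qed
      then have "1 \<le> (\<integral>\<^sup>+x. epowr (f j x * w x / ennreal (n j / 2)) (P x) \<partial>lebesgue)"
        by (simp add: var_modular_finite_exponent not_le less_imp_le)
      also have "\<dots> \<le> (\<integral>\<^sup>+x. ennreal (4 powr pp) * epowr (Y j x) (P x) \<partial>lebesgue)"
      proof (rule nn_integral_mono)
        fix x
        have "f j x * w x / ennreal (n j / 2) = 4 * Y j x"
        proof -
          have "inverse (ennreal (n j / 2)) = 4 * inverse (ennreal (2 * n j))"
          proof -
            have p: "0 < n j / 2" "0 < 2 * n j" using n(1)[of j] by auto
            have "ennreal (inverse (n j / 2)) = ennreal (4 * inverse (2 * n j))" by (simp add: field_simps)
            also have "\<dots> = ennreal 4 * ennreal (inverse (2 * n j))" using p by (intro ennreal_mult) auto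
            finally show ?thesis unfolding inverse_ennreal[OF p(1)] inverse_ennreal[OF p(2)] by simp
          qed
          then show ?thesis by (simp add: Y_def divide_ennreal_def ac_simps)
        qed
        then have "epowr (f j x * w x / ennreal (n j / 2)) (P x) = epowr 4 (P x) * epowr (Y j x) (P x)"
          using Px[of x] by (simp add: epowr_mult)
        also have "epowr 4 (P x) = ennreal (4 powr P x)" using epowr_ennreal[of 4 "P x"] by simp
        also have "ennreal (4 powr P x) \<le> ennreal (4 powr pp)"
          using P(2)[of x] by (intro ennreal_leI powr_mono) auto
        finally show "epowr (f j x * w x / ennreal (n j / 2)) (P x) \<le> ennreal (4 powr pp) * epowr (Y j x) (P x)"
          by (simp add: mult_right_mono)
      qed
      also have "\<dots> = ennreal (4 powr pp) * (\<integral>\<^sup>+x. epowr (Y j x) (P x) \<partial>lebesgue)"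
        by (rule nn_integral_cmult) measurable
      finally show ?thesis .
    qed
    define c where "c j = (1 / 2 :: real) ^ Suc j" for j
    have c: "0 < c j" "c j \<le> 1" for j
      unfolding c_def by (simp, rule power_le_one) auto
    \<comment> \<open>\<open>Y\<^sup>P\<^sup>-\<^sup>p\<^sup>s\<close> is extremal in the duality between the exponents \<open>P/ps\<close> and \<open>es\<close>.\<close>
    define h where "h x = (SUP j. ennreal (c j) * epowr (Y j x) (P x - ps))" for x
    have [measurable]: "h \<in> borel_measurable lebesgue" unfolding h_def by measurable
    have h_ge: "ennreal (c j) * epowr (Y j x) (P x - ps) \<le> h x" for j x
      unfolding h_def by (rule SUP_upper) simp
    have h_le: "epowr (h x) (es x) \<le> (\<Sum>j. ennreal (c j) * epowr (Y j x) (P x))" for x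
    proof (rule epowr_inverse_le)
      show "h x \<le> epowr (\<Sum>j. ennreal (c j) * epowr (Y j x) (P x)) (1 / es x)"
        unfolding h_def
      proof (rule SUP_least, rule le_epowr_inverse)
        fix j
        have ex: "(P x - ps) * es x = P x" using Px[of x] by (simp add: es_def)
        have "epowr (ennreal (c j) * epowr (Y j x) (P x - ps)) (es x) = epowr (ennreal (c j)) (es x) * epowr (Y j x) (P x)"
          using es[of x] by (simp add: epowr_mult epowr_epowr ex)
        also have "epowr (ennreal (c j)) (es x) \<le> epowr (ennreal (c j)) 1"
          using es[of x] c[of j] by (intro epowr_exponent_antimono) auto
        also have "epowr (ennreal (c j)) 1 * epowr (Y j x) (P x) = (\<Sum>i\<in>{j}. ennreal (c i) * epowr (Y i x) (P x))" by simp
        also have "\<dots> \<le> (\<Sum>j. ennreal (c j) * epowr (Y j x) (P x))"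
          by (rule sum_le_suminf) auto
        finally show "epowr (ennreal (c j) * epowr (Y j x) (P x - ps)) (es x) \<le> (\<Sum>j. ennreal (c j) * epowr (Y j x) (P x))"
          by (simp add: mult_right_mono)
      qed (use es[of x] in simp)
    qed (use es[of x] in simp)
    have int_h: "(\<integral>\<^sup>+x. epowr (h x) (es x) \<partial>lebesgue) \<le> 1"
    proof -
      have "(\<integral>\<^sup>+x. epowr (h x) (es x) \<partial>lebesgue) \<le> (\<integral>\<^sup>+x. (\<Sum>j. ennreal (c j) * epowr (Y j x) (P x)) \<partial>lebesgue)"
        by (intro nn_integral_mono h_le)
      also have "\<dots> = (\<Sum>j. ennreal (c j) * (\<integral>\<^sup>+x. epowr (Y j x) (P x) \<partial>lebesgue))"
        by (simp add: nn_integral_suminf nn_integral_cmult)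
      also have "\<dots> \<le> (\<Sum>j. ennreal (c j))"
        using Y_le mult_left_mono[OF Y_le] by (intro suminf_le allI) auto
      also have "\<dots> = ennreal 1"
        unfolding c_def using power_half_series by (intro suminf_ennreal_eq) auto
      finally show ?thesis by simp
    qed
    define \<psi> where "\<psi> x = epowr (h x) (1 / (\<delta> * b)) * epowr (w x) \<rho>" for x
    have [measurable]: "\<psi> \<in> borel_measurable lebesgue" unfolding \<psi>_def by measurable
    have \<psi>z: "AE x in lebesgue. \<psi> x * z x = epowr (h x) (1 / (\<delta> * b))"
      using w_AE
    proof eventually_elim
      case (elim x)
      have "epowr (w x) \<rho> * epowr (w x) (- \<rho>) = 1" using elim epowr_add[of "w x" \<rho> "- \<rho>"] by simp
      then show ?case by (simp add: \<psi>_def z_def mult.assoc)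
    qed
    have int_\<psi>: "(\<integral>\<^sup>+x. epowr (\<psi> x * z x) (E x) \<partial>lebesgue) \<le> 1"
    proof -
      have "(\<integral>\<^sup>+x. epowr (\<psi> x * z x) (E x) \<partial>lebesgue) = (\<integral>\<^sup>+x. epowr (h x) (es x) \<partial>lebesgue)"
      proof (rule nn_integral_cong_AE, use \<psi>z in eventually_elim)
        case (elim x)
        have "1 / (\<delta> * b) * E x = es x" using \<delta> b by (simp add: E_def)
        then show ?case unfolding elim epowr_epowr by simp
      qed
      then show ?thesis using int_h by simp
    qed
    define m where "m x = max (\<psi> x) (max_fun \<psi> x)" for x
    have [measurable]: "m \<in> borel_measurable lebesgue" unfolding m_def by measurable
    have D_fin: "(\<integral>\<^sup>+x. epowr (m x * z x) (E x) \<partial>lebesgue) < \<infinity>"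
      unfolding m_def
      by (rule variable_maximal_finite[OF _ E_bounds e1(1) e2_a1 locE decE t(1) e1(2) t_a2 _ int_\<psi>]) measurable
    then obtain D where D: "0 \<le> D" "(\<integral>\<^sup>+x. epowr (m x * z x) (E x) \<partial>lebesgue) = ennreal D"
      by (cases "\<integral>\<^sup>+x. epowr (m x * z x) (E x) \<partial>lebesgue") auto
    have m_fin: "AE x in lebesgue. m x < \<infinity>"
    proof -
      have "AE x in lebesgue. epowr (m x * z x) (E x) \<noteq> \<infinity>"
        using D_fin by (intro nn_integral_noteq_infinite) auto
      then show ?thesis using z_AE
      proof eventually_elim
        case (elim x)
        have "m x * z x \<noteq> \<infinity>" using elim(1) epowr_eq_top_iff[OF E0, of "m x * z x" x] by auto
        then show ?case using elim(2) by (cases "m x = \<infinity>") (auto simp: ennreal_top_mult less_top split: if_splits)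
      qed
    qed
    have \<psi>_nz: "\<not> (AE x in lebesgue. \<psi> x = 0)"
    proof
      assume "AE x in lebesgue. \<psi> x = 0"
      then have "AE x in lebesgue. epowr (Y 0 x) (P x) = 0" using \<psi>z
      proof eventually_elim
        case (elim x)
        then have "h x = 0" using \<delta> b by (simp add: epowr_eq_0_iff)
        then have "epowr (Y 0 x) (P x - ps) = 0" using h_ge[of 0 x] c[of 0] by simp
        then have "Y 0 x = 0" using Px[of x] by (simp add: epowr_eq_0_iff)
        then show ?case using Px[of x] by simp
      qed
      then have "(\<integral>\<^sup>+x. epowr (Y 0 x) (P x) \<partial>lebesgue) = 0" by (simp add: nn_integral_0_iff_AE)
      then show False using Y_ge[of 0] by simp
    qed
    define u where "u x = epowr (m x) \<delta>" for x
    have u: "A1_weight u"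
      unfolding u_def m_def using \<delta> \<psi>_nz m_fin by (intro A1_weight_majorant) (auto simp: m_def)
    obtain C where C: "0 < C" "\<And>f g. (f, g) \<in> F \<Longrightarrow> (\<integral>\<^sup>+x. epowr (f x) ps * epowr (u x) b \<partial>lebesgue) < \<infinity> \<Longrightarrow>
      (\<integral>\<^sup>+x. epowr (f x) ps * epowr (u x) b \<partial>lebesgue) \<le> ennreal C * (\<integral>\<^sup>+x. epowr (g x) ps * epowr (u x) b \<partial>lebesgue)"
      using limited_range_A1_weight[OF F q hyp u] unfolding family_ineq_def b_def by blast
    define H where "H x = epowr (m x * z x) (\<delta> * b)" for x
    have [measurable]: "H \<in> borel_measurable lebesgue" unfolding H_def by measurable
    have intH: "(\<integral>\<^sup>+x. epowr (H x) (es x) \<partial>lebesgue) = ennreal D"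
      unfolding H_def epowr_epowr E_def[symmetric] by (rule D)
    have H_ge: "AE x in lebesgue. h x \<le> H x"
      using \<psi>z
    proof eventually_elim
      case (elim x)
      have "h x = epowr (\<psi> x * z x) (\<delta> * b)" unfolding elim epowr_epowr using \<delta> b by simp
      also have "\<dots> \<le> H x" unfolding H_def using \<delta> b by (intro epowr_mono mult_right_mono) (auto simp: m_def)
      finally show ?case .
    qed
    have transfer: "(\<integral>\<^sup>+x. epowr (y x) ps * epowr (u x) b \<partial>lebesgue) = (\<integral>\<^sup>+x. epowr (y x * w x) ps * H x \<partial>lebesgue)"
      for y :: "real ^ 'n \<Rightarrow> ennreal"
    proof (rule nn_integral_cong_AE, use w_AE in eventually_elim)
      case (elim x)
      have "H x = epowr (u x) b * epowr (w x) (- \<rho> * (\<delta> * b))"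
        unfolding H_def u_def z_def using \<delta> b by (simp only: epowr_mult[OF mult_nonneg_nonneg] less_imp_le epowr_epowr)
      also have "- \<rho> * (\<delta> * b) = - ps" using \<rho> by simp
      finally have "epowr (y x * w x) ps * H x = epowr (y x) ps * epowr (u x) b * (epowr (w x) ps * epowr (w x) (- ps))"
        using ps0 by (simp add: epowr_mult ac_simps)
      moreover have "epowr (w x) ps * epowr (w x) (- ps) = 1" using elim epowr_add[of "w x" ps "- ps"] by simp
      ultimately show ?case by simp
    qed
    have upper: "(\<integral>\<^sup>+x. epowr (y x) ps * epowr (u x) b \<partial>lebesgue) \<le> ennreal (k powr ps * (1 + D))"
      if [measurable]: "y \<in> borel_measurable lebesgue" and k: "N y < ennreal k" "0 < k" for y k
    proof -
      have mod: "(\<integral>\<^sup>+x. epowr (y x * w x / ennreal k) (P x) \<partial>lebesgue) \<le> 1"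
        using var_modular_le_one[of P "\<lambda>x. y x * w x" k] k Px unfolding N_def var_modular_finite_exponent by auto
      have "(\<integral>\<^sup>+x. epowr (y x * w x) ps * H x \<partial>lebesgue) \<le>
        (\<integral>\<^sup>+x. ennreal (k powr ps) * (epowr (y x * w x / ennreal k) (P x) + epowr (H x) (es x)) \<partial>lebesgue)"
      proof (rule nn_integral_mono)
        fix x
        let ?X = "y x * w x / ennreal k"
        have "y x * w x = ennreal k * ?X"
          using k by (simp add: ennreal_times_divide mult.commute[of "ennreal k"] mult_divide_eq_ennreal)
        then have "epowr (y x * w x) ps * H x = ennreal (k powr ps) * (epowr ?X ps * H x)"
          using ps0 k epowr_mult[of ps "ennreal k" ?X] by (simp add: epowr_ennreal mult.assoc)
        moreover have "epowr ?X ps * H x \<le> epowr ?X (P x) + epowr (H x) (es x)"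
        proof -
          have th: "0 < ps / P x" "ps / P x < 1" using Px[of x] ps0 by auto
          have "P x * (ps / P x) = ps" "es x * (1 - ps / P x) = 1"
            using Px[of x] by (auto simp: es_def field_simps)
          then have "epowr ?X ps * H x = epowr (epowr ?X (P x)) (ps / P x) * epowr (epowr (H x) (es x)) (1 - ps / P x)"
            by (simp only: epowr_epowr epowr_one_right)
          also have "\<dots> \<le> ennreal (ps / P x) * epowr ?X (P x) + ennreal (1 - ps / P x) * epowr (H x) (es x)"
            by (rule epowr_young[OF th])
          also have "\<dots> \<le> ennreal 1 * epowr ?X (P x) + ennreal 1 * epowr (H x) (es x)"
            using th by (intro add_mono mult_right_mono ennreal_leI) auto
          finally show ?thesis by simp
        qed
        ultimately show "epowr (y x * w x) ps * H x \<le> ennreal (k powr ps) * (epowr ?X (P x) + epowr (H x) (es x))"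
          by (simp add: mult_left_mono)
      qed
      also have "\<dots> = ennreal (k powr ps) * ((\<integral>\<^sup>+x. epowr (y x * w x / ennreal k) (P x) \<partial>lebesgue) + ennreal D)"
        by (simp add: nn_integral_cmult nn_integral_add intH)
      also have "\<dots> \<le> ennreal (k powr ps) * (1 + ennreal D)" by (intro mult_left_mono add_right_mono mod) simp
      also have "\<dots> = ennreal (k powr ps * (1 + D))" using D(1) by (simp add: ennreal_mult ennreal_plus)
      finally show ?thesis by (simp add: transfer)
    qed
    have lower: "ennreal (c j * (2 * n j) powr ps / 4 powr pp) \<le> (\<integral>\<^sup>+x. epowr (f j x) ps * epowr (u x) b \<partial>lebesgue)" for j
    proof -
      have "ennreal (c j * (2 * n j) powr ps) * (\<integral>\<^sup>+x. epowr (Y j x) (P x) \<partial>lebesgue) = (\<integral>\<^sup>+x. ennreal (c j * (2 * n j) powr ps) * epowr (Y j x) (P x) \<partial>lebesgue)"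
        by (rule nn_integral_cmult[symmetric]) measurable
      also have "\<dots> \<le> (\<integral>\<^sup>+x. epowr (f j x * w x) ps * H x \<partial>lebesgue)"
      proof (rule nn_integral_mono_AE, use H_ge in eventually_elim)
        case (elim x)
        have "f j x * w x = ennreal (2 * n j) * Y j x"
          using n(1)[of j] unfolding Y_def by (simp add: ennreal_times_divide mult.commute[of "ennreal (2 * n j)"] mult_divide_eq_ennreal)
        then have eq: "epowr (f j x * w x) ps = ennreal ((2 * n j) powr ps) * epowr (Y j x) ps"
          using ps0 n(1)[of j] epowr_mult[of ps "ennreal (2 * n j)" "Y j x"] by (simp add: epowr_ennreal)
        have "epowr (Y j x) (P x) = epowr (Y j x) ps * epowr (Y j x) (P x - ps)"
          using epowr_add_nonneg[of ps "P x - ps" "Y j x"] ps0 Px[of x] by simp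
        then have "ennreal (c j * (2 * n j) powr ps) * epowr (Y j x) (P x) = epowr (f j x * w x) ps * (ennreal (c j) * epowr (Y j x) (P x - ps))"
          unfolding eq using c[of j] by (subst ennreal_mult) (auto simp: ac_simps)
        also have "\<dots> \<le> epowr (f j x * w x) ps * H x"
          using h_ge[of j x] elim by (intro mult_left_mono) auto
        finally show ?case .
      qed
      finally have *: "ennreal (c j * (2 * n j) powr ps) * (\<integral>\<^sup>+x. epowr (Y j x) (P x) \<partial>lebesgue) \<le> (\<integral>\<^sup>+x. epowr (f j x) ps * epowr (u x) b \<partial>lebesgue)"
        by (simp add: transfer)
      have "ennreal (c j * (2 * n j) powr ps / 4 powr pp) * 1 \<le> ennreal (c j * (2 * n j) powr ps / 4 powr pp) * (ennreal (4 powr pp) * (\<integral>\<^sup>+x. epowr (Y j x) (P x) \<partial>lebesgue))"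
        by (intro mult_left_mono Y_ge) simp
      also have "\<dots> = ennreal (c j * (2 * n j) powr ps) * (\<integral>\<^sup>+x. epowr (Y j x) (P x) \<partial>lebesgue)"
        using c[of j] by (simp add: mult.assoc[symmetric] ennreal_mult[symmetric])
      finally show ?thesis using * by simp
    qed
    define B where "B = (C * (1 + D) * 4 powr pp * 2) powr (1 / ps)"
    have bound: "n j \<le> B * (2 powr (1 / ps)) ^ j * k" if k: "N (g j) < ennreal k" "0 < k" for j k
    proof -
      have "(\<integral>\<^sup>+x. epowr (f j x) ps * epowr (u x) b \<partial>lebesgue) < \<infinity>"
        using upper[of "f j" "2 * n j"] n[of j] by (auto simp: ennreal_less_iff intro: le_less_trans)
      then have "(\<integral>\<^sup>+x. epowr (f j x) ps * epowr (u x) b \<partial>lebesgue) \<le> ennreal C * (\<integral>\<^sup>+x. epowr (g j x) ps * epowr (u x) b \<partial>lebesgue)"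
        using fg[of j] by (intro C(2)) auto
      also have "\<dots> \<le> ennreal C * ennreal (k powr ps * (1 + D))"
        using k by (intro mult_left_mono upper) auto
      finally have "ennreal (c j * (2 * n j) powr ps / 4 powr pp) \<le> ennreal C * ennreal (k powr ps * (1 + D))"
        using lower[of j] by simp
      then have "c j * (2 * n j) powr ps / 4 powr pp \<le> C * (k powr ps * (1 + D))"
        using C(1) D(1) by (simp add: ennreal_mult[symmetric])
      then have "(2 * n j) powr ps \<le> C * (1 + D) * 4 powr pp * k powr ps * 2 ^ Suc j"
        by (simp add: c_def power_one_over field_simps)
      moreover have "n j powr ps \<le> (2 * n j) powr ps" using n(1)[of j] ps0 by (intro powr_mono2) auto
      ultimately have "n j powr ps \<le> (C * (1 + D) * 4 powr pp * 2) * 2 ^ j * k powr ps"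
        by (simp add: algebra_simps)
      then have "(n j powr ps) powr (1 / ps) \<le> ((C * (1 + D) * 4 powr pp * 2) * 2 ^ j * k powr ps) powr (1 / ps)"
        using ps0 by (intro powr_mono2) auto
      then show ?thesis
        using n(1)[of j] ps0 k by (simp add: powr_mult powr_powr B_def powr_realpow[symmetric] mult.commute)
    qed
    have "N (f j) \<le> ennreal (B * (2 powr (1 / ps)) ^ j) * N (g j)" for j
    proof -
      have "N (g j) < \<infinity>" using fg[of j] by (auto intro: less_trans)
      then obtain y where y: "0 \<le> y" "N (g j) = ennreal y" by (cases "N (g j)") auto
      let ?K = "B * (2 powr (1 / ps)) ^ j"
      have B: "0 < B" using C(1) D(1) by (auto simp: B_def)
      then have K: "0 < ?K" by simp
      have "n j \<le> ?K * y"
      proof (rule field_le_epsilon)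
        fix e :: real assume e: "0 < e"
        have "n j \<le> ?K * (y + e / ?K)"
          using e y K by (intro bound) (auto simp: ennreal_less_iff add_nonneg_pos)
        also have "\<dots> = ?K * y + e" using B by (simp add: distrib_left)
        finally show "n j \<le> ?K * y + e" .
      qed
      then show ?thesis using y K n[of j] by (simp add: ennreal_mult[symmetric] ennreal_leI)
    qed
    then show "\<exists>C. \<forall>j. N (f j) \<le> ennreal (C * (2 powr (1 / ps)) ^ j) * N (g j)" by blast
  qed
  then show ?thesis by (simp add: N_def[abs_def])
qed

section \<open>Choice of the parameters\<close>

text \<open>The constant \<open>k\<close> must be small for two reasons: the exponent \<open>p(\<cdot>) / (k \<sigma>)\<close> has to exceed \<open>1\<close>, and
  the positive power mean of the weight, whose exponent is \<open>p\<^sub>- / k\<close>, has to be strong enough for the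
  maximal operator.  The auxiliary \<open>\<delta>\<close> and \<open>t\<close> are those of \<open>variable_extrapolation\<close>.\<close>

definition admissible :: "real \<Rightarrow> real \<Rightarrow> real \<Rightarrow> real \<Rightarrow> real \<Rightarrow> real \<Rightarrow> bool" where
  "admissible pm pp qm qp ps k \<longleftrightarrow> 0 < k \<and> k < 1 \<and> k * (ps * qm / (ps - qm)) < pm \<and>
     (\<exists>\<delta> t. 0 < \<delta> \<and> \<delta> < 1 \<and> 1 < t \<and> t < \<delta> * (1 - ps / qp) * (pp / (pp - ps)) \<and>
        t / (t - 1) \<le> pm / k * \<delta> * (1 - ps / qp) / ps)"

lemma admissible_exists:
  assumes q: "0 < qm" "qm < ps" "ps < pm" "pm \<le> pp" "pp < qp"
  shows "\<exists>k. admissible pm pp qm qp ps k"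
proof -
  define B where "B = (1 - ps / qp) * (pp / (pp - ps))"
  have b: "0 < 1 - ps / qp" using q by simp
  \<comment> \<open>This is where \<open>pp < qp\<close> enters.\<close>
  have B: "1 < B"
  proof -
    have "ps * pp < ps * qp" using q by simp
    then have "qp * (pp - ps) < (qp - ps) * pp" by (simp add: algebra_simps)
    then show ?thesis using q by (simp add: B_def field_simps)
  qed
  define \<delta> where "\<delta> = (1 / B + 1) / 2"
  have \<delta>: "0 < \<delta>" "\<delta> < 1" "1 < \<delta> * B" using B by (auto simp: \<delta>_def field_simps)
  define t where "t = (1 + \<delta> * B) / 2"
  have mid: "1 < (1 + x) / 2" "(1 + x) / 2 < x" if "1 < x" for x :: real using that by auto
  have t: "1 < t" and t_less: "t < \<delta> * B" unfolding t_def by (rule mid[OF \<delta>(3)])+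
  define \<sigma> where "\<sigma> = ps * qm / (ps - qm)"
  have \<sigma>: "0 < \<sigma>" using q by (simp add: \<sigma>_def)
  define d where "d = pm * \<delta> * (1 - ps / qp) / (ps * (t / (t - 1)))"
  have d: "0 < d" using q b \<delta> t by (simp add: d_def)
  define k where "k = min (1 / 2) (min (pm / (2 * \<sigma>)) d)"
  have k: "0 < k" "k \<le> 1 / 2" "k \<le> pm / (2 * \<sigma>)" "k \<le> d" using q \<sigma> d by (auto simp: k_def)
  have "k * \<sigma> < pm"
  proof -
    have "k * \<sigma> \<le> pm / (2 * \<sigma>) * \<sigma>" using k \<sigma> by (intro mult_right_mono) auto
    also have "\<dots> < pm" using q \<sigma> by simp
    finally show ?thesis .
  qed
  moreover have "t / (t - 1) \<le> pm / k * \<delta> * (1 - ps / qp) / ps"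
  proof -
    have T: "0 < ps * (t / (t - 1))" using q t by simp
    have "k * (ps * (t / (t - 1))) \<le> d * (ps * (t / (t - 1)))"
      using k T by (intro mult_right_mono) auto
    also have "\<dots> = pm * \<delta> * (1 - ps / qp)"
    proof -
      have "x / y * y = x" if "0 < y" for x y :: real using that by simp
      then show ?thesis unfolding d_def using T by blast
    qed
    finally have "t / (t - 1) * (ps * k) \<le> pm * \<delta> * (1 - ps / qp)" by (simp only: ac_simps)
    then have "t / (t - 1) \<le> pm * \<delta> * (1 - ps / qp) / (ps * k)"
      using q k by (subst pos_le_divide_eq) auto
    then show ?thesis by (simp add: ac_simps)
  qed
  moreover have "\<delta> * B = \<delta> * (1 - ps / qp) * (pp / (pp - ps))" by (simp add: B_def)
  ultimately have "admissible pm pp qm qp ps k"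
    unfolding admissible_def using k \<delta> t t_less by (auto simp: \<sigma>_def)
  then show ?thesis ..
qed

section \<open>Exponents in the class \<open>LH\<close>\<close>

text \<open>A log-Hoelder continuous function is continuous, and every ball has positive measure.\<close>

lemma log_Holder_AE_bound:
  fixes P :: "real ^ 'n \<Rightarrow> real"
  assumes loc: "log_Holder_local C P" and AE: "AE x in lebesgue. b \<le> P x"
  shows "b \<le> P x"
proof (rule ccontr)
  assume "\<not> b \<le> P x"
  define e where "e = b - P x"
  have e: "0 < e" using \<open>\<not> b \<le> P x\<close> by (simp add: e_def)
  have C: "0 < C" using loc by (simp add: log_Holder_local_def)
  define \<rho> where "\<rho> = min (1 / 2) (exp (- (C / e)))"
  have \<rho>: "0 < \<rho>" by (simp add: \<rho>_def)
  obtain y where y: "y \<in> ball x \<rho>" "b \<le> P y" using ball_ex_AE[OF AE \<rho>] by blast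
  then have "y \<noteq> x" using e by (auto simp: e_def)
  then have d: "0 < dist x y" "dist x y < 1 / 2" "dist x y < exp (- (C / e))" using y by (auto simp: \<rho>_def)
  have "ln (dist x y) < - (C / e)" using d by (metis exp_gt_zero ln_exp ln_less_cancel_iff)
  then have *: "C / e < - ln (dist x y)" by simp
  moreover have "0 < C / e" using C e by simp
  ultimately have "0 < - ln (dist x y)" by (rule less_trans[rotated])
  then have "C / (- ln (dist x y)) < e" using * e by (simp add: field_simps)
  moreover have "\<bar>P x - P y\<bar> \<le> C / (- ln (dist x y))" using loc d by (simp add: log_Holder_local_def)
  ultimately have "P y < b" by (simp add: e_def abs_if split: if_splits)
  then show False using y by simp
qed

lemma LH_real_exponent:
  fixes p :: "real ^ 'n \<Rightarrow> ereal"
  assumes p: "p \<in> LH"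
  obtains P C0 Ci l where "p = (\<lambda>x. ereal (P x))" "P \<in> borel_measurable lebesgue"
    "log_Holder_local C0 P" "log_Holder_decay Ci l P"
proof -
  from p obtain C0 Ci l where c: "p \<in> exponents" "0 < C0" "0 < Ci"
    and loc: "\<And>x y. dist x y < 1 / 2 \<Longrightarrow> \<bar>p x - p y\<bar> \<le> ereal (C0 / (- ln (dist x y)))"
    and dec: "\<And>x. \<bar>p x - ereal l\<bar> \<le> ereal (Ci / ln (exp 1 + norm x))"
    unfolding LH_def by blast
  have [measurable]: "p \<in> borel_measurable lebesgue" using c(1) by (simp add: exponents_def)
  define P where "P x = real_of_ereal (p x)" for x
  have eq: "p x = ereal (P x)" for x
    using dec[of x] by (cases "p x") (auto simp: P_def)
  show thesis
  proof
    show "p = (\<lambda>x. ereal (P x))" using eq by blast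
    show "P \<in> borel_measurable lebesgue" unfolding P_def by measurable
    show "log_Holder_local C0 P"
      using loc c unfolding eq log_Holder_local_def by simp
    show "log_Holder_decay Ci l P"
      using dec c unfolding eq log_Holder_decay_def by simp
  qed
qed

lemma LH_bounds:
  fixes P :: "real ^ 'n \<Rightarrow> real"
  assumes loc: "log_Holder_local C P" and P_meas [measurable]: "P \<in> borel_measurable lebesgue"
    and lo: "ereal qm < p_minus (\<lambda>x. ereal (P x))" and le: "p_minus (\<lambda>x. ereal (P x)) \<le> p_plus (\<lambda>x. ereal (P x))"
    and hi: "p_plus (\<lambda>x. ereal (P x)) < ereal qp"
  obtains pm pp where "p_minus (\<lambda>x. ereal (P x)) = ereal pm" "p_plus (\<lambda>x. ereal (P x)) = ereal pp"
    "qm < pm" "pm \<le> pp" "pp < qp" "\<And>x. pm \<le> P x" "\<And>x. P x \<le> pp"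
proof -
  let ?a = "p_minus (\<lambda>x. ereal (P x))" and ?b = "p_plus (\<lambda>x. ereal (P x))"
  obtain pm where pm: "?a = ereal pm"
    using lo order_le_less_trans[OF le hi] by (cases ?a) simp_all
  obtain pp where pp: "?b = ereal pp"
    using order_less_le_trans[OF lo le] hi by (cases ?b) simp_all
  have "?a \<le> ereal (P x)" for x
    unfolding p_minus_def
  proof (rule Sup_least)
    fix z assume "z \<in> {z. AE y in lebesgue. z \<le> ereal (P y)}"
    then have z: "AE y in lebesgue. z \<le> ereal (P y)" by (rule CollectD)
    show "z \<le> ereal (P x)"
    proof (cases z)
      case (real r)
      have "AE y in lebesgue. r \<le> P y" using z unfolding real by (simp only: ereal_less_eq)
      then show ?thesis unfolding real ereal_less_eq by (rule log_Holder_AE_bound[OF loc])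
    next
      case PInf
      have "AE y :: real ^ 'n in lebesgue. False" using z unfolding PInf by (rule eventually_mono) simp
      from ball_ex_AE[OF this zero_less_one, of 0] show ?thesis by blast
    qed simp
  qed
  then have lower: "pm \<le> P x" for x unfolding pm by simp
  have "AE x in lebesgue. ereal (P x) \<le> ?b" unfolding p_plus_def by (rule esssup_AE)
  then have "AE x in lebesgue. - pp \<le> - P x" unfolding pp by simp
  moreover have "log_Holder_local C (\<lambda>x. - P x)" using loc by (simp add: log_Holder_local_def abs_minus_commute)
  ultimately have "- pp \<le> - P x" for x by (intro log_Holder_AE_bound)
  then have upper: "P x \<le> pp" for x by simp
  show thesis
  proof
    show "?a = ereal pm" "?b = ereal pp" by (rule pm pp)+
    show "qm < pm" "pm \<le> pp" "pp < qp" using lo le hi unfolding pm pp by auto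
  qed (rule lower upper)+
qed

section \<open>The theorem\<close>

theorem theorem2p13:
  shows "\<exists>c :: real \<Rightarrow> real \<Rightarrow> real \<Rightarrow> real \<Rightarrow> real \<Rightarrow> real.
    \<forall>(F :: ((real ^ 'n::finite \<Rightarrow> ennreal) \<times> (real ^ 'n \<Rightarrow> ennreal)) set) (qm :: real) (qp :: real).
      (\<forall>(f, g)\<in>F. f \<in> borel_measurable lebesgue \<and> g \<in> borel_measurable lebesgue) \<and>
      1 < qm \<and> qm < qp \<and>
      (\<exists>p0. qm < p0 \<and> p0 < qp \<and>
        (\<forall>w0 \<in> A_const (p0 / qm) \<inter> RH (conj_exp (qp / p0)).
           family_ineq F (\<lambda>h. \<integral>\<^sup>+ x. epowr (h x) p0 * w0 x \<partial>lebesgue)))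
      \<longrightarrow>
      (\<forall>p \<in> LH. ereal qm < p_minus p \<and> p_minus p \<le> p_plus p \<and> p_plus p < ereal qp \<longrightarrow>
         family_ineq F (var_norm p)) \<and>
      (\<forall>p \<in> LH. ereal qm < p_minus p \<and> p_minus p \<le> p_plus p \<and> p_plus p < ereal qp \<longrightarrow>
         (\<exists>ps. qm < ps \<and> ps < qp \<and>
           (let \<sigma> = ps * qm / (ps - qm);
                k = c (real_of_ereal (p_minus p)) (real_of_ereal (p_plus p)) qm qp ps
            in 0 < k \<and> k < 1 \<and>
               (\<lambda>x. p x / ereal (k * \<sigma>)) \<in> exponents \<and>
               (\<forall>w. weight w \<and>
                    (\<lambda>x. epowr (w x) \<sigma>) \<in> A_var (\<lambda>x. p x / ereal (k * \<sigma>)) \<longrightarrow>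
                  family_ineq F (\<lambda>h. var_norm p (\<lambda>x. h x * w x))))))"
proof (intro exI[of _ "\<lambda>pm pp qm qp ps. SOME k. admissible pm pp qm qp ps k"] allI impI, goal_cases)
  case (1 F qm qp)
  then obtain p0 where F: "\<forall>(f, g)\<in>F. f \<in> borel_measurable lebesgue \<and> g \<in> borel_measurable lebesgue"
    and qm: "1 < qm" and p0: "qm < p0" "p0 < qp"
    and hyp: "\<forall>w0 \<in> A_const (p0 / qm) \<inter> RH (conj_exp (qp / p0)).
           family_ineq F (\<lambda>h. \<integral>\<^sup>+ x. epowr (h x) p0 * w0 x \<partial>lebesgue)"
    by blast
  have main: "family_ineq F (var_norm p) \<and>
      (\<exists>ps. qm < ps \<and> ps < qp \<and>
           (let \<sigma> = ps * qm / (ps - qm);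
                k = (SOME k. admissible (real_of_ereal (p_minus p)) (real_of_ereal (p_plus p)) qm qp ps k)
            in 0 < k \<and> k < 1 \<and>
               (\<lambda>x. p x / ereal (k * \<sigma>)) \<in> exponents \<and>
               (\<forall>w. weight w \<and>
                    (\<lambda>x. epowr (w x) \<sigma>) \<in> A_var (\<lambda>x. p x / ereal (k * \<sigma>)) \<longrightarrow>
                  family_ineq F (\<lambda>h. var_norm p (\<lambda>x. h x * w x)))))"
    if p: "p \<in> LH" and pq: "ereal qm < p_minus p \<and> p_minus p \<le> p_plus p \<and> p_plus p < ereal qp" for p
  proof -
    obtain P C0 Ci l where peq: "p = (\<lambda>x. ereal (P x))" and P_meas [measurable]: "P \<in> borel_measurable lebesgue"
      and loc: "log_Holder_local C0 P" and dec: "log_Holder_decay Ci l P"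
      using p by (rule LH_real_exponent)
    obtain pm pp where pmp: "p_minus p = ereal pm" "p_plus p = ereal pp"
      "qm < pm" "pm \<le> pp" "pp < qp" "\<And>x. pm \<le> P x" "\<And>x. P x \<le> pp"
      using LH_bounds[OF loc P_meas] pq unfolding peq by metis
    \<comment> \<open>the harmonic mean of \<open>qm\<close> and \<open>pm\<close>\<close>
    define hm where "hm = 2 * qm * pm / (qm + pm)"
    have hm: "qm < hm" "hm < pm"
    proof -
      have "qm * (qm + pm) < 2 * qm * pm" using qm pmp(3) by simp
      then show "qm < hm" using qm pmp(3) by (simp add: hm_def pos_less_divide_eq)
      have "2 * qm * pm < pm * (qm + pm)" using qm pmp(3) by (simp add: algebra_simps)
      then show "hm < pm" using qm pmp(3) by (simp add: hm_def pos_divide_less_eq)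
    qed
    have "qm < min p0 hm" using p0 hm by simp
    from dense[OF this] obtain ps where "qm < ps" "ps < min p0 hm" by blast
    then have ps: "qm < ps" "ps < p0" "ps < hm" by simp_all
    have harm: "ps * (qm + pm) < 2 * qm * pm"
      using ps(3) qm pmp(3) by (simp add: hm_def pos_less_divide_eq)
    have ps': "ps < pm" "0 < qm" "0 < ps" using ps hm qm by auto
    define k where "k = (SOME k. admissible pm pp qm qp ps k)"
    have "admissible pm pp qm qp ps k"
      unfolding k_def by (rule someI_ex[OF admissible_exists[OF ps'(2) ps(1) ps'(1) pmp(4,5)]])
    then obtain \<delta> t where k: "0 < k" "k < 1" "k * (ps * qm / (ps - qm)) < pm"
      and \<delta>: "0 < \<delta>" "\<delta> < 1" and t: "1 < t" "t < \<delta> * (1 - ps / qp) * (pp / (pp - ps))"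
        "t / (t - 1) \<le> pm / k * \<delta> * (1 - ps / qp) / ps"
      unfolding admissible_def by blast
    define \<sigma> where "\<sigma> = ps * qm / (ps - qm)"
    have \<sigma>: "0 < \<sigma>" using ps ps' by (simp add: \<sigma>_def)
    have \<alpha>: "0 < pm / k" using k pmp(3) qm by simp
    note extrapolation = variable_extrapolation[OF F hyp ps'(2) ps(1,2) p0(2) P_meas pmp(6,7) ps'(1) loc dec \<sigma>_def harm \<delta> t(1,2) \<alpha> t(3)]
    have unweighted: "family_ineq F (var_norm p)"
    proof -
      have "family_ineq F (\<lambda>h. var_norm (\<lambda>x. ereal (P x)) (\<lambda>x. h x * 1))"
        by (rule extrapolation[where A = 1]) (auto simp: ball_avg_const)
      then show ?thesis by (simp add: peq)
    qed
    define r where "r x = P x / (k * \<sigma>)" for x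
    have k\<sigma>: "0 < k * \<sigma>" "k * \<sigma> < pm" using k(1,3) \<sigma> unfolding \<sigma>_def[symmetric] by (simp_all only: mult_pos_pos)
    have req: "(\<lambda>x. p x / ereal (k * \<sigma>)) = (\<lambda>x. ereal (r x))"
      using k(1) \<sigma> by (simp add: peq r_def)
    define r1 where "r1 = pm / (k * \<sigma>)"
    have r: "1 < r1" "r1 \<le> r x" "r x \<le> pp / (k * \<sigma>)" for x
      using k\<sigma> pmp(6)[of x] pmp(7)[of x] by (auto simp: r1_def r_def divide_right_mono)
    have [measurable]: "r \<in> borel_measurable lebesgue" unfolding r_def by measurable
    have exps: "(\<lambda>x. p x / ereal (k * \<sigma>)) \<in> exponents"
    proof -
      have "1 \<le> r x" for x using r(1) r(2)[of x] by simp
      then show ?thesis unfolding req exponents_def by simp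
    qed
    have weighted: "family_ineq F (\<lambda>h. var_norm p (\<lambda>x. h x * w x))"
      if w: "weight w" "(\<lambda>x. epowr (w x) \<sigma>) \<in> A_var (\<lambda>x. p x / ereal (k * \<sigma>))" for w
    proof -
      have w_meas: "w \<in> borel_measurable lebesgue" using w(1) by (simp add: weight_def)
      have "AE x in lebesgue. 0 < epowr (w x) \<sigma> \<and> epowr (w x) \<sigma> < \<infinity>" using w(2) by (simp add: A_var_def)
      then have w_AE: "AE x in lebesgue. 0 < w x \<and> w x < \<infinity>"
      proof eventually_elim
        case (elim x)
        then show ?case using \<sigma> by (cases "w x" rule: ennreal_zero_top_pos_cases) auto
      qed
      define K where "K = 1 / (k * \<sigma>)"
      have K: "0 < K" using k\<sigma> by (simp add: K_def)
      have Lip: "\<bar>u / (k * \<sigma>) - v / (k * \<sigma>)\<bar> \<le> K * \<bar>u - v\<bar>" for u v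
        using k\<sigma> by (simp add: K_def diff_divide_distrib[symmetric] abs_divide)
      have locr: "log_Holder_local (K * C0) r"
        using loc K by (rule log_Holder_local_Lipschitz) (simp add: r_def Lip)
      have decr: "log_Holder_decay (K * Ci) (l / (k * \<sigma>)) r"
        using dec K by (rule log_Holder_decay_Lipschitz) (simp add: r_def Lip)
      obtain A where A: "0 < A" "\<And>a \<rho>. 0 < \<rho> \<Longrightarrow> epowr (ball_avg a \<rho> (\<lambda>x. epowr (epowr (w x) \<sigma>) r1)) (1 / r1) *
          ball_avg a \<rho> (\<lambda>x. inverse (epowr (w x) \<sigma>)) \<le> ennreal A"
        using A_var_imp_power_means[OF w(2)[unfolded req] _ r(2,3,1) locr decr] by auto
      have "family_ineq F (\<lambda>h. var_norm (\<lambda>x. ereal (P x)) (\<lambda>x. h x * w x))"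
      proof (rule extrapolation[OF w_meas w_AE, where A = "A powr (1 / \<sigma>)"])
        show "0 < A powr (1 / \<sigma>)" using A by simp
        fix a :: "real ^ 'n" and \<rho> :: real assume \<rho>: "0 < \<rho>"
        have ex: "\<sigma> * r1 = pm / k" "1 / r1 * (1 / \<sigma>) = 1 / (pm / k)"
          using \<sigma> k by (auto simp: r1_def)
        have inv: "inverse (epowr (w x) \<sigma>) = epowr (w x) (- \<sigma>)" for x
          using epowr_inverse[of "epowr (w x) \<sigma>" 1] by (simp add: epowr_epowr)
        have "epowr (ball_avg a \<rho> (\<lambda>x. epowr (w x) (pm / k))) (1 / (pm / k)) * epowr (ball_avg a \<rho> (\<lambda>x. epowr (w x) (- \<sigma>))) (1 / \<sigma>)
          = epowr (epowr (ball_avg a \<rho> (\<lambda>x. epowr (epowr (w x) \<sigma>) r1)) (1 / r1) * ball_avg a \<rho> (\<lambda>x. inverse (epowr (w x) \<sigma>))) (1 / \<sigma>)"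
          using \<sigma> by (simp only: epowr_mult divide_nonneg_pos zero_le_one epowr_epowr ex inv)
        also have "\<dots> \<le> epowr (ennreal A) (1 / \<sigma>)" using \<sigma> by (intro epowr_mono A(2) \<rho>) auto
        finally show "epowr (ball_avg a \<rho> (\<lambda>x. epowr (w x) (pm / k))) (1 / (pm / k)) * epowr (ball_avg a \<rho> (\<lambda>x. epowr (w x) (- \<sigma>))) (1 / \<sigma>) \<le> ennreal (A powr (1 / \<sigma>))"
          using A by (simp add: epowr_ennreal)
      qed
      then show ?thesis by (simp add: peq)
    qed
    have "ps < qp" using ps p0 by simp
    with unweighted exps weighted ps k have "family_ineq F (var_norm p) \<and> qm < ps \<and> ps < qp \<and> 0 < k \<and> k < 1 \<and>
        (\<lambda>x. p x / ereal (k * \<sigma>)) \<in> exponents \<and>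
        (\<forall>w. weight w \<and> (\<lambda>x. epowr (w x) \<sigma>) \<in> A_var (\<lambda>x. p x / ereal (k * \<sigma>)) \<longrightarrow>
           family_ineq F (\<lambda>h. var_norm p (\<lambda>x. h x * w x)))" by blast
    then show ?thesis
      unfolding Let_def pmp(1,2) real_of_ereal.simps k_def \<sigma>_def by blast
  qed
  show ?case using main by blast
qed

end
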